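(* Let $L>0$, $Y\in(0,L)$, $\lambda_1\ge0$, and let $\{t_i\}_{i\ge1}$ be a sequence of times with $t_1=0$, $t_{i+1}>t_i$, for which there are $\bar T_1,\bar T_2>0$ such that $t_{2k}-t_{2k-1}=\bar T_1$ and $t_{2k+1}-t_{2k}=\bar T_2$ for all $k\in\{1,2,\dots\}$. Put $I_1:=\bigcup_{k\ge1}[t_{2k-1},t_{2k})$ and $I_2:=\bigcup_{k\ge1}[t_{2k},t_{2k+1})$. Consider $$u_t=-uu_x-\lambda_1u_{xx}-u_{xxxx},\qquad x\in[0,L],$$ under $(u_x(L),u_x(Y),u_x(0))=(0,0,0)$ and $(u(0),u(Y),u(L))=(u_1,u_2,u_3)$, and let $w,v$ be the restrictions of $u$ to $[0,Y]$ and $[Y,L]$. Let $\Sigma_1^{cl}$ be the closed-loop system obtained with $u_3=u_2=0$, $u_1=\kappa_1(V_1,w_{xxx}(0))$ on $I_1$, and with $u_3=0$, $u_1=u_2=\kappa_2\big(\alpha_2^{1/3}V_2(t_{2k}),v_{xxx}(Y)\big)$ on each interval $[t_{2k},t_{2k+1})\subset I_2$, where $V_1,V_2,\kappa_1,\kappa_2$ (depending on the free design parameters $\alpha_1,\alpha_2>0$) are defined in the context. Then, with $\|\cdot\|$ the norm of $L^2(0,L)$: (i) the trivial solution of $\Sigma_1^{cl}$ is $\mathcal L^2$ practically semi-globally attractive: for each $\beta>\epsilon>0$ there exists $\alpha_2^\star>0$ such that for each $\alpha_2\ge\alpha_2^\star$ there exists $\alpha_1^\star$ such that for each $\alpha_1\ge\alpha_1^\star$,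 for every solution $u$ of $\Sigma_1^{cl}$ with $\|u(t_o)\|\le\beta$ there exists $T>0$ such that $\|u(t_o+T)\|\le\epsilon$; (ii) $\Sigma_1^{cl}$ is $\mathcal L^2$ semi-globally bounded: for each $\beta>0$ there exist $\gamma>0$ and $\alpha_2^\star>0$ such that for each $\alpha_2\ge\alpha_2^\star$ there exists $\alpha_1^\star$ such that for each $\alpha_1\ge\alpha_1^\star$, every solution $u$ of $\Sigma_1^{cl}$ with $\|u(t_o)\|\le\beta$ satisfies $\|u(t_o+t)\|\le\gamma$ for all $t\ge0$; (iii) $\Sigma_1^{cl}$ is $\mathcal L^2$ semi-globally ultimately bounded: there exists $\gamma>0$ such that for each $\beta>0$ there exists $\alpha_2^\star>0$ such that for each $\alpha_2\ge\alpha_2^\star$ there exists $\alpha_1^\star$ such that for each $\alpha_1\ge\alpha_1^\star$, for every solution $u$ of $\Sigma_1^{cl}$ with $\|u(t_o)\|\le\beta$ there exists $T>0$ such that $\|u(t_o+t)\|\le\gamma$ for all $t\ge T$.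
   Context: Sensing scenario: $u([0,Y],t)$ is available to the controller for $t\in I_1$ and $u([Y,L],t)$ is available for $t\in I_2$. Here $t_o\ge0$ denotes the initial time. Solutions. A pair $((w,v),\{u_i\}_{i=1}^3)$, with $w:[0,Y]\times D\to\mathbb R$, $v:[Y,L]\times D\to\mathbb R$, $u_i:D\to\mathbb R$ (common time domain $D$), is a solution pair of the split system if $(w(\cdot,t),v(\cdot,t))\in H^4(0,Y)\times H^4(Y,L)$; $(w(x,\cdot),v(x,\cdot))$ is locally absolutely continuous; the boundary conditions $w(Y)=v(Y)=u_2$, $w_x(Y)=v_x(Y)=0$, $w_x(0)=0$, $v_x(L)=0$, $w(0)=u_1$, $v(L)=u_3$ hold; and $w_t=-ww_x-\lambda_1w_{xx}-w_{xxxx}$ for almost all $(x,t)\in[0,Y]\times D$, $v_t=-vv_x-\lambda_1v_{xx}-v_{xxxx}$ for almost all $(x,t)\in[Y,L]\times D$. A solution $u$ of the equation on $[0,L]$ is a function equal to $w$ on $[0,Y]\times D$ and to $v$ on $[Y,L]\times D$ for such a pair. $V_1:=\frac12\int_0^Yw(x)^2dx$ and $V_2:=\frac12\int_Y^Lv(x)^2dx$ (functions of time). Constants. For an interval $[a,b]$, let $\delta_o$ be the smallest $\delta\in\mathbb R$ such that $z_{xxxx}+3\lambda_1z_{xx}=\delta z$ on $[a,b]$ has a nontrivial solution $z$ with $z(a)=z(b)=z_x(a)=z_x(b)=0$. Fix $\delta\in\mathbb R$ not larger than the value of $\delta_o$ for $[a,b]=[0,Y]$ and not larger than the value of $\delta_o$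 for $[a,b]=[Y,L]$. Put $\delta_1:=(|\delta|-2\delta)/3$ and $\delta_2:=(4|\delta|-2\delta)/3$. For $p\in\mathbb R$ let $\chi(x):=p+2p\left(\frac{x}{Y}\right)^3-3p\left(\frac{x}{Y}\right)^2$ on $[0,Y]$ (the cubic with $\chi(0)=p$, $\chi(Y)=0$, $\chi_x(0)=\chi_x(Y)=0$), and let $a_{w1},a_{w2},a_{w3}$ be the constants with $a_{w1}p^2=2\int_0^Y\chi_{xx}^2dx$, $a_{w2}p^2=\int_0^Y\chi^2dx$, $a_{w3}p^2=2\int_0^Y\chi_x^2dx$. Controller $\kappa_1$. Let $l_1(V_1):=V_1^2/3+(a_{w1}+\delta_2a_{w2}+\lambda_1a_{w3})V_1+(\alpha_1+2\delta_1)$ and let $k_1=k_1(V_1)$ satisfy $k_1^3+3(a_{w1}+\delta_2a_{w2}+\lambda_1a_{w3}+1)k_1^2+3l_1(V_1)^2\le-3(\alpha_1+2\delta_1)V_1$. Then $\kappa_1(V_1,\zeta):=-\mathrm{sign}(\zeta)V_1$ if $|\zeta|\ge l_1(V_1)$, and $\kappa_1(V_1,\zeta):=k_1(V_1)$ otherwise. Controller $\kappa_2$. Fix $\mu>0$ with $-\mu^3+6\mu+3\le0$. Then $\kappa_2(\alpha_2^{1/3}V_2,\zeta):=-\mathrm{sign}(\zeta)\alpha_2^{1/3}V_2$ if $|\zeta|\ge2\alpha_2^{2/3}V_2^2$, and $\kappa_2(\alpha_2^{1/3}V_2,\zeta):=-\mu\,\alpha_2^{1/3}V_2$ otherwise.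
   Formalization: The regularity, boundary and feedback conditions are not imposed at the times t_i, where inputs jump; solutions must also be locally absolutely continuous in time as curves in L^2(0,L); if t_o lies inside [t_{2k},t_{2k+1}), V_2(t_o) is the held sample. *)

theory Defs
  imports "HOL-Analysis.Analysis"
begin

definition in_L2 :: "real \<Rightarrow> real \<Rightarrow> (real \<Rightarrow> real) \<Rightarrow> bool" where
  "in_L2 a b f \<longleftrightarrow>
     set_borel_measurable lebesgue {a..b} f \<and> set_integrable lebesgue {a..b} (\<lambda>x. (f x)\<^sup>2)"

definition L2norm :: "real \<Rightarrow> real \<Rightarrow> (real \<Rightarrow> real) \<Rightarrow> real" where
  "L2norm a b f = sqrt (LINT x:{a..b}|lebesgue. (f x)\<^sup>2)"

text \<open>
  Absolute continuity on the compact interval from \<open>c\<close> to \<open>d\<close> of a curve into a (pseudo)metric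
  space; \<open>\<rho> s t\<close> is the distance between the points of the curve at the parameters \<open>s\<close> and \<open>t\<close>.
  It is used for real-valued curves and for curves in \<open>L\<^sup>2\<close>.
\<close>
definition abs_cont :: "(real \<Rightarrow> real \<Rightarrow> real) \<Rightarrow> real \<Rightarrow> real \<Rightarrow> bool" where
  "abs_cont \<rho> c d \<longleftrightarrow>
     (\<forall>\<epsilon>>0. \<exists>\<eta>>0. \<forall>(n::nat) (p::nat \<Rightarrow> real) q.
        (\<forall>i<n. c \<le> p i \<and> p i \<le> q i \<and> q i \<le> d) \<and>
        disjoint_family_on (\<lambda>i. {p i<..<q i}) {..<n} \<and>
        (\<Sum>i<n. q i - p i) < \<eta>
        \<longrightarrow> (\<Sum>i<n. \<rho> (p i) (q i)) < \<epsilon>)"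

definition loc_abs_cont :: "(real \<Rightarrow> real \<Rightarrow> real) \<Rightarrow> real set \<Rightarrow> bool" where
  "loc_abs_cont \<rho> J \<longleftrightarrow> (\<forall>c d. c \<le> d \<and> {c..d} \<subseteq> J \<longrightarrow> abs_cont \<rho> c d)"

text \<open>
  \<open>xderiv a b j f\<close> is the \<open>j\<close>-th derivative of \<open>f\<close> on the interval from \<open>a\<close> to \<open>b\<close>, one-sided at the
  end points.  The same function therefore has two (possibly different) values of, say, its third
  derivative at an interface point, one for each adjacent interval.
\<close>
definition xderiv :: "real \<Rightarrow> real \<Rightarrow> nat \<Rightarrow> (real \<Rightarrow> real) \<Rightarrow> real \<Rightarrow> real" where
  "xderiv a b j = ((\<lambda>g x. vector_derivative g (at x within {a..b})) ^^ j)"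

text \<open>
  The Sobolev space \<open>H\<^sup>4(a,b)\<close>, for the continuous representative: the third derivative exists, is
  absolutely continuous, and its almost-everywhere derivative is square integrable.  Existence of
  the latter almost everywhere is Lebesgue's theorem for absolutely continuous functions; it is
  listed only so that the values of \<open>xderiv a b 4 f\<close> are visibly meaningful.
\<close>
definition H4 :: "real \<Rightarrow> real \<Rightarrow> (real \<Rightarrow> real) \<Rightarrow> bool" where
  "H4 a b f \<longleftrightarrow>
     (\<forall>j<3. xderiv a b j f differentiable_on {a..b}) \<and>
     abs_cont (\<lambda>x y. \<bar>xderiv a b 3 f x - xderiv a b 3 f y\<bar>) a b \<and>
     (AE x in lebesgue. x \<in> {a..b} \<longrightarrow> xderiv a b 3 f differentiable (at x within {a..b})) \<and>
     in_L2 a b (xderiv a b 4 f)"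

definition ks_on :: "real \<Rightarrow> real \<Rightarrow> real \<Rightarrow> real set \<Rightarrow> (real \<Rightarrow> real \<Rightarrow> real) \<Rightarrow> bool" where
  "ks_on lam a b D w \<longleftrightarrow>
     (AE z in lebesgue. case z of (x, t) \<Rightarrow> x \<in> {a..b} \<and> t \<in> D \<longrightarrow>
        ((\<lambda>s. w x s) has_real_derivative
           (- w x t * xderiv a b 1 (\<lambda>y. w y t) x
            - lam * xderiv a b 2 (\<lambda>y. w y t) x
            - xderiv a b 4 (\<lambda>y. w y t) x)) (at t within D))"

text \<open>
  Solutions on the time domain \<open>D\<close> with inputs \<open>u1, u2, u3\<close>; the components \<open>w\<close> and \<open>v\<close> are the
  restrictions of \<open>u\<close> to \<open>x \<in> {0..Y}\<close> and \<open>x \<in> {Y..L}\<close>.  The set \<open>N\<close> collects the instants at which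
  the inputs may jump (the switching instants of the controller).  A jump of \<open>u1, u2, u3\<close>
  is incompatible with continuity in time at the boundary points and with \<open>H\<^sup>4\<close>-regularity at that
  very instant, so the pointwise conditions are imposed off \<open>N\<close> only.  The state \<open>u(\<cdot>,t)\<close>, on the
  other hand, is a locally absolutely continuous curve in \<open>L\<^sup>2(0,L)\<close> on all of \<open>D\<close>; this carries the
  state over a switching instant and makes the energies \<open>V1\<close> and \<open>V2\<close> locally absolutely continuous.
\<close>
definition split_solution ::
  "real \<Rightarrow> real \<Rightarrow> real \<Rightarrow> real set \<Rightarrow> real set \<Rightarrow> (real \<Rightarrow> real \<Rightarrow> real) \<Rightarrow>
   (real \<Rightarrow> real) \<Rightarrow> (real \<Rightarrow> real) \<Rightarrow> (real \<Rightarrow> real) \<Rightarrow> bool" where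
  "split_solution L Y lam D N u u1 u2 u3 \<longleftrightarrow>
     (\<forall>t\<in>D. in_L2 0 L (\<lambda>x. u x t)) \<and>
     loc_abs_cont (\<lambda>s t. L2norm 0 L (\<lambda>x. u x s - u x t)) D \<and>
     (\<forall>x\<in>{0..L}. loc_abs_cont (\<lambda>s t. \<bar>u x s - u x t\<bar>) (D - N)) \<and>
     (\<forall>t\<in>D - N. H4 0 Y (\<lambda>x. u x t) \<and> H4 Y L (\<lambda>x. u x t)) \<and>
     (\<forall>t\<in>D - N.
        u 0 t = u1 t \<and> u Y t = u2 t \<and> u L t = u3 t \<and>
        xderiv 0 Y 1 (\<lambda>x. u x t) 0 = 0 \<and> xderiv 0 Y 1 (\<lambda>x. u x t) Y = 0 \<and>
        xderiv Y L 1 (\<lambda>x. u x t) Y = 0 \<and> xderiv Y L 1 (\<lambda>x. u x t) L = 0) \<and>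
     ks_on lam 0 Y D u \<and> ks_on lam Y L D u"

definition V1 :: "real \<Rightarrow> (real \<Rightarrow> real \<Rightarrow> real) \<Rightarrow> real \<Rightarrow> real" where
  "V1 Y u t = (1/2) * (LINT x:{0..Y}|lebesgue. (u x t)\<^sup>2)"

definition V2 :: "real \<Rightarrow> real \<Rightarrow> (real \<Rightarrow> real \<Rightarrow> real) \<Rightarrow> real \<Rightarrow> real" where
  "V2 Y L u t = (1/2) * (LINT x:{Y..L}|lebesgue. (u x t)\<^sup>2)"

definition delta_o :: "real \<Rightarrow> real \<Rightarrow> real \<Rightarrow> real" where
  "delta_o lam a b = (LEAST \<delta>. \<exists>z.
     (\<forall>j<4. xderiv a b j z differentiable_on {a..b}) \<and>
     (\<forall>x\<in>{a..b}. xderiv a b 4 z x + 3 * lam * xderiv a b 2 z x = \<delta> * z x) \<and>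
     z a = 0 \<and> z b = 0 \<and> xderiv a b 1 z a = 0 \<and> xderiv a b 1 z b = 0 \<and>
     (\<exists>x\<in>{a..b}. z x \<noteq> 0))"

definition delta1 :: "real \<Rightarrow> real" where
  "delta1 \<delta> = (\<bar>\<delta>\<bar> - 2 * \<delta>) / 3"

definition delta2 :: "real \<Rightarrow> real" where
  "delta2 \<delta> = (4 * \<bar>\<delta>\<bar> - 2 * \<delta>) / 3"

definition chi :: "real \<Rightarrow> real \<Rightarrow> real \<Rightarrow> real" where
  "chi Y p x = p + 2 * p * (x / Y) ^ 3 - 3 * p * (x / Y)\<^sup>2"

definition a_w1 :: "real \<Rightarrow> real" where
  "a_w1 Y = (THE a. \<forall>p. a * p\<^sup>2 = 2 * (LINT x:{0..Y}|lebesgue. (xderiv 0 Y 2 (chi Y p) x)\<^sup>2))"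

definition a_w2 :: "real \<Rightarrow> real" where
  "a_w2 Y = (THE a. \<forall>p. a * p\<^sup>2 = (LINT x:{0..Y}|lebesgue. (chi Y p x)\<^sup>2))"

definition a_w3 :: "real \<Rightarrow> real" where
  "a_w3 Y = (THE a. \<forall>p. a * p\<^sup>2 = 2 * (LINT x:{0..Y}|lebesgue. (xderiv 0 Y 1 (chi Y p) x)\<^sup>2))"

definition l1 :: "real \<Rightarrow> real \<Rightarrow> real \<Rightarrow> real \<Rightarrow> real \<Rightarrow> real" where
  "l1 Y lam \<delta> \<alpha>1 V =
     V\<^sup>2 / 3 + (a_w1 Y + delta2 \<delta> * a_w2 Y + lam * a_w3 Y) * V + (\<alpha>1 + 2 * delta1 \<delta>)"

definition admissible_k1 :: "real \<Rightarrow> real \<Rightarrow> real \<Rightarrow> real \<Rightarrow> (real \<Rightarrow> real) \<Rightarrow> bool" where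
  "admissible_k1 Y lam \<delta> \<alpha>1 k1 \<longleftrightarrow>
     (\<forall>V\<ge>0. (k1 V) ^ 3 + 3 * (a_w1 Y + delta2 \<delta> * a_w2 Y + lam * a_w3 Y + 1) * (k1 V)\<^sup>2
             + 3 * (l1 Y lam \<delta> \<alpha>1 V)\<^sup>2 \<le> - 3 * (\<alpha>1 + 2 * delta1 \<delta>) * V)"

definition kappa1 ::
  "real \<Rightarrow> real \<Rightarrow> real \<Rightarrow> real \<Rightarrow> (real \<Rightarrow> real) \<Rightarrow> real \<Rightarrow> real \<Rightarrow> real" where
  "kappa1 Y lam \<delta> \<alpha>1 k1 V \<zeta> =
     (if \<bar>\<zeta>\<bar> \<ge> l1 Y lam \<delta> \<alpha>1 V then - sgn \<zeta> * V else k1 V)"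

definition kappa2 :: "real \<Rightarrow> real \<Rightarrow> real \<Rightarrow> real" where
  "kappa2 \<mu> \<xi> \<zeta> = (if \<bar>\<zeta>\<bar> \<ge> 2 * \<xi>\<^sup>2 then - sgn \<zeta> * \<xi> else - \<mu> * \<xi>)"

definition I1 :: "(nat \<Rightarrow> real) \<Rightarrow> real set" where
  "I1 t = (\<Union>k\<in>{1..}. {t (2*k - 1)..<t (2*k)})"

text \<open>
  Closed-loop solutions starting at the initial time \<open>t0\<close>.  On a cycle already under way at
  \<open>t0\<close>, i.e. \<open>t (2*k) < t0 < t (2*k+1)\<close>, the energy at \<open>t (2*k)\<close> precedes the initial time, and
  the held sample is the one taken at \<open>t0\<close>; otherwise \<open>max t0 (t (2*k))\<close> is just \<open>t (2*k)\<close>.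
\<close>
definition closed_loop_solution ::
  "real \<Rightarrow> real \<Rightarrow> real \<Rightarrow> (nat \<Rightarrow> real) \<Rightarrow> real \<Rightarrow> real \<Rightarrow> real \<Rightarrow> real \<Rightarrow> (real \<Rightarrow> real) \<Rightarrow>
   real \<Rightarrow> (real \<Rightarrow> real \<Rightarrow> real) \<Rightarrow> bool" where
  "closed_loop_solution L Y lam t \<delta> \<mu> \<alpha>1 \<alpha>2 k1 t0 u \<longleftrightarrow>
     (\<exists>u1 u2 u3. let D = {t0..}; N = t ` {1..} in
        split_solution L Y lam D N u u1 u2 u3 \<and>
        (\<forall>s\<in>D \<inter> I1 t - N.
           u1 s = kappa1 Y lam \<delta> \<alpha>1 k1 (V1 Y u s) (xderiv 0 Y 3 (\<lambda>x. u x s) 0) \<and>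
           u2 s = 0 \<and> u3 s = 0) \<and>
        (\<forall>k\<ge>1. \<forall>s\<in>D \<inter> {t (2*k)..<t (2*k + 1)} - N.
           u1 s = kappa2 \<mu> (\<alpha>2 powr (1/3) * V2 Y L u (max t0 (t (2*k))))
                    (xderiv Y L 3 (\<lambda>x. u x s) Y) \<and>
           u2 s = u1 s \<and> u3 s = 0))"

end

theory Submission
  imports Defs "HOL-Complex_Analysis.Great_Picard"
begin

text \<open>
  The energies \<open>V1\<close> and \<open>V2\<close> are absolutely continuous in time, and their derivatives are
  given by integration by parts in space. After subtracting a lift of the boundary values, the
  interior terms are controlled by the clamped spectral inequality with constant \<open>delta_o\<close>; what
  remains is a boundary term that the controllers render negative. On \<open>I1\<close> this makes \<open>V1\<close> decay at
  rate \<open>\<alpha>1\<close> while \<open>V2\<close> grows at most exponentially at a fixed rate.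

  On \<open>I2\<close> the held value \<open>\<psi> = \<alpha>2 powr (1/3) * V2\<close> enters as
  \<open>V2' \<le> C * V2 + B * \<psi>\<^sup>2 - \<psi> ^ 3\<close>. Since \<open>V2\<close> cannot become negative,
  \<open>\<psi>\<close> is bounded by a constant that depends only on the length of the period. Hence the sampled
  values of \<open>V2\<close> are \<open>O(\<alpha>2 powr (-1/3))\<close>, while \<open>V2\<close> and the growth of \<open>V1\<close> over the
  period are bounded uniformly in \<open>\<alpha>2\<close>. A large \<open>\<alpha>1\<close> then makes \<open>V1\<close> small at every sampling instant.
\<close>

section \<open>Absolute continuity\<close>

text \<open>Four obstacles shape the argument. In time the state is only an absolutely continuous
  curve for the L2 distance, and the equation holds pointwise almost everywhere; neither makes
  difference quotients converge in L2. What can be had is finite metric speed at almost every time.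
  It bounds the quotients, and that is enough to differentiate a quadratic functional. Next,
  \<open>delta_o\<close> is a \<open>LEAST\<close> over the reals and says nothing until a least
  eigenvalue is known to exist; hence the direct method and the regularity of the minimizer. Then,
  on \<open>I2\<close> the left segment is driven at both ends, and the flux of \<open>V1\<close>
  contains third derivatives there that no control law sees. They cancel if the energy is measured
  from the common boundary value, provided this value is constant in time. Finally,
  \<open>t0\<close> may fall anywhere in a cycle, so a truncated first stretch has to be absorbed
  into constants that are fixed before the gains.\<close>

abbreviation abs_cont_fun :: "(real \<Rightarrow> real) \<Rightarrow> real \<Rightarrow> real \<Rightarrow> bool" where
  "abs_cont_fun F \<equiv> abs_cont (\<lambda>s t. \<bar>F s - F t\<bar>)"

definition interval_family ::
  "real \<Rightarrow> real \<Rightarrow> 'i set \<Rightarrow> ('i \<Rightarrow> real) \<Rightarrow> ('i \<Rightarrow> real) \<Rightarrow> bool" where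
  "interval_family c d I p q \<longleftrightarrow> finite I \<and> (\<forall>i\<in>I. c \<le> p i \<and> p i \<le> q i \<and> q i \<le> d) \<and>
     disjoint_family_on (\<lambda>i. {p i<..<q i}) I"

lemma abs_cont_iff:
  "abs_cont \<rho> c d \<longleftrightarrow> (\<forall>\<epsilon>>0. \<exists>\<eta>>0. \<forall>(n::nat) p q. interval_family c d {..<n} p q \<and>
     (\<Sum>i<n. q i - p i) < \<eta> \<longrightarrow> (\<Sum>i<n. \<rho> (p i) (q i)) < \<epsilon>)"
  by (simp add: abs_cont_def interval_family_def Ball_def)

text \<open>The definition speaks only of families indexed by initial segments of the naturals.
  Enumerating the index set extends it to any finite set, so that tagged pieces of a division, or
  pairs returned by a covering theorem, can serve as indices directly.\<close>

lemma abs_cont_finite_family: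
  assumes "abs_cont \<rho> c d" and "0 < e"
  shows "\<exists>\<eta>>0. \<forall>(I :: 'i set) p q. interval_family c d I p q \<longrightarrow> (\<Sum>i\<in>I. q i - p i) < \<eta> \<longrightarrow>
     (\<Sum>i\<in>I. \<rho> (p i) (q i)) < e"
proof -
  obtain \<eta> where \<eta>: "\<eta> > 0" and small: "\<And>(n::nat) p q. interval_family c d {..<n} p q \<and>
      (\<Sum>i<n. q i - p i) < \<eta> \<Longrightarrow> (\<Sum>i<n. \<rho> (p i) (q i)) < e"
    using assms unfolding abs_cont_iff by blast
  have "(\<Sum>i\<in>I. \<rho> (p i) (q i)) < e"
    if fam: "interval_family c d I p q" and len: "(\<Sum>i\<in>I. q i - p i) < \<eta>" for I :: "'i set" and p q
  proof -
    obtain h where h: "bij_betw h {..<card I} I"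
      using ex_bij_betw_nat_finite[of I] fam by (auto simp: atLeast0LessThan interval_family_def)
    have sum_h: "(\<Sum>i\<in>I. f i) = (\<Sum>j<card I. f (h j))" for f :: "'i \<Rightarrow> real"
      using sum.reindex_bij_betw[OF h, of f] by simp
    have hI: "h j \<in> I" if "j < card I" for j
      using h that by (auto simp: bij_betw_def)
    have "{p (h i)<..<q (h i)} \<inter> {p (h j)<..<q (h j)} = {}"
      if "i < card I" "j < card I" "i \<noteq> j" for i j
    proof -
      have "h i \<noteq> h j" using h that by (auto simp: bij_betw_def inj_on_def)
      then show ?thesis
        using fam hI that unfolding interval_family_def disjoint_family_on_def by auto
    qed
    then have "interval_family c d {..<card I} (p \<circ> h) (q \<circ> h)"
      using fam hI by (simp add: interval_family_def disjoint_family_on_def)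
    then show ?thesis
      using small[of "card I" "p \<circ> h" "q \<circ> h"] len by (simp add: sum_h comp_def)
  qed
  with \<eta> show ?thesis by blast
qed

lemma sum_interval_family_le_measure:
  assumes fam: "interval_family c d I p q"
    and sub: "\<And>i. i \<in> I \<Longrightarrow> {p i<..<q i} \<subseteq> S" "S \<in> lmeasurable"
  shows "(\<Sum>i\<in>I. q i - p i) \<le> measure lebesgue S"
proof -
  have "(\<Sum>i\<in>I. q i - p i) = (\<Sum>i\<in>I. measure lebesgue {p i<..<q i})"
    using fam by (intro sum.cong) (auto simp: interval_family_def)
  also have "\<dots> = measure lebesgue (\<Union>i\<in>I. {p i<..<q i})"
    using fam by (intro measure_finite_Union[symmetric]) (auto simp: interval_family_def)
  also have "\<dots> \<le> measure lebesgue S"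
    using sub fam by (intro measure_mono_fmeasurable) (auto simp: interval_family_def)
  finally show ?thesis .
qed

lemma open_superset_small_measure:
  assumes "negligible (E :: real set)" "0 < \<eta>"
  obtains T where "open T" "E \<subseteq> T" "T \<in> lmeasurable" "measure lebesgue T < \<eta>"
proof -
  have E: "E \<in> null_sets lebesgue"
    using assms by (simp add: negligible_iff_null_sets)
  then obtain T where T: "open T" "E \<subseteq> T" "T - E \<in> lmeasurable" "emeasure lebesgue (T - E) < ennreal \<eta>"
    using sets_lebesgue_outer_open[of E \<eta>] assms by auto
  have "T = (T - E) \<union> E" using T by auto
  then have "T \<in> lmeasurable"
    using T assms(1) fmeasurable.Un[of "T - E" lebesgue E] by (simp add: negligible_iff_measure)
  moreover have "emeasure lebesgue T = emeasure lebesgue (T - E)"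
    using E T by (simp add: emeasure_Diff_null_set)
  ultimately have "measure lebesgue T < \<eta>"
    using T assms
    by (metis emeasure_eq_measure2 ennreal_less_iff measure_nonneg)
  then show thesis using T that \<open>T \<in> lmeasurable\<close> by blast
qed

text \<open>Take a gauge that shrinks to an open set of small measure around the exceptional points.
  In a fine division the good tags are controlled by the derivative, the bad ones by absolute
  continuity.\<close>
lemma abs_cont_has_integral:
  fixes F g :: "real \<Rightarrow> real"
  assumes ab: "a \<le> b" and ac: "abs_cont_fun F a b"
    and E: "negligible E"
    and deriv: "\<And>x. x \<in> {a..b} - E \<Longrightarrow> (F has_real_derivative g x) (at x within {a..b})"
  shows "(g has_integral (F b - F a)) {a..b}"
proof (rule has_integral_spike[OF E])
  \<comment> \<open>With the integrand set to zero on \<open>E\<close>, a tag in \<open>E\<close>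
    contributes nothing to the Riemann sum, and its error is just the increment of
    \<open>F\<close>.\<close>
  let ?g = "\<lambda>x. if x \<in> E then 0 else g x"
  show "g x = ?g x" if "x \<in> {a..b} - E" for x using that by auto
  show "(?g has_integral (F b - F a)) {a..b}"
    unfolding has_integral_real
  proof (intro allI impI)
    fix e :: real assume "0 < e"
    define e1 where "e1 = e / (2 * (b - a + 1))"
    have e1: "0 < e1" using ab \<open>0 < e\<close> by (simp add: e1_def)
    obtain \<eta> where \<eta>: "0 < \<eta>" and small: "\<And>(I :: (real \<times> real set) set) p q. interval_family a b I p q \<Longrightarrow>
        (\<Sum>i\<in>I. q i - p i) < \<eta> \<Longrightarrow> (\<Sum>i\<in>I. \<bar>F (p i) - F (q i)\<bar>) < e / 2"
      using abs_cont_finite_family[OF ac half_gt_zero[OF \<open>0 < e\<close>]] by blast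
    obtain T where T: "open T" "E \<subseteq> T" "T \<in> lmeasurable" "measure lebesgue T < \<eta>"
      using open_superset_small_measure[OF E \<eta>] .
    have "\<exists>d>0. \<forall>y\<in>{a..b}. \<bar>y - x\<bar> < d \<longrightarrow> \<bar>F y - F x - g x * (y - x)\<bar> \<le> e1 * \<bar>y - x\<bar>"
      if "x \<in> {a..b} - E" for x
      using deriv[OF that] e1 unfolding has_field_derivative_def has_derivative_within_alt by force
    then obtain d where d: "\<And>x. x \<in> {a..b} - E \<Longrightarrow> d x > 0"
      "\<And>x y. x \<in> {a..b} - E \<Longrightarrow> y \<in> {a..b} \<Longrightarrow> \<bar>y - x\<bar> < d x \<Longrightarrow>
          \<bar>F y - F x - g x * (y - x)\<bar> \<le> e1 * \<bar>y - x\<bar>"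
      by metis
    define \<gamma> where "\<gamma> x = (if x \<in> E then T else if x \<in> {a..b} then ball x (d x) else ball x 1)" for x
    show "\<exists>\<gamma>. gauge \<gamma> \<and> (\<forall>\<D>. \<D> tagged_division_of {a..b} \<and> \<gamma> fine \<D> \<longrightarrow>
        norm ((\<Sum>(x,k)\<in>\<D>. measure lborel k *\<^sub>R ?g x) - (F b - F a)) < e)"
    proof (intro exI[of _ \<gamma>] conjI allI impI)
      show "gauge \<gamma>"
        unfolding gauge_def \<gamma>_def using T d(1) by auto
    next
      fix \<D> assume "\<D> tagged_division_of {a..b} \<and> \<gamma> fine \<D>"
      then have D: "\<D> tagged_division_of {a..b}" and fine: "\<gamma> fine \<D>" by auto
      have fin: "finite \<D>" using D by blast
      have form: "\<exists>u v. k = {u..v} \<and> u \<le> x \<and> x \<le> v \<and> a \<le> u \<and> v \<le> b \<and> Inf k = u \<and> Sup k = v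
           \<and> measure lborel k = v - u" if xk: "(x, k) \<in> \<D>" for x k
      proof -
        obtain u v where uv: "k = {u..v}"
          using tagged_division_ofD(4)[OF D xk] by auto
        moreover have "x \<in> k" "k \<subseteq> {a..b}"
          using tagged_division_ofD(2,3)[OF D xk] by auto
        ultimately show ?thesis by (intro exI[of _ u] exI[of _ v]) auto
      qed
      define B where "B = {i \<in> \<D>. fst i \<in> E}"
      have finB: "finite B" and BD: "B \<subseteq> \<D>" using fin by (auto simp: B_def)
      have Bform: "a \<le> Inf (snd i) \<and> Inf (snd i) \<le> Sup (snd i) \<and> Sup (snd i) \<le> b" if "i \<in> B" for i
        using form[of "fst i" "snd i"] that BD by force
      have Bint: "{Inf (snd i)<..<Sup (snd i)} = interior (snd i)" if "i \<in> \<D>" for i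
        using form[of "fst i" "snd i"] that by (metis interior_atLeastAtMost_real prod.collapse)
      have Bdisj: "disjoint_family_on (\<lambda>i. {Inf (snd i)<..<Sup (snd i)}) B"
        unfolding disjoint_family_on_def
      proof (intro ballI impI)
        fix i j assume "i \<in> B" "j \<in> B" "i \<noteq> j"
        then show "{Inf (snd i)<..<Sup (snd i)} \<inter> {Inf (snd j)<..<Sup (snd j)} = {}"
          using tagged_division_ofD(5)[OF D, of "fst i" "snd i" "fst j" "snd j"] Bint BD
          by (metis prod.collapse subset_iff)
      qed
      have fam: "interval_family a b B (\<lambda>i. Inf (snd i)) (\<lambda>i. Sup (snd i))"
        using finB Bform Bdisj by (simp add: interval_family_def)
      have "(\<Sum>i\<in>B. Sup (snd i) - Inf (snd i)) \<le> measure lebesgue T"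
      proof (rule sum_interval_family_le_measure[OF fam _ T(3)])
        show "{Inf (snd i)<..<Sup (snd i)} \<subseteq> T" if "i \<in> B" for i
        proof -
          obtain x k where i: "i = (x, k)" by (cases i)
          then have "(x,k) \<in> \<D>" "x \<in> E" using that by (auto simp: B_def)
          then have "k \<subseteq> T" using fineD[OF fine \<open>(x,k) \<in> \<D>\<close>] by (simp add: \<gamma>_def)
          moreover obtain u v where "k = {u..v}" "Inf k = u" "Sup k = v"
            using form[OF \<open>(x,k) \<in> \<D>\<close>] by blast
          then have "{Inf k<..<Sup k} \<subseteq> k" by (metis greaterThanLessThan_subseteq_atLeastAtMost_iff order_refl)
          ultimately show ?thesis by (simp add: i)
        qed
      qed
      then have bad: "(\<Sum>i\<in>B. \<bar>F (Inf (snd i)) - F (Sup (snd i))\<bar>) < e / 2"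
        using small[OF fam] T(4) by linarith
      \<comment> \<open>Straddle estimate: the tag lies between the end points of its interval, so
        the derivative estimates on its two sides add up to an error proportional to the
        length.\<close>
      have good: "\<bar>measure lborel k * g x - (F (Sup k) - F (Inf k))\<bar> \<le> e1 * measure lborel k"
        if xk: "(x, k) \<in> \<D> - B" for x k
      proof -
        obtain u v where uv: "k = {u..v}" "u \<le> x" "x \<le> v" "a \<le> u" "v \<le> b" "Inf k = u" "Sup k = v"
           "measure lborel k = v - u" using form[of x k] xk by blast
        have xE: "x \<in> {a..b} - E" using xk uv by (auto simp: B_def)
        have "k \<subseteq> ball x (d x)" using fineD[OF fine, of x k] xk xE by (auto simp: \<gamma>_def)
        then have "u \<in> ball x (d x)" "v \<in> ball x (d x)"
          using uv(1-3) by (metis atLeastAtMost_iff order.trans order_refl subset_iff)+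
        then have "\<bar>u - x\<bar> < d x" "\<bar>v - x\<bar> < d x"
          by (simp_all add: dist_real_def abs_minus_commute)
        then have "\<bar>F u - F x - g x * (u - x)\<bar> \<le> e1 * (x - u)"
          "\<bar>F v - F x - g x * (v - x)\<bar> \<le> e1 * (v - x)"
          using d(2)[OF xE, of u] d(2)[OF xE, of v] uv by auto
        moreover have "measure lborel k * g x - (F (Sup k) - F (Inf k)) =
            (F u - F x - g x * (u - x)) - (F v - F x - g x * (v - x))"
          using uv by (simp add: algebra_simps)
        moreover have "e1 * measure lborel k = e1 * (x - u) + e1 * (v - x)"
          using uv by (simp add: algebra_simps)
        ultimately show ?thesis by linarith
      qed
      have tot: "(\<Sum>(x,k)\<in>\<D>. measure lborel k) = b - a"
        using additive_content_tagged_division[of \<D> a b] D ab by simp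
      have "(\<Sum>(x,k)\<in>\<D>. measure lborel k *\<^sub>R ?g x) - (F b - F a)
          = (\<Sum>(x,k)\<in>\<D>. measure lborel k *\<^sub>R ?g x - (F (Sup k) - F (Inf k)))"
        using additive_tagged_division_1[OF ab D, of F] by (simp add: sum_subtractf case_prod_unfold)
      also have "\<bar>\<dots>\<bar> \<le> (\<Sum>(x,k)\<in>\<D>. \<bar>measure lborel k *\<^sub>R ?g x - (F (Sup k) - F (Inf k))\<bar>)"
        by (simp add: case_prod_unfold)
      also have "\<dots> = (\<Sum>(x,k)\<in>\<D> - B. \<bar>measure lborel k *\<^sub>R ?g x - (F (Sup k) - F (Inf k))\<bar>)
          + (\<Sum>(x,k)\<in>B. \<bar>measure lborel k *\<^sub>R ?g x - (F (Sup k) - F (Inf k))\<bar>)"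
        using sum.subset_diff[OF BD fin] .
      also have "(\<Sum>(x,k)\<in>B. \<bar>measure lborel k *\<^sub>R ?g x - (F (Sup k) - F (Inf k))\<bar>)
          = (\<Sum>i\<in>B. \<bar>F (Inf (snd i)) - F (Sup (snd i))\<bar>)"
        by (intro sum.cong) (auto simp: B_def)
      also have "(\<Sum>(x,k)\<in>\<D> - B. \<bar>measure lborel k *\<^sub>R ?g x - (F (Sup k) - F (Inf k))\<bar>)
          \<le> (\<Sum>(x,k)\<in>\<D> - B. e1 * measure lborel k)"
        using good by (intro sum_mono) (auto simp: B_def)
      also have "\<dots> \<le> (\<Sum>(x,k)\<in>\<D>. e1 * measure lborel k)"
        using fin e1 by (intro sum_mono2) auto
      also have "\<dots> = e1 * (b - a)"
        unfolding tot[symmetric] by (simp add: sum_distrib_left case_prod_unfold)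
      also have "e1 * (b - a) \<le> e / 2"
        using ab \<open>0 < e\<close> by (simp add: e1_def field_simps)
      finally show "norm ((\<Sum>(x,k)\<in>\<D>. measure lborel k *\<^sub>R ?g x) - (F b - F a)) < e"
        using bad by simp
    qed
  qed
qed

lemma AE_lebesgue_negligible:
  assumes "AE x in lebesgue. P (x::real)"
  obtains E where "negligible E" "\<And>x. x \<notin> E \<Longrightarrow> P x"
  using assms by (auto simp: eventually_ae_filter negligible_iff_null_sets)

text \<open>Absolute continuity makes the increment the integral of the derivative, so a sign off a
  null set suffices. For functions that are merely continuous this fails, as the Cantor function
  shows.\<close>

lemma abs_cont_nonincreasing:
  fixes F :: "real \<Rightarrow> real"
  assumes ab: "a \<le> b" and ac: "abs_cont_fun F a b"
    and der: "AE x in lebesgue. x \<in> {a..b} \<longrightarrow> (\<exists>D\<le>0. (F has_real_derivative D) (at x within {a..b}))"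
  shows "F b \<le> F a"
proof -
  obtain E where E: "negligible E"
    "\<And>x. x \<notin> E \<Longrightarrow> x \<in> {a..b} \<longrightarrow> (\<exists>D\<le>0. (F has_real_derivative D) (at x within {a..b}))"
    using AE_lebesgue_negligible[OF der] by blast
  then obtain g where g: "\<And>x. x \<in> {a..b} - E \<Longrightarrow> g x \<le> 0 \<and>
      (F has_real_derivative g x) (at x within {a..b})"
    by (metis DiffE)
  have "(g has_integral (F b - F a)) {a..b}"
    by (rule abs_cont_has_integral[OF ab ac E(1)]) (use g in auto)
  then have "((\<lambda>x. if x \<in> E then 0 else g x) has_integral (F b - F a)) {a..b}"
    by (rule has_integral_spike[OF E(1), rotated]) auto
  then have "F b - F a \<le> 0"
    by (rule has_integral_le[OF _ has_integral_0]) (use g in auto)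
  then show ?thesis by simp
qed

text \<open>A common comparison principle: Lipschitz functions, sums, products and energies are all
  handled by dominating their increments. Two dominating distances are allowed so that a product can
  be estimated by the increments of both factors.\<close>

lemma abs_cont_dominated:
  assumes ac: "abs_cont \<rho>1 c d" "abs_cont \<rho>2 c d" and M: "0 \<le> M"
    and le: "\<And>s t. c \<le> s \<Longrightarrow> s \<le> t \<Longrightarrow> t \<le> d \<Longrightarrow> \<rho> s t \<le> M * (\<rho>1 s t + \<rho>2 s t)"
  shows "abs_cont \<rho> c d"
  unfolding abs_cont_iff
proof (intro allI impI)
  fix e :: real assume "0 < e"
  \<comment> \<open>Dividing by \<open>M + 1\<close> covers \<open>M = 0\<close> as well.\<close>
  define e0 where "e0 = e / (M + 1)"
  define e' where "e' = e0 / 2"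
  have e': "0 < e'" using M \<open>0 < e\<close> by (simp add: e'_def e0_def)
  obtain \<eta>1 where \<eta>1: "\<eta>1 > 0" "\<And>(n::nat) p q. interval_family c d {..<n} p q \<and> (\<Sum>i<n. q i - p i) < \<eta>1
        \<Longrightarrow> (\<Sum>i<n. \<rho>1 (p i) (q i)) < e'"
    using ac(1) e' unfolding abs_cont_iff by blast
  obtain \<eta>2 where \<eta>2: "\<eta>2 > 0" "\<And>(n::nat) p q. interval_family c d {..<n} p q \<and> (\<Sum>i<n. q i - p i) < \<eta>2
        \<Longrightarrow> (\<Sum>i<n. \<rho>2 (p i) (q i)) < e'"
    using ac(2) e' unfolding abs_cont_iff by blast
  have "(\<Sum>i<n. \<rho> (p i) (q i)) < e"
    if *: "interval_family c d {..<n} p q \<and> (\<Sum>i<n. q i - p i) < min \<eta>1 \<eta>2"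
    for n :: nat and p q
  proof -
    have "(\<Sum>i<n. \<rho> (p i) (q i)) \<le> (\<Sum>i<n. M * (\<rho>1 (p i) (q i) + \<rho>2 (p i) (q i)))"
      using * by (intro sum_mono le) (auto simp: interval_family_def)
    also have "\<dots> = M * ((\<Sum>i<n. \<rho>1 (p i) (q i)) + (\<Sum>i<n. \<rho>2 (p i) (q i)))"
      by (simp add: sum.distrib flip: sum_distrib_left)
    also have "\<dots> \<le> M * (e' + e')"
      using \<eta>1(2)[of n p q] \<eta>2(2)[of n p q] * M by (intro mult_left_mono) auto
    also have "\<dots> < (M + 1) * (e' + e')" using e' by (intro mult_strict_right_mono) auto
    also have "e' + e' = e0" by (simp add: e'_def)
    also have "(M + 1) * e0 = e" using M by (simp add: e0_def)
    finally show ?thesis .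
  qed
  then show "\<exists>\<eta>>0. \<forall>(n::nat) p q. interval_family c d {..<n} p q \<and> (\<Sum>i<n. q i - p i) < \<eta>
        \<longrightarrow> (\<Sum>i<n. \<rho> (p i) (q i)) < e"
    using \<eta>1(1) \<eta>2(1) by (intro exI[of _ "min \<eta>1 \<eta>2"]) auto
qed

lemma abs_cont_lipschitz:
  assumes "0 \<le> M" "\<And>s t. c \<le> s \<Longrightarrow> s \<le> t \<Longrightarrow> t \<le> d \<Longrightarrow> \<rho> s t \<le> M * (t - s)"
  shows "abs_cont \<rho> c d"
proof -
  have id: "abs_cont (\<lambda>s t. t - s) c d"
    unfolding abs_cont_def by auto
  show ?thesis
  proof (rule abs_cont_dominated[OF id id assms(1)])
    fix s t assume "c \<le> s" "s \<le> t" "t \<le> d"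
    then show "\<rho> s t \<le> M * (t - s + (t - s))"
      using assms(2)[of s t] mult_left_mono[of "t - s" "t - s + (t - s)" M] assms(1) by linarith
  qed
qed

lemma abs_cont_subinterval:
  assumes "abs_cont \<rho> c d" "c \<le> c'" "d' \<le> d"
  shows "abs_cont \<rho> c' d'"
  using assms unfolding abs_cont_def by (meson order_trans)

lemma abs_cont_modulus:
  assumes ac: "abs_cont \<rho> c d" and "0 < e"
  obtains \<eta> where "0 < \<eta>" "\<And>s t. c \<le> s \<Longrightarrow> s \<le> t \<Longrightarrow> t \<le> d \<Longrightarrow> t - s < \<eta> \<Longrightarrow> \<rho> s t < e"
proof -
  obtain \<eta> where \<eta>: "0 < \<eta>" "\<And>(I :: unit set) p q. interval_family c d I p q \<Longrightarrow>
      (\<Sum>i\<in>I. q i - p i) < \<eta> \<Longrightarrow> (\<Sum>i\<in>I. \<rho> (p i) (q i)) < e"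
    using abs_cont_finite_family[OF assms] by blast
  show thesis
  proof (rule that[OF \<eta>(1)])
    fix s t assume "c \<le> s" "s \<le> t" "t \<le> d" "t - s < \<eta>"
    then show "\<rho> s t < e"
      using \<eta>(2)[of "{()}" "\<lambda>_. s" "\<lambda>_. t"] by (simp add: interval_family_def disjoint_family_on_def)
  qed
qed

lemma abs_cont_imp_continuous_on:
  fixes F :: "real \<Rightarrow> real"
  assumes ac: "abs_cont_fun F c d"
  shows "continuous_on {c..d} F"
  unfolding continuous_on_iff
proof (intro ballI allI impI)
  fix x e :: real assume x: "x \<in> {c..d}" and "0 < e"
  obtain \<eta> where \<eta>: "0 < \<eta>"
    "\<And>s t. c \<le> s \<Longrightarrow> s \<le> t \<Longrightarrow> t \<le> d \<Longrightarrow> t - s < \<eta> \<Longrightarrow> \<bar>F s - F t\<bar> < e"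
    using abs_cont_modulus[OF ac \<open>0 < e\<close>] by blast
  show "\<exists>\<eta>>0. \<forall>y\<in>{c..d}. dist y x < \<eta> \<longrightarrow> dist (F y) (F x) < e"
  proof (intro exI[of _ \<eta>] conjI ballI impI \<eta>(1))
    fix y assume y: "y \<in> {c..d}" "dist y x < \<eta>"
    show "dist (F y) (F x) < e"
    proof (cases "x \<le> y")
      case True
      then show ?thesis using \<eta>(2)[of x y] x y by (auto simp: dist_real_def abs_minus_commute)
    next
      case False
      then show ?thesis using \<eta>(2)[of y x] x y by (auto simp: dist_real_def abs_minus_commute)
    qed
  qed
qed

lemma continuous_on_Icc_bounded:
  fixes f :: "real \<Rightarrow> real"
  assumes "continuous_on {a..b} f"
  obtains M where "\<And>x. x \<in> {a..b} \<Longrightarrow> \<bar>f x\<bar> \<le> M"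
  using assms
  by (metis bounded_iff compact_Icc compact_continuous_image compact_imp_bounded imageI real_norm_def)

lemma abs_cont_mult:
  fixes F G :: "real \<Rightarrow> real"
  assumes F: "abs_cont_fun F c d" and G: "abs_cont_fun G c d"
  shows "abs_cont_fun (\<lambda>s. F s * G s) c d"
proof -
  obtain M where M: "\<And>x. x \<in> {c..d} \<Longrightarrow> \<bar>F x\<bar> \<le> M"
    using continuous_on_Icc_bounded[OF abs_cont_imp_continuous_on[OF F]] by blast
  obtain M' where M': "\<And>x. x \<in> {c..d} \<Longrightarrow> \<bar>G x\<bar> \<le> M'"
    using continuous_on_Icc_bounded[OF abs_cont_imp_continuous_on[OF G]] by blast
  show ?thesis
  proof (rule abs_cont_dominated[OF F G])
    show "0 \<le> max 0 (max M M')" by simp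
    fix s t assume st: "c \<le> s" "s \<le> t" "t \<le> d"
    have "F s * G s - F t * G t = (F s - F t) * G s + F t * (G s - G t)"
      by (simp add: algebra_simps)
    then have "\<bar>F s * G s - F t * G t\<bar> \<le> \<bar>F s - F t\<bar> * \<bar>G s\<bar> + \<bar>F t\<bar> * \<bar>G s - G t\<bar>"
      by (metis abs_mult abs_triangle_ineq)
    also have "\<dots> \<le> \<bar>F s - F t\<bar> * max 0 (max M M') + max 0 (max M M') * \<bar>G s - G t\<bar>"
      using M[of t] M'[of s] st by (intro add_mono mult_left_mono mult_right_mono) auto
    finally show "\<bar>F s * G s - F t * G t\<bar> \<le> max 0 (max M M') * (\<bar>F s - F t\<bar> + \<bar>G s - G t\<bar>)"
      by (simp add: algebra_simps)
  qed
qed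

lemma abs_cont_of_continuous_deriv:
  fixes F :: "real \<Rightarrow> real"
  assumes der: "\<And>x. x \<in> {c..d} \<Longrightarrow> (F has_real_derivative F' x) (at x within {c..d})"
    and cont: "continuous_on {c..d} F'"
  shows "abs_cont_fun F c d"
proof -
  obtain M where M: "\<And>x. x \<in> {c..d} \<Longrightarrow> \<bar>F' x\<bar> \<le> M"
    using continuous_on_Icc_bounded[OF cont] by blast
  show ?thesis
  proof (rule abs_cont_lipschitz)
    show "0 \<le> max 0 M" by simp
    fix s t assume "c \<le> s" "s \<le> t" "t \<le> d"
    then have "norm (F t - F s) \<le> max 0 M * norm (t - s)"
      by (intro field_differentiable_bound[of "{c..d}"]) (use M der in \<open>auto intro: le_max_iff_disj[THEN iffD2]\<close>)
    then show "\<bar>F s - F t\<bar> \<le> max 0 M * (t - s)" using \<open>s \<le> t\<close> by (simp add: abs_minus_commute)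
  qed
qed

section \<open>Metric speed of absolutely continuous curves\<close>

definition infinite_speed :: "(real \<Rightarrow> real \<Rightarrow> real) \<Rightarrow> real set" where
  "infinite_speed \<rho> = {t. \<forall>M. \<forall>\<delta>>0. \<exists>t'. t' \<noteq> t \<and> \<bar>t' - t\<bar> < \<delta> \<and> M * \<bar>t' - t\<bar> < \<rho> t t'}"

text \<open>Vitali's covering theorem packs the bad set into disjoint balls on which \<open>\<rho>\<close> exceeds
  \<open>M\<close> times the radius; on a short interval the values of \<open>\<rho>\<close> sum up to at most 1.\<close>
lemma infinite_speed_negligible_short:
  assumes small: "\<And>(I :: (real \<times> real) set) p q. interval_family c d I p q \<Longrightarrow>
       (\<Sum>i\<in>I. q i - p i) < \<eta> \<Longrightarrow> (\<Sum>i\<in>I. \<rho> (p i) (q i)) < (1::real)"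
    and sym: "\<And>s t. \<rho> s t = \<rho> t s"
    and pq: "c \<le> c'" "c' < d'" "d' \<le> d" "d' - c' < \<eta>"
  shows "negligible (infinite_speed \<rho> \<inter> {c'<..<d'})" (is "negligible ?B")
  unfolding negligible_outer
proof (intro allI impI)
  fix e :: real assume "0 < e"
  let ?b = "\<lambda>i. ball (fst i) \<bar>snd i - fst i\<bar>"
  \<comment> \<open>The disjoint balls will have total length at most \<open>2 / M\<close>, which is
    then half of \<open>e\<close>.\<close>
  define M where "M = 4 / e"
  have M: "0 < M" using \<open>0 < e\<close> by (simp add: M_def)
  \<comment> \<open>A ball is indexed by its centre together with a witness of large speed, whose
    distance is the radius; the covering theorem thus returns disjoint balls with their witnesses
    attached.\<close>
  define K where "K = {(t, t'). t' \<noteq> t \<and> ball t \<bar>t' - t\<bar> \<subseteq> {c'..d'} \<and> M * \<bar>t' - t\<bar> < \<rho> t t'}"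
  obtain C where C: "countable C" "C \<subseteq> K"
    and disj: "pairwise (\<lambda>i j. disjnt (?b i) (?b j)) C"
    and neg: "negligible (?B - (\<Union>i\<in>C. ?b i))"
  proof (rule Vitali_covering_theorem_balls[of ?B K fst "\<lambda>i. \<bar>snd i - fst i\<bar>"])
    fix x \<delta> :: real assume x: "x \<in> ?B" and "0 < \<delta>"
    define \<delta>' where "\<delta>' = min \<delta> (min (x - c') (d' - x))"
    have "0 < \<delta>'" using x \<open>0 < \<delta>\<close> by (auto simp: \<delta>'_def)
    then obtain t' where t': "t' \<noteq> x" "\<bar>t' - x\<bar> < \<delta>'" "M * \<bar>t' - x\<bar> < \<rho> x t'"
      using x unfolding infinite_speed_def by blast
    have "ball x \<bar>t' - x\<bar> \<subseteq> {c'..d'}"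
    proof
      fix y assume "y \<in> ball x \<bar>t' - x\<bar>"
      then have "\<bar>x - y\<bar> < \<delta>'" using t' by (simp add: dist_real_def)
      then show "y \<in> {c'..d'}" by (auto simp: \<delta>'_def)
    qed
    then show "\<exists>i. i \<in> K \<and> x \<in> ?b i \<and> \<bar>snd i - fst i\<bar> < \<delta>"
      using t' by (intro exI[of _ "(x, t')"]) (auto simp: K_def \<delta>'_def)
  qed
  have fin: "measure lebesgue (\<Union>i\<in>F. ?b i) \<le> 2 / M"
    if F: "finite F" "F \<subseteq> C" for F
  proof -
    \<comment> \<open>The segment from centre to witness lies in the ball and has half its length.
      Disjointness passes to the segments, on which absolute continuity acts; the factor 2 is paid
      when returning to the balls.\<close>
    define p q where "p i = min (fst i) (snd i)" and "q i = max (fst i) (snd i)" for i :: "real \<times> real"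
    have len: "q i - p i = \<bar>snd i - fst i\<bar>" for i by (auto simp: p_def q_def)
    have ball_F: "?b i \<subseteq> {c'..d'}" "M * (q i - p i) < \<rho> (p i) (q i)"
      if "i \<in> F" for i
    proof -
      have "i \<in> K" using that F C by blast
      then show "?b i \<subseteq> {c'..d'}" by (auto simp: K_def)
      show "M * (q i - p i) < \<rho> (p i) (q i)"
        unfolding len using \<open>i \<in> K\<close> sym[of "snd i" "fst i"]
        by (auto simp: K_def p_def q_def min_def max_def)
    qed
    have sub: "{p i<..<q i} \<subseteq> ?b i" for i
      by (auto simp: p_def q_def dist_real_def)
    have bd: "c' \<le> p i \<and> p i \<le> q i \<and> q i \<le> d'" if "i \<in> F" for i
    proof -
      have "i \<in> K" using that F C by blast
      then have "p i < q i" by (auto simp: K_def p_def q_def)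
      moreover have "{p i<..<q i} \<subseteq> {c'..d'}" using ball_F(1)[OF that] sub[of i] by blast
      ultimately show ?thesis by (simp add: greaterThanLessThan_subseteq_atLeastAtMost_iff)
    qed
    have dj: "disjoint_family_on (\<lambda>i. {p i<..<q i}) F"
      unfolding disjoint_family_on_def
    proof (intro ballI impI)
      fix i j assume "i \<in> F" "j \<in> F" "i \<noteq> j"
      then have "disjnt (?b i) (?b j)"
        using disj F by (meson pairwiseD subsetD)
      then show "{p i<..<q i} \<inter> {p j<..<q j} = {}"
        using sub[of i] sub[of j] unfolding disjnt_def by blast
    qed
    have fam: "interval_family c d F p q"
      using F(1) bd pq dj unfolding interval_family_def by (meson order_trans)
    have "(\<Sum>i\<in>F. q i - p i) \<le> measure lebesgue {c'..d'}"
    proof (rule sum_interval_family_le_measure[OF fam])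
      show "{p i<..<q i} \<subseteq> {c'..d'}" if "i \<in> F" for i using ball_F(1)[OF that] sub[of i] by blast
    qed simp
    also have "\<dots> < \<eta>" using pq by simp
    finally have "(\<Sum>i\<in>F. \<rho> (p i) (q i)) < 1" by (rule small[OF fam])
    moreover have "M * (\<Sum>i\<in>F. q i - p i) \<le> (\<Sum>i\<in>F. \<rho> (p i) (q i))"
      unfolding sum_distrib_left using ball_F(2) by (intro sum_mono) (auto intro: less_imp_le)
    ultimately have "(\<Sum>i\<in>F. q i - p i) \<le> 1 / M"
      using M by (simp add: field_simps)
    moreover have "measure lebesgue (\<Union>i\<in>F. ?b i)
        \<le> (\<Sum>i\<in>F. measure lebesgue (?b i))"
      using F by (intro measure_UNION_le) auto
    moreover have "\<dots> = (\<Sum>i\<in>F. 2 * (q i - p i))"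
      by (intro sum.cong refl) (simp add: len ball_eq_greaterThanLessThan)
    ultimately show ?thesis by (simp only: sum_distrib_left[symmetric])
  qed
  let ?U = "\<Union>i\<in>C. ?b i"
  have U: "?U \<in> lmeasurable" "measure lebesgue ?U \<le> 2 / M"
    using fmeasurable_UN_bound[OF C(1) _ fin] measure_UN_bound[OF C(1) _ fin] by auto
  show "\<exists>T. ?B \<subseteq> T \<and> T \<in> lmeasurable \<and> measure lebesgue T < e"
  proof (intro exI[of _ "?U \<union> (?B - ?U)"] conjI)
    show "?U \<union> (?B - ?U) \<in> lmeasurable"
      using U neg by (intro fmeasurable.Un) (auto simp: negligible_iff_measure)
    have "measure lebesgue (?U \<union> (?B - ?U)) \<le> measure lebesgue ?U + measure lebesgue (?B - ?U)"
      using U neg by (intro measure_Un_le) (auto simp: negligible_iff_measure fmeasurableD)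
    also have "\<dots> \<le> 2 / M" using U neg by (simp add: negligible_iff_measure)
    also have "\<dots> < e" using \<open>0 < e\<close> by (simp add: M_def)
    finally show "measure lebesgue (?U \<union> (?B - ?U)) < e" .
  qed auto
qed

text \<open>The modulus of absolute continuity controls only families of total length below
  \<open>\<eta>\<close>, so the interval is covered by short ones, and rational end points keep the
  cover countable. The result takes the place of differentiability of the curve, which makes no
  sense for an abstract distance.\<close>

lemma abs_cont_finite_speed:
  assumes ac: "abs_cont \<rho> c d" and sym: "\<And>s t. \<rho> s t = \<rho> t s"
  shows "AE t in lebesgue. t \<in> {c<..<d} \<longrightarrow>
    (\<exists>M. \<exists>\<delta>>0. \<forall>t'. t' \<noteq> t \<and> \<bar>t' - t\<bar> < \<delta> \<longrightarrow> \<rho> t t' \<le> M * \<bar>t' - t\<bar>)"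
proof -
  obtain \<eta> where \<eta>: "\<eta> > 0" and small: "\<And>(I :: (real \<times> real) set) p q. interval_family c d I p q \<Longrightarrow>
       (\<Sum>i\<in>I. q i - p i) < \<eta> \<Longrightarrow> (\<Sum>i\<in>I. \<rho> (p i) (q i)) < 1"
    using abs_cont_finite_family[OF ac zero_less_one] by blast
  define B where "B = (\<lambda>(c', d'). infinite_speed \<rho> \<inter> {c'<..<d'})"
  define P where "P = {(c', d'). c' \<in> \<rat> \<and> d' \<in> \<rat> \<and> c \<le> c' \<and> c' < d' \<and> d' \<le> d \<and> d' - c' < \<eta>}"
  have cnt: "countable P"
    by (rule countable_subset[of _ "\<rat> \<times> \<rat>"]) (auto simp: P_def countable_rat)
  have neg: "negligible (\<Union>(B ` P))"
  proof (rule negligible_countable_Union)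
    show "countable (B ` P)" using cnt by simp
    show "negligible S" if S: "S \<in> B ` P" for S
    proof -
      obtain c' d' where "(c', d') \<in> P" "S = B (c', d')" using S by auto
      then show ?thesis
        using infinite_speed_negligible_short[of c d \<eta> \<rho> c' d', OF small sym]
        by (simp add: P_def B_def)
    qed
  qed
  have sub: "B (c, d) \<subseteq> \<Union>(B ` P)"
  proof
    fix t assume t: "t \<in> B (c, d)"
    then have tt: "c < t" "t < d" by (auto simp: B_def)
    obtain c' where c': "c' \<in> \<rat>" "max c (t - \<eta>/2) < c'" "c' < t"
      using Rats_dense_in_real[of "max c (t - \<eta>/2)" t] tt \<eta> by auto
    obtain d' where d': "d' \<in> \<rat>" "t < d'" "d' < min d (t + \<eta>/2)"
      using Rats_dense_in_real[of t "min d (t + \<eta>/2)"] tt \<eta> by auto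
    have "(c', d') \<in> P" using c' d' by (auto simp: P_def)
    moreover have "t \<in> B (c', d')" using t c' d' by (auto simp: B_def)
    ultimately show "t \<in> \<Union>(B ` P)" by blast
  qed
  have "B (c, d) \<in> null_sets lebesgue"
    using negligible_subset[OF neg sub] by (simp add: negligible_iff_null_sets)
  then show ?thesis
    by (rule AE_I') (auto simp: B_def infinite_speed_def not_le)
qed

text \<open>An L2 bound makes the sequence uniformly integrable. Below height \<open>R\<close>
  dominated convergence applies, with a constant as the majorant; above it
  \<open>|y| \<le> y^2 / R\<close>, so the tails are uniformly small.\<close>

lemma (in finite_measure) tendsto_integral_of_bounded_L2:
  fixes G :: "nat \<Rightarrow> 'a \<Rightarrow> real"
  assumes meas [measurable]: "\<And>n. G n \<in> borel_measurable M" "\<phi> \<in> borel_measurable M"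
    and conv: "AE x in M. (\<lambda>n. G n x) \<longlonglongrightarrow> 0"
    and int: "\<And>n. integrable M (\<lambda>x. (G n x)\<^sup>2)" and B: "\<And>n. (\<integral>x. (G n x)\<^sup>2 \<partial>M) \<le> B"
    and K: "AE x in M. \<bar>\<phi> x\<bar> \<le> K"
  shows "(\<lambda>n. \<integral>x. \<phi> x * G n x \<partial>M) \<longlonglongrightarrow> 0"
proof (rule LIMSEQ_I)
  fix r :: real assume "0 < r"
  define K' where "K' = max K 0 + 1"
  have K': "0 < K'" "K \<le> K'" by (auto simp: K'_def)
  define B' where "B' = max B 0 + 1"
  have B': "0 < B'" "B \<le> B'" by (auto simp: B'_def)
  \<comment> \<open>Chosen so that the tails cost \<open>K' * B' / R = r / 2\<close>; the truncated
    part is given the other half.\<close>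
  define R where "R = 2 * K' * B' / r"
  have R: "0 < R" using K' B' \<open>0 < r\<close> by (simp add: R_def)
  have int_min: "integrable M (\<lambda>x. min \<bar>G n x\<bar> R)" for n
    by (rule integrable_const_bound[of _ R]) (use R in auto)
  have "(\<lambda>n. \<integral>x. min \<bar>G n x\<bar> R \<partial>M) \<longlonglongrightarrow> (\<integral>x. 0 \<partial>M)"
  proof (rule integral_dominated_convergence[where w = "\<lambda>_. R"])
    show "AE x in M. (\<lambda>n. min \<bar>G n x\<bar> R) \<longlonglongrightarrow> 0"
      using conv
    proof eventually_elim
      case (elim x)
      have "(\<lambda>n. min \<bar>G n x\<bar> R) \<longlonglongrightarrow> min \<bar>0\<bar> R"
        by (intro tendsto_intros elim)
      then show ?case using R by simp
    qed
  qed (use R in auto)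
  then have "(\<lambda>n. \<integral>x. min \<bar>G n x\<bar> R \<partial>M) \<longlonglongrightarrow> 0" by simp
  then obtain N where N: "\<And>n. n \<ge> N \<Longrightarrow> \<bar>\<integral>x. min \<bar>G n x\<bar> R \<partial>M\<bar> < r / (2 * K')"
    using LIMSEQ_D[of _ 0 "r / (2 * K')"] K' \<open>0 < r\<close> by fastforce
  show "\<exists>N. \<forall>n\<ge>N. norm ((\<integral>x. \<phi> x * G n x \<partial>M) - 0) < r"
  proof (intro exI[of _ N] allI impI)
    fix n assume n: "N \<le> n"
    have le: "\<bar>y\<bar> \<le> min \<bar>y\<bar> R + y\<^sup>2 / R" for y
    proof (cases "\<bar>y\<bar> \<le> R")
      case False
      then have "R * \<bar>y\<bar> \<le> \<bar>y\<bar> * \<bar>y\<bar>" by (intro mult_right_mono) auto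
      then have "\<bar>y\<bar> \<le> y\<^sup>2 / R" using R by (simp add: pos_le_divide_eq mult.commute power2_eq_square)
      then show ?thesis using R by simp
    qed (use R in auto)
    have AE_le: "AE x in M. norm (\<phi> x * G n x) \<le> K' * (min \<bar>G n x\<bar> R + (G n x)\<^sup>2 / R)"
      using K
    proof eventually_elim
      case (elim x)
      then show ?case
        using mult_mono[of "\<bar>\<phi> x\<bar>" K' "\<bar>G n x\<bar>", OF _ le[of "G n x"]] K' by (simp add: abs_mult)
    qed
    have intb: "integrable M (\<lambda>x. K' * (min \<bar>G n x\<bar> R + (G n x)\<^sup>2 / R))"
      using int int_min by auto
    have "norm (\<integral>x. \<phi> x * G n x \<partial>M) \<le> (\<integral>x. norm (\<phi> x * G n x) \<partial>M)"
      by (rule integral_norm_bound)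
    also have "\<dots> \<le> (\<integral>x. K' * (min \<bar>G n x\<bar> R + (G n x)\<^sup>2 / R) \<partial>M)"
      using R K' by (intro integral_mono_AE'[OF intb AE_le] AE_I2 mult_nonneg_nonneg) auto
    also have "\<dots> = K' * ((\<integral>x. min \<bar>G n x\<bar> R \<partial>M) + (\<integral>x. (G n x)\<^sup>2 \<partial>M) / R)"
      using int int_min by simp
    also have "\<dots> < K' * (r / (2 * K') + B' / R)"
    proof (intro mult_strict_left_mono add_less_le_mono)
      show "(\<integral>x. min \<bar>G n x\<bar> R \<partial>M) < r / (2 * K')" using N[OF n] by simp
      show "(\<integral>x. (G n x)\<^sup>2 \<partial>M) / R \<le> B' / R"
        using B[of n] B' R by (intro divide_right_mono) auto
    qed fact
    also have "\<dots> = r" using K' B' \<open>0 < r\<close> by (simp add: R_def field_simps)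
    finally show "norm ((\<integral>x. \<phi> x * G n x \<partial>M) - 0) < r" by simp
  qed
qed

section \<open>Energies of absolutely continuous curves\<close>

lemma in_L2_iff:
  "in_L2 a b f \<longleftrightarrow> f \<in> borel_measurable (lebesgue_on {a..b}) \<and>
     integrable (lebesgue_on {a..b}) (\<lambda>x. (f x)\<^sup>2)"
  unfolding in_L2_def set_borel_measurable_def set_integrable_def
  by (simp add: borel_measurable_restrict_space_iff integrable_restrict_space)

lemma set_lebesgue_integral_eq_lebesgue_on:
  fixes f :: "real \<Rightarrow> real"
  shows "(LINT x:{a..b}|lebesgue. f x) = integral\<^sup>L (lebesgue_on {a..b}) f"
  unfolding set_lebesgue_integral_def by (simp add: integral_restrict_space)

lemma finite_measure_lebesgue_on_Icc: "finite_measure (lebesgue_on {a..b::real})"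
  by (intro finite_measureI) (simp add: emeasure_restrict_space space_restrict_space emeasure_lborel_Icc_eq)

lemma integrable_mult_of_squares:
  fixes f g :: "'a \<Rightarrow> real"
  assumes "f \<in> borel_measurable M" "g \<in> borel_measurable M"
    "integrable M (\<lambda>x. (f x)\<^sup>2)" "integrable M (\<lambda>x. (g x)\<^sup>2)"
  shows "integrable M (\<lambda>x. f x * g x)"
proof (rule Bochner_Integration.integrable_bound)
  show "integrable M (\<lambda>x. (f x)\<^sup>2 + (g x)\<^sup>2)" using assms by simp
  show "(\<lambda>x. f x * g x) \<in> borel_measurable M" using assms by simp
  have "\<bar>x * y\<bar> \<le> x\<^sup>2 + y\<^sup>2" for x y :: real
  proof -
    have "2 * \<bar>x\<bar> * \<bar>y\<bar> \<le> \<bar>x\<bar>\<^sup>2 + \<bar>y\<bar>\<^sup>2" by (rule sum_squares_bound)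
    moreover have "0 \<le> \<bar>x\<bar> * \<bar>y\<bar>" by simp
    ultimately have "\<bar>x\<bar> * \<bar>y\<bar> \<le> \<bar>x\<bar>\<^sup>2 + \<bar>y\<bar>\<^sup>2" by linarith
    then show ?thesis by (simp add: abs_mult)
  qed
  then show "AE x in M. norm (f x * g x) \<le> norm ((f x)\<^sup>2 + (g x)\<^sup>2)" by simp
qed

text \<open>Serves the L2 inner product and, later, the bending form shifted by its infimum. The
  latter is only semidefinite, whence the case \<open>C = 0\<close>: a nonnegative affine function
  of \<open>s\<close> has slope zero. Otherwise evaluate at the minimizer
  \<open>- B / C\<close>.\<close>

lemma quadratic_nonneg_discriminant:
  fixes A B C :: real
  assumes q: "\<And>s. 0 \<le> A + 2 * s * B + s\<^sup>2 * C" and C: "0 \<le> C"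
  shows "B\<^sup>2 \<le> A * C"
proof (cases "C = 0")
  case True
  have "B = 0"
  proof (rule ccontr)
    assume B: "B \<noteq> 0"
    have "2 * (- (A + 1) / (2 * B)) * B = - (A + 1)" using B by simp
    then show False using q[of "- (A + 1) / (2 * B)"] True by simp
  qed
  then show ?thesis using True by simp
next
  case False
  then have C: "0 < C" using C by linarith
  have "A + 2 * (- B / C) * B + (- B / C)\<^sup>2 * C = A - B\<^sup>2 / C"
    using C by (simp add: power2_eq_square)
  then have "0 \<le> A - B\<^sup>2 / C" using q[of "- B / C"] by metis
  then have "B\<^sup>2 / C \<le> A" by simp
  then show ?thesis using C by (simp add: pos_divide_le_eq)
qed

lemma Cauchy_Schwarz_integral:
  fixes f g :: "'a \<Rightarrow> real"
  assumes m: "f \<in> borel_measurable M" "g \<in> borel_measurable M"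
    and i: "integrable M (\<lambda>x. (f x)\<^sup>2)" "integrable M (\<lambda>x. (g x)\<^sup>2)"
  shows "(\<integral>x. f x * g x \<partial>M)\<^sup>2 \<le> (\<integral>x. (f x)\<^sup>2 \<partial>M) * (\<integral>x. (g x)\<^sup>2 \<partial>M)"
proof -
  let ?A = "\<integral>x. (f x)\<^sup>2 \<partial>M" and ?B = "\<integral>x. f x * g x \<partial>M" and ?C = "\<integral>x. (g x)\<^sup>2 \<partial>M"
  note fg = integrable_mult_of_squares[OF m i]
  have q: "0 \<le> ?A - 2 * l * ?B + l\<^sup>2 * ?C" for l
  proof -
    have "0 \<le> (\<integral>x. (f x - l * g x)\<^sup>2 \<partial>M)" by simp
    also have "(\<lambda>x. (f x - l * g x)\<^sup>2) = (\<lambda>x. (f x)\<^sup>2 - 2 * l * (f x * g x) + l\<^sup>2 * (g x)\<^sup>2)"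
      by (simp add: power2_eq_square algebra_simps fun_eq_iff)
    also have "(\<integral>x. (f x)\<^sup>2 - 2 * l * (f x * g x) + l\<^sup>2 * (g x)\<^sup>2 \<partial>M) = ?A - 2 * l * ?B + l\<^sup>2 * ?C"
      using i fg by simp
    finally show ?thesis .
  qed
  show ?thesis
  proof (rule quadratic_nonneg_discriminant)
    show "0 \<le> ?A + 2 * l * ?B + l\<^sup>2 * ?C" for l using q[of "- l"] by simp
  qed simp
qed

lemma in_L2_diff:
  assumes "in_L2 a b f" "in_L2 a b g" shows "in_L2 a b (\<lambda>x. f x - g x)"
proof -
  let ?M = "lebesgue_on {a..b}"
  have "integrable ?M (\<lambda>x. (f x)\<^sup>2 - 2 * (f x * g x) + (g x)\<^sup>2)"
    using assms integrable_mult_of_squares[of f ?M g] by (simp add: in_L2_iff)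
  then have "integrable ?M (\<lambda>x. (f x - g x)\<^sup>2)"
    by (simp add: power2_diff algebra_simps)
  then show ?thesis using assms by (simp add: in_L2_iff borel_measurable_diff)
qed

lemma in_L2_scale: "in_L2 a b f \<Longrightarrow> in_L2 a b (\<lambda>x. c * f x)"
  by (simp add: in_L2_iff power_mult_distrib borel_measurable_times)

lemma in_L2_add:
  assumes "in_L2 a b f" "in_L2 a b g" shows "in_L2 a b (\<lambda>x. f x + g x)"
  using in_L2_diff[OF assms(1) in_L2_scale[OF assms(2), of "-1"]] by simp

lemma in_L2_const: "in_L2 a b (\<lambda>_. c)"
proof -
  interpret finite_measure "lebesgue_on {a..b}" by (rule finite_measure_lebesgue_on_Icc)
  show ?thesis by (simp add: in_L2_iff)
qed

lemma in_L2_subinterval: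
  assumes "in_L2 a b f" "a \<le> a'" "b' \<le> b"
  shows "in_L2 a' b' f"
  unfolding in_L2_def
proof
  have sub: "{a'..b'} \<subseteq> {a..b}" using assms by auto
  show "set_integrable lebesgue {a'..b'} (\<lambda>x. (f x)\<^sup>2)"
    by (rule set_integrable_subset[OF _ _ sub]) (use assms in \<open>auto simp: in_L2_def\<close>)
  show "set_borel_measurable lebesgue {a'..b'} f"
    by (rule set_borel_measurable_subset[OF _ _ sub]) (use assms in \<open>auto simp: in_L2_def\<close>)
qed

lemma in_L2_continuous:
  assumes "continuous_on {a..b} f"
  shows "in_L2 a b f"
proof -
  have "f absolutely_integrable_on {a..b}" "(\<lambda>x. (f x)\<^sup>2) absolutely_integrable_on {a..b}"
    by (auto intro!: absolutely_integrable_continuous_real continuous_intros assms)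
  then show ?thesis unfolding in_L2_def
    by (auto simp: set_borel_measurable_def set_integrable_def dest: borel_measurable_integrable)
qed

lemma L2norm_power2: "(L2norm a b f)\<^sup>2 = integral\<^sup>L (lebesgue_on {a..b}) (\<lambda>x. (f x)\<^sup>2)"
  unfolding L2norm_def set_lebesgue_integral_eq_lebesgue_on by simp

lemma L2norm_nonneg: "0 \<le> L2norm a b f"
  unfolding L2norm_def set_lebesgue_integral_eq_lebesgue_on by simp

lemma L2norm_subinterval:
  assumes "in_L2 a b f" "a \<le> a'" "b' \<le> b"
  shows "L2norm a' b' f \<le> L2norm a b f"
proof -
  have sub: "{a'..b'} \<subseteq> {a..b}" using assms by auto
  have "(LINT x:{a'..b'}|lebesgue. (f x)\<^sup>2) \<le> (LINT x:{a..b}|lebesgue. (f x)\<^sup>2)"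
    unfolding set_lebesgue_integral_def
    using assms(1) in_L2_subinterval[OF assms] sub
    by (intro integral_mono) (auto simp: in_L2_def set_integrable_def indicator_def)
  then show ?thesis unfolding L2norm_def by simp
qed

lemma L2_inner_le:
  assumes "in_L2 a b f" "in_L2 a b g"
  shows "\<bar>integral\<^sup>L (lebesgue_on {a..b}) (\<lambda>x. f x * g x)\<bar> \<le> L2norm a b f * L2norm a b g"
proof (rule power2_le_imp_le)
  show "\<bar>integral\<^sup>L (lebesgue_on {a..b}) (\<lambda>x. f x * g x)\<bar>\<^sup>2 \<le> (L2norm a b f * L2norm a b g)\<^sup>2"
    using Cauchy_Schwarz_integral[of f "lebesgue_on {a..b}" g] assms
    by (simp add: in_L2_iff power_mult_distrib L2norm_power2)
qed (simp add: L2norm_nonneg)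

lemma L2norm_diff_le:
  assumes fg: "in_L2 a b f" "in_L2 a b g"
  shows "\<bar>L2norm a b f - L2norm a b g\<bar> \<le> L2norm a b (\<lambda>x. f x - g x)"
proof (rule power2_le_imp_le)
  let ?I = "integral\<^sup>L (lebesgue_on {a..b})"
  have "(\<lambda>x. (f x - g x)\<^sup>2) = (\<lambda>x. (f x)\<^sup>2 - 2 * (f x * g x) + (g x)\<^sup>2)"
    by (simp add: power2_diff fun_eq_iff)
  moreover have "?I (\<lambda>x. (f x)\<^sup>2 - 2 * (f x * g x) + (g x)\<^sup>2)
      = ?I (\<lambda>x. (f x)\<^sup>2) - 2 * ?I (\<lambda>x. f x * g x) + ?I (\<lambda>x. (g x)\<^sup>2)"
    using fg integrable_mult_of_squares[of f _ g] by (simp add: in_L2_iff)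
  ultimately have "(L2norm a b (\<lambda>x. f x - g x))\<^sup>2
      = ?I (\<lambda>x. (f x)\<^sup>2) - 2 * ?I (\<lambda>x. f x * g x) + ?I (\<lambda>x. (g x)\<^sup>2)"
    by (simp add: L2norm_power2)
  moreover have "(L2norm a b f - L2norm a b g)\<^sup>2
      = ?I (\<lambda>x. (f x)\<^sup>2) - 2 * (L2norm a b f * L2norm a b g) + ?I (\<lambda>x. (g x)\<^sup>2)"
    by (simp add: power2_diff L2norm_power2)
  ultimately show "\<bar>L2norm a b f - L2norm a b g\<bar>\<^sup>2 \<le> (L2norm a b (\<lambda>x. f x - g x))\<^sup>2"
    using L2_inner_le[OF fg] by simp
qed (simp add: L2norm_nonneg)

lemma L2norm_add_le:
  assumes "in_L2 a b f" "in_L2 a b g"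
  shows "L2norm a b (\<lambda>x. f x + g x) \<le> L2norm a b f + L2norm a b g"
  using L2norm_diff_le[OF in_L2_add[OF assms] assms(2)] by simp

text \<open>The offset \<open>k\<close> is nonzero only for the left segment during
  \<open>I2\<close>, whose two ends carry the same input value; measured from that value the profile
  vanishes at both ends.\<close>

definition energy :: "real \<Rightarrow> real \<Rightarrow> real \<Rightarrow> (real \<Rightarrow> real) \<Rightarrow> real" where
  "energy a b k f = (1/2) * (LINT x:{a..b}|lebesgue. (f x - k)\<^sup>2)"

lemma energy_eq: "energy a b k f = (1/2) * (L2norm a b (\<lambda>x. f x - k))\<^sup>2"
  unfolding energy_def L2norm_power2 set_lebesgue_integral_eq_lebesgue_on ..

lemma energy_nonneg: "0 \<le> energy a b k f"
  by (simp add: energy_eq)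

lemma energy_diff_le:
  assumes "in_L2 a b f" "in_L2 a b g"
  shows "\<bar>energy a b k f - energy a b k g\<bar>
      \<le> (1/2) * L2norm a b (\<lambda>x. f x - g x) * (L2norm a b f + L2norm a b g + 2 * L2norm a b (\<lambda>_. k))"
proof -
  let ?F = "\<lambda>x. f x - k" and ?G = "\<lambda>x. g x - k"
  note L2 = in_L2_diff[OF assms(1) in_L2_const] in_L2_diff[OF assms(2) in_L2_const]
  have eq: "energy a b k f - energy a b k g
     = (1/2) * (L2norm a b ?F - L2norm a b ?G) * (L2norm a b ?F + L2norm a b ?G)"
    by (simp add: energy_eq power2_eq_square algebra_simps)
  have "\<bar>energy a b k f - energy a b k g\<bar>
     = (1/2) * \<bar>L2norm a b ?F - L2norm a b ?G\<bar> * (L2norm a b ?F + L2norm a b ?G)"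
    unfolding eq by (simp add: abs_mult L2norm_nonneg)
  moreover have "\<bar>L2norm a b ?F - L2norm a b ?G\<bar> \<le> L2norm a b (\<lambda>x. f x - g x)"
    using L2norm_diff_le[OF L2, of k k] by simp
  moreover have "L2norm a b ?F \<le> L2norm a b f + L2norm a b (\<lambda>_. k)"
    "L2norm a b ?G \<le> L2norm a b g + L2norm a b (\<lambda>_. k)"
    using L2norm_add_le[OF assms(1) in_L2_const[of a b "-k"]] L2norm_add_le[OF assms(2) in_L2_const[of a b "-k"]]
    by (simp_all add: L2norm_def)
  ultimately show ?thesis
    using mult_mono[of "\<bar>L2norm a b ?F - L2norm a b ?G\<bar>" "L2norm a b (\<lambda>x. f x - g x)"
        "L2norm a b ?F + L2norm a b ?G" "L2norm a b f + L2norm a b g + 2 * L2norm a b (\<lambda>_. k)"]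
    by (simp add: abs_mult L2norm_nonneg)
qed

text \<open>On a compact time interval the curve is bounded in norm, and on bounded sets the energy
  is Lipschitz for the L2 distance. The curve is controlled on the whole interval, whereas the
  energies live on the pieces.\<close>

lemma abs_cont_energy:
  assumes L2: "\<And>s. s \<in> {c..d} \<Longrightarrow> in_L2 a b (\<lambda>x. u x s)"
    and ac: "abs_cont (\<lambda>s t. L2norm a b (\<lambda>x. u x s - u x t)) c d"
    and sub: "a \<le> a'" "b' \<le> b"
  shows "abs_cont_fun (\<lambda>s. energy a' b' k (\<lambda>x. u x s)) c d"
proof -
  let ?n = "\<lambda>s. L2norm a b (\<lambda>x. u x s)"
  have n: "abs_cont_fun ?n c d"
  proof (rule abs_cont_dominated[OF ac ac zero_le_one])
    fix s t assume "c \<le> s" "s \<le> t" "t \<le> d"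
    then show "\<bar>?n s - ?n t\<bar> \<le> 1 * (L2norm a b (\<lambda>x. u x s - u x t) + L2norm a b (\<lambda>x. u x s - u x t))"
      using L2norm_diff_le[OF L2 L2, of s t] L2norm_nonneg[of a b "\<lambda>x. u x s - u x t"] by simp
  qed
  obtain M where M: "\<And>s. s \<in> {c..d} \<Longrightarrow> \<bar>?n s\<bar> \<le> M"
    using continuous_on_Icc_bounded[OF abs_cont_imp_continuous_on[OF n]] by blast
  define R where "R = \<bar>M\<bar> + L2norm a' b' (\<lambda>_. k)"
  have R: "0 \<le> R" by (simp add: R_def L2norm_nonneg)
  show ?thesis
  proof (rule abs_cont_dominated[OF ac ac R])
    fix s t assume st: "c \<le> s" "s \<le> t" "t \<le> d"
    have Ls: "in_L2 a b (\<lambda>x. u x s)" and Lt: "in_L2 a b (\<lambda>x. u x t)" using L2 st by auto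
    note Ls' = in_L2_subinterval[OF Ls sub] and Lt' = in_L2_subinterval[OF Lt sub]
    have n: "L2norm a' b' (\<lambda>x. u x s) \<le> \<bar>M\<bar>" "L2norm a' b' (\<lambda>x. u x t) \<le> \<bar>M\<bar>"
      using M[of s] M[of t] st L2norm_subinterval[OF Ls sub] L2norm_subinterval[OF Lt sub] by auto
    have "\<bar>energy a' b' k (\<lambda>x. u x s) - energy a' b' k (\<lambda>x. u x t)\<bar>
      \<le> (1/2) * L2norm a' b' (\<lambda>x. u x s - u x t) *
        (L2norm a' b' (\<lambda>x. u x s) + L2norm a' b' (\<lambda>x. u x t) + 2 * L2norm a' b' (\<lambda>_. k))"
      by (rule energy_diff_le[OF Ls' Lt'])
    also have "\<dots> \<le> (1/2) * L2norm a b (\<lambda>x. u x s - u x t) * (2 * R)"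
      using L2norm_subinterval[OF in_L2_diff[OF Ls Lt] sub] n
      by (intro mult_mono mult_nonneg_nonneg add_nonneg_nonneg) (auto simp: R_def L2norm_nonneg)
    finally show "\<bar>energy a' b' k (\<lambda>x. u x s) - energy a' b' k (\<lambda>x. u x t)\<bar>
        \<le> R * (L2norm a b (\<lambda>x. u x s - u x t) + L2norm a b (\<lambda>x. u x s - u x t))"
      by (simp add: algebra_simps)
  qed
qed

text \<open>Finite metric speed bounds the difference quotients in \<open>L\<^sup>2\<close>, so that pointwise
  convergence almost everywhere suffices to pass to the limit against the bounded state.\<close>
lemma energy_has_derivative:
  assumes D: "t \<in> interior D" and L2: "\<And>s. s \<in> D \<Longrightarrow> in_L2 a b (\<lambda>x. u x s)"
    and speed: "0 < \<delta>" "\<And>s. s \<noteq> t \<Longrightarrow> \<bar>s - t\<bar> < \<delta> \<Longrightarrow> L2norm a b (\<lambda>x. u x t - u x s) \<le> M * \<bar>s - t\<bar>"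
    and K: "\<And>x. x \<in> {a..b} \<Longrightarrow> \<bar>u x t\<bar> \<le> K"
    and f: "in_L2 a b f"
    and der: "AE x in lebesgue. x \<in> {a..b} \<longrightarrow> ((\<lambda>s. u x s) has_real_derivative f x) (at t within D)"
  shows "((\<lambda>s. energy a b k (\<lambda>x. u x s)) has_real_derivative
            (LINT x:{a..b}|lebesgue. (u x t - k) * f x)) (at t)"
  unfolding has_field_derivative_iff
proof (rule Lim_within_LIMSEQ, intro allI impI)
  let ?M = "lebesgue_on {a..b}"
  interpret finite_measure ?M by (rule finite_measure_lebesgue_on_Icc)
  fix X :: "nat \<Rightarrow> real" assume X: "(\<forall>n. X n \<noteq> t \<and> X n \<in> UNIV) \<and> X \<longlonglongrightarrow> t"
  have "\<forall>\<^sub>F n in sequentially. X n \<in> interior D \<inter> ball t \<delta>"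
    by (rule topological_tendstoD) (use X D speed(1) in auto)
  then obtain N where N: "\<And>n. n \<ge> N \<Longrightarrow> X n \<in> interior D \<inter> ball t \<delta>"
    unfolding eventually_sequentially by blast
  \<comment> \<open>Dropping finitely many terms puts the whole sequence inside \<open>D\<close> and
    within the range of the speed bound.\<close>
  define Z where "Z n = X (n + N)" for n
  have Z: "Z n \<in> D" "\<bar>Z n - t\<bar> < \<delta>" "Z n \<noteq> t" for n
    using N[of "n + N"] interior_subset[of D] X by (auto simp: Z_def dist_real_def abs_minus_commute)
  have Zt: "Z \<longlonglongrightarrow> t" unfolding Z_def using X by (intro LIMSEQ_ignore_initial_segment) auto
  have tD: "t \<in> D" using D interior_subset by blast
  define g where "g n x = (u x (Z n) - u x t) / (Z n - t)" for n x
  have gL2: "in_L2 a b (g n)" for n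
    using in_L2_scale[OF in_L2_diff[OF L2[OF Z(1)] L2[OF tD]], of "1 / (Z n - t)" n]
    by (simp add: g_def[abs_def])
  have gM: "integral\<^sup>L ?M (\<lambda>x. (g n x)\<^sup>2) \<le> M\<^sup>2" for n
  proof -
    have "integral\<^sup>L ?M (\<lambda>x. (g n x)\<^sup>2) = integral\<^sup>L ?M (\<lambda>x. (u x t - u x (Z n))\<^sup>2 / (Z n - t)\<^sup>2)"
      by (simp add: g_def power_divide power2_commute)
    also have "\<dots> = (L2norm a b (\<lambda>x. u x t - u x (Z n)))\<^sup>2 / (Z n - t)\<^sup>2"
      by (simp add: L2norm_power2)
    also have "\<dots> \<le> (M * \<bar>Z n - t\<bar>)\<^sup>2 / (Z n - t)\<^sup>2"
      using speed(2)[OF Z(3,2)] L2norm_nonneg by (intro divide_right_mono power_mono) auto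
    also have "\<dots> = M\<^sup>2" using Z(3)[of n] by (simp add: power_mult_distrib)
    finally show ?thesis .
  qed
  define G where "G n x = g n x - f x" for n x
  have GL2: "in_L2 a b (G n)" for n
    unfolding G_def[abs_def] by (rule in_L2_diff[OF gL2 f])
  have Gn: "L2norm a b (G n) \<le> \<bar>M\<bar> + L2norm a b f" for n
  proof -
    have "(L2norm a b (g n))\<^sup>2 \<le> \<bar>M\<bar>\<^sup>2" using gM[of n] by (simp add: L2norm_power2)
    then have "L2norm a b (g n) \<le> \<bar>M\<bar>" by (rule power2_le_imp_le) simp
    moreover have "L2norm a b (G n) \<le> L2norm a b (g n) + L2norm a b (\<lambda>x. - f x)"
      using L2norm_add_le[OF gL2 in_L2_scale[OF f, of "-1"]] by (simp add: G_def[abs_def])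
    moreover have "L2norm a b (\<lambda>x. - f x) = L2norm a b f" by (simp add: L2norm_def)
    ultimately show ?thesis by simp
  qed
  have uL2: "in_L2 a b (\<lambda>x. u x t - k)" by (rule in_L2_diff[OF L2[OF tD] in_L2_const])
  have lim: "(\<lambda>n. \<integral>x. (u x t - k) * G n x \<partial>?M) \<longlonglongrightarrow> 0"
  proof (rule tendsto_integral_of_bounded_L2[where B = "(\<bar>M\<bar> + L2norm a b f)\<^sup>2" and K = "K + \<bar>k\<bar>"])
    show "G n \<in> borel_measurable ?M" "integrable ?M (\<lambda>x. (G n x)\<^sup>2)" for n
      using GL2[of n] by (simp_all add: in_L2_iff)
    show "(\<lambda>x. u x t - k) \<in> borel_measurable ?M" using uL2 by (simp add: in_L2_iff)
    show "(\<integral>x. (G n x)\<^sup>2 \<partial>?M) \<le> (\<bar>M\<bar> + L2norm a b f)\<^sup>2" for n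
      using power_mono[OF Gn L2norm_nonneg, of n 2] by (simp add: L2norm_power2)
    show "AE x in ?M. \<bar>u x t - k\<bar> \<le> K + \<bar>k\<bar>"
    proof (rule AE_I2)
      fix x assume "x \<in> space ?M"
      then show "\<bar>u x t - k\<bar> \<le> K + \<bar>k\<bar>" using K[of x] by (simp add: space_restrict_space)
    qed
    show "AE x in ?M. (\<lambda>n. G n x) \<longlonglongrightarrow> 0"
    proof (subst AE_restrict_space_iff)
      show "AE x in lebesgue. x \<in> {a..b} \<longrightarrow> (\<lambda>n. G n x) \<longlonglongrightarrow> 0"
        using der
      proof eventually_elim
        case (elim x)
        show ?case
        proof
          assume "x \<in> {a..b}"
          then have "((\<lambda>s. (u x s - u x t) / (s - t)) \<longlongrightarrow> f x) (at t within D)"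
            using elim by (simp add: has_field_derivative_iff)
          then have "(\<lambda>n. g n x) \<longlonglongrightarrow> f x"
            using Z Zt unfolding tendsto_at_iff_sequentially g_def comp_def by blast
          then show "(\<lambda>n. G n x) \<longlonglongrightarrow> 0"
            unfolding G_def using tendsto_diff[OF _ tendsto_const[of "f x"]] by fastforce
        qed
      qed
    qed simp
  qed
  \<comment> \<open>Expansion of the square around time \<open>t\<close>. The last term is the
    quadratic remainder; the quotients \<open>g n\<close> have squared norm at most
    \<open>M\<^sup>2\<close>, so it vanishes with \<open>Z n - t\<close>.\<close>
  have quot: "(energy a b k (\<lambda>x. u x (Z n)) - energy a b k (\<lambda>x. u x t)) / (Z n - t)
      = (\<integral>x. (u x t - k) * G n x \<partial>?M) + (\<integral>x. (u x t - k) * f x \<partial>?M)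
        + (Z n - t) / 2 * (\<integral>x. (g n x)\<^sup>2 \<partial>?M)" for n
  proof -
    let ?h = "Z n - t"
    have h: "?h \<noteq> 0" using Z(3)[of n] by simp
    have i1: "integrable ?M (\<lambda>x. (u x t - k) * G n x)" and i2: "integrable ?M (\<lambda>x. (u x t - k) * f x)"
      using uL2 GL2[of n] f integrable_mult_of_squares by (auto simp: in_L2_iff)
    have i3: "integrable ?M (\<lambda>x. (g n x)\<^sup>2)" using gL2 by (simp add: in_L2_iff)
    have i4: "integrable ?M (\<lambda>x. (u x t - k)\<^sup>2)" using uL2 by (simp add: in_L2_iff)
    have "(u x (Z n) - k)\<^sup>2 = (u x t - k)\<^sup>2 + 2 * ?h * ((u x t - k) * G n x)
        + 2 * ?h * ((u x t - k) * f x) + ?h\<^sup>2 * (g n x)\<^sup>2" for x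
    proof -
      have eq: "u x (Z n) = u x t + ?h * g n x" using h by (simp add: g_def)
      have "(u x t + h * g n x - k)\<^sup>2 = (u x t - k)\<^sup>2 + 2 * h * ((u x t - k) * G n x)
        + 2 * h * ((u x t - k) * f x) + h\<^sup>2 * (g n x)\<^sup>2" for h
        by (simp add: G_def power2_eq_square algebra_simps)
      then show ?thesis unfolding eq .
    qed
    then have "energy a b k (\<lambda>x. u x (Z n)) = (1/2) * (\<integral>x. (u x t - k)\<^sup>2 + 2 * ?h * ((u x t - k) * G n x)
        + 2 * ?h * ((u x t - k) * f x) + ?h\<^sup>2 * (g n x)\<^sup>2 \<partial>?M)"
      by (simp add: energy_def set_lebesgue_integral_eq_lebesgue_on)
    also have "\<dots> = energy a b k (\<lambda>x. u x t) + ?h * (\<integral>x. (u x t - k) * G n x \<partial>?M)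
        + ?h * (\<integral>x. (u x t - k) * f x \<partial>?M) + ?h\<^sup>2 / 2 * (\<integral>x. (g n x)\<^sup>2 \<partial>?M)"
      using i1 i2 i3 i4
      by (simp add: energy_def set_lebesgue_integral_eq_lebesgue_on) (simp add: algebra_simps)
    finally show ?thesis using h by (simp add: power2_eq_square divide_simps) (simp add: algebra_simps)
  qed
  have "(\<lambda>n. (Z n - t) / 2 * (\<integral>x. (g n x)\<^sup>2 \<partial>?M)) \<longlonglongrightarrow> 0"
  proof (rule Lim_null_comparison)
    show "\<forall>\<^sub>F n in sequentially. norm ((Z n - t) / 2 * (\<integral>x. (g n x)\<^sup>2 \<partial>?M)) \<le> \<bar>Z n - t\<bar> / 2 * M\<^sup>2"
      using gM by (intro always_eventually allI) (auto simp: abs_mult intro!: mult_left_mono)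
    show "(\<lambda>n. \<bar>Z n - t\<bar> / 2 * M\<^sup>2) \<longlonglongrightarrow> 0"
      using tendsto_mult[OF tendsto_divide[OF tendsto_rabs[OF tendsto_diff[OF Zt tendsto_const[of t]]]
          tendsto_const[of 2]] tendsto_const[of "M\<^sup>2"]] by simp
  qed
  from tendsto_add[OF tendsto_add[OF lim tendsto_const[of "\<integral>x. (u x t - k) * f x \<partial>?M"]] this]
  have "(\<lambda>n. (energy a b k (\<lambda>x. u x (Z n)) - energy a b k (\<lambda>x. u x t)) / (Z n - t))
      \<longlonglongrightarrow> (LINT x:{a..b}|lebesgue. (u x t - k) * f x)"
    unfolding quot set_lebesgue_integral_eq_lebesgue_on by simp
  then show "(\<lambda>n. (energy a b k (\<lambda>x. u x (X n)) - energy a b k (\<lambda>x. u x t)) / (X n - t))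
      \<longlonglongrightarrow> (LINT x:{a..b}|lebesgue. (u x t - k) * f x)"
    unfolding Z_def by (rule LIMSEQ_offset)
qed


text \<open>Lebesgue measure in the plane is a completion and not itself a product measure, so the
  exceptional set is first enlarged to a Borel null set, to which Fubini applies. Time is the outer
  variable: the equation becomes available at almost every fixed time.\<close>

lemma AE_lebesgue_pair:
  assumes "AE z in lebesgue. P (z :: real \<times> real)"
  shows "AE t in lebesgue. AE x in lebesgue. P (x, t)"
proof -
  obtain N where N: "N \<in> null_sets lborel" "{z. \<not> P z} \<subseteq> N"
    using assms unfolding eventually_ae_filter by (auto simp: null_sets_completion_iff2)
  have meas: "N \<in> sets (lborel \<Otimes>\<^sub>M lborel)" using N(1) unfolding lborel_prod by (rule null_setsD2)
  have "AE z in lborel \<Otimes>\<^sub>M lborel. z \<notin> N"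
    unfolding lborel_prod using N(1) by (rule AE_not_in)
  then have "AE x in lborel. AE t in lborel. (x, t) \<notin> N"
    by (rule lborel_pair.AE_pair)
  then have "AE t in lborel. AE x in lborel. (x, t) \<notin> N"
    by (subst (asm) lborel_pair.AE_commute)
      (use sets.compl_sets[OF meas] in \<open>auto simp: space_pair_measure Compl_eq_Diff_UNIV[symmetric] Compl_eq\<close>)
  then have "AE t in lborel. AE x in lebesgue. P (x, t)"
  proof eventually_elim
    case (elim t)
    then have "AE x in lborel. P (x, t)" by eventually_elim (use N(2) in blast)
    then show ?case by (rule AE_completion)
  qed
  then show ?thesis by (rule AE_completion)
qed

section \<open>The energy identity\<close>

lemmas integral_expand = integral_add integral_diff integrable_continuous_real
  continuous_on_mult continuous_on_power continuous_on_add continuous_on_diff continuous_on_const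

text \<open>Carrying the derivative as a second function avoids calculating with
  \<open>vector_derivative\<close>, which is meaningful only where a derivative is already known to
  exist.\<close>

definition deriv_on :: "real \<Rightarrow> real \<Rightarrow> (real \<Rightarrow> real) \<Rightarrow> (real \<Rightarrow> real) \<Rightarrow> bool" where
  "deriv_on a b f f' \<longleftrightarrow> (\<forall>x\<in>{a..b}. (f has_real_derivative f' x) (at x within {a..b}))"

lemma deriv_onD: "deriv_on a b f f' \<Longrightarrow> x \<in> {a..b} \<Longrightarrow> (f has_real_derivative f' x) (at x within {a..b})"
  by (simp add: deriv_on_def)

lemma deriv_on_continuous: "deriv_on a b f f' \<Longrightarrow> continuous_on {a..b} f"
  unfolding deriv_on_def by (rule DERIV_continuous_on) auto

lemma deriv_on_cong:
  assumes "deriv_on a b f f'" "\<And>x. x \<in> {a..b} \<Longrightarrow> g x = f x" "\<And>x. x \<in> {a..b} \<Longrightarrow> g' x = f' x"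
  shows "deriv_on a b g g'"
  unfolding deriv_on_def
proof
  fix x assume x: "x \<in> {a..b}"
  then have "(f has_real_derivative g' x) (at x within {a..b})"
    using assms by (simp add: deriv_on_def)
  then show "(g has_real_derivative g' x) (at x within {a..b})"
    by (rule has_field_derivative_transform_within[OF _ zero_less_one x]) (use assms(2) in auto)
qed

lemma deriv_on_add: "deriv_on a b f f' \<Longrightarrow> deriv_on a b g g' \<Longrightarrow> deriv_on a b (\<lambda>x. f x + g x) (\<lambda>x. f' x + g' x)"
  and deriv_on_diff: "deriv_on a b f f' \<Longrightarrow> deriv_on a b g g' \<Longrightarrow> deriv_on a b (\<lambda>x. f x - g x) (\<lambda>x. f' x - g' x)"
  and deriv_on_cmult: "deriv_on a b f f' \<Longrightarrow> deriv_on a b (\<lambda>x. c * f x) (\<lambda>x. c * f' x)"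
  and deriv_on_mult: "deriv_on a b f f' \<Longrightarrow> deriv_on a b g g' \<Longrightarrow>
      deriv_on a b (\<lambda>x. f x * g x) (\<lambda>x. f x * g' x + f' x * g x)"
  and deriv_on_const: "deriv_on a b (\<lambda>_. c) (\<lambda>_. 0)"
  unfolding deriv_on_def by (auto intro!: derivative_eq_intros)

lemma deriv_on_integral:
  assumes "deriv_on a b f f'" "a \<le> b"
  shows "(f' has_integral (f b - f a)) {a..b}"
  using assms by (intro fundamental_theorem_of_calculus)
    (auto simp: deriv_on_def has_real_derivative_iff_has_vector_derivative)

lemma deriv_on_by_parts:
  assumes ab: "a \<le> b" and f: "deriv_on a b f f'" and g: "deriv_on a b g g'"
    and cont: "continuous_on {a..b} f'" "continuous_on {a..b} g'"
  shows "integral {a..b} (\<lambda>x. f x * g' x) = f b * g b - f a * g a - integral {a..b} (\<lambda>x. f' x * g x)"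
proof -
  have "integral {a..b} (\<lambda>x. f x * g' x + f' x * g x) = f b * g b - f a * g a"
    by (rule integral_unique, rule deriv_on_integral[OF deriv_on_mult[OF f g] ab])
  moreover have "integral {a..b} (\<lambda>x. f x * g' x + f' x * g x)
      = integral {a..b} (\<lambda>x. f x * g' x) + integral {a..b} (\<lambda>x. f' x * g x)"
    by (intro integral_add integrable_continuous_real continuous_intros cont
        deriv_on_continuous[OF f] deriv_on_continuous[OF g])
  ultimately show ?thesis by simp
qed

lemma xderiv_Suc: "xderiv a b (Suc j) f x = vector_derivative (xderiv a b j f) (at x within {a..b})"
  by (simp add: xderiv_def)

lemma xderiv_0: "xderiv a b 0 f = f"
  by (simp add: xderiv_def)

lemma has_real_derivative_xderiv:
  assumes "a < b" "x \<in> {a..b}" "xderiv a b j f differentiable (at x within {a..b})"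
  shows "(xderiv a b j f has_real_derivative xderiv a b (Suc j) f x) (at x within {a..b})"
  using assms by (simp add: xderiv_Suc has_real_derivative_iff_has_vector_derivative vector_derivative_works)

lemma deriv_on_xderiv:
  assumes "a < b" "xderiv a b j f differentiable_on {a..b}"
  shows "deriv_on a b (xderiv a b j f) (xderiv a b (Suc j) f)"
  using assms has_real_derivative_xderiv unfolding deriv_on_def differentiable_on_def by blast

text \<open>One-sided derivatives are unique because the interval is nondegenerate. The induction
  keeps the identity on all of it, since the next derivative is taken within it.\<close>

lemma xderiv_eq_of_deriv_on:
  assumes ab: "a < b" and F: "\<And>i. i < j \<Longrightarrow> deriv_on a b (F i) (F (Suc i))"
  shows "i \<le> j \<Longrightarrow> x \<in> {a..b} \<Longrightarrow> xderiv a b i (F 0) x = F i x"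
proof (induction i arbitrary: x)
  case 0
  then show ?case by (simp add: xderiv_0)
next
  case (Suc i)
  then have "deriv_on a b (xderiv a b i (F 0)) (F (Suc i))"
    by (intro deriv_on_cong[OF F[of i]]) auto
  then have "(xderiv a b i (F 0) has_vector_derivative F (Suc i) x) (at x within {a..b})"
    using Suc.prems by (simp add: deriv_on_def has_real_derivative_iff_has_vector_derivative)
  then show ?case
    unfolding xderiv_Suc using Suc.prems ab
    by (intro vector_derivative_within_closed_interval) auto
qed

lemma abs_cont_add:
  fixes F G :: "real \<Rightarrow> real"
  assumes "abs_cont_fun F c d" "abs_cont_fun G c d"
  shows "abs_cont_fun (\<lambda>s. F s + G s) c d"
  by (rule abs_cont_dominated[OF assms, of 1]) auto

lemma abs_cont_deriv_on:
  assumes "deriv_on a b f f'" "continuous_on {a..b} f'"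
  shows "abs_cont_fun f a b"
  by (rule abs_cont_of_continuous_deriv[OF _ assms(2)]) (use assms(1) in \<open>simp add: deriv_on_def\<close>)

lemma H4_deriv_on:
  assumes "a < b" "H4 a b f"
  shows "deriv_on a b f (xderiv a b 1 f)"
    and "deriv_on a b (xderiv a b 1 f) (xderiv a b 2 f)"
    and "deriv_on a b (xderiv a b 2 f) (xderiv a b 3 f)"
    and "abs_cont_fun (xderiv a b 3 f) a b"
    and "continuous_on {a..b} (xderiv a b 3 f)"
    and "AE x in lebesgue. x \<in> {a..b} \<longrightarrow>
      (xderiv a b 3 f has_real_derivative xderiv a b 4 f x) (at x within {a..b})"
    and "in_L2 a b (xderiv a b 4 f)"
proof -
  have "deriv_on a b (xderiv a b j f) (xderiv a b (Suc j) f)" if "j < 3" for j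
    using deriv_on_xderiv[OF assms(1)] assms(2) that by (simp add: H4_def)
  from this[of 0] this[of 1] this[of 2]
  show "deriv_on a b f (xderiv a b 1 f)" "deriv_on a b (xderiv a b 1 f) (xderiv a b 2 f)"
    "deriv_on a b (xderiv a b 2 f) (xderiv a b 3 f)"
    by (simp_all add: xderiv_0 numeral_2_eq_2 numeral_3_eq_3)
  show ac: "abs_cont_fun (xderiv a b 3 f) a b"
    using assms(2) by (simp add: H4_def)
  then show "continuous_on {a..b} (xderiv a b 3 f)" by (rule abs_cont_imp_continuous_on)
  have "AE x in lebesgue. x \<in> {a..b} \<longrightarrow> xderiv a b 3 f differentiable (at x within {a..b})"
    using assms(2) by (simp add: H4_def)
  then show "AE x in lebesgue. x \<in> {a..b} \<longrightarrow>
      (xderiv a b 3 f has_real_derivative xderiv a b 4 f x) (at x within {a..b})"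
    by eventually_elim (use has_real_derivative_xderiv[OF assms(1), of _ 3 f] in simp)
  show "in_L2 a b (xderiv a b 4 f)" using assms(2) by (simp add: H4_def)
qed

abbreviation ks_rhs :: "real \<Rightarrow> real \<Rightarrow> real \<Rightarrow> (real \<Rightarrow> real) \<Rightarrow> real \<Rightarrow> real" where
  "ks_rhs lam a b f x \<equiv> - f x * xderiv a b 1 f x - lam * xderiv a b 2 f x - xderiv a b 4 f x"

text \<open>What the boundary contributes once the slope vanishes at both ends: convection tested
  with \<open>f\<close> gives the cubic term and tested with \<open>k\<close> the quadratic one, and
  the fourth derivative gives the rest. The boundary terms of the second derivative carry a factor
  \<open>f_x\<close> and drop out.\<close>

definition boundary_flux :: "real \<Rightarrow> real \<Rightarrow> real \<Rightarrow> (real \<Rightarrow> real) \<Rightarrow> real" where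
  "boundary_flux a b k f = - (f b ^ 3 - f a ^ 3) / 3 + k * ((f b)\<^sup>2 - (f a)\<^sup>2) / 2
      - (f b - k) * xderiv a b 3 f b + (f a - k) * xderiv a b 3 f a"

abbreviation sq_int :: "real \<Rightarrow> real \<Rightarrow> (real \<Rightarrow> real) \<Rightarrow> real" where
  "sq_int a b f \<equiv> integral {a..b} (\<lambda>x. (f x)\<^sup>2)"

lemma integral_square_nonneg:
  fixes f :: "real \<Rightarrow> real"
  shows "continuous_on {a..b} f \<Longrightarrow> 0 \<le> sq_int a b f"
  by (rule integral_nonneg) (auto intro!: integrable_continuous_real continuous_intros)

definition net_growth :: "real \<Rightarrow> real \<Rightarrow> real \<Rightarrow> (real \<Rightarrow> real) \<Rightarrow> real" where
  "net_growth lam a b f = lam * sq_int a b (xderiv a b 1 f)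
      - sq_int a b (xderiv a b 2 f)"

lemma in_L2_ks_rhs:
  assumes "a < b" "H4 a b f"
  shows "in_L2 a b (ks_rhs lam a b f)"
proof -
  note H = H4_deriv_on[OF assms]
  have "continuous_on {a..b} (\<lambda>x. - f x * xderiv a b 1 f x - lam * xderiv a b 2 f x)"
    by (intro continuous_intros deriv_on_continuous[OF H(1)] deriv_on_continuous[OF H(2)]
        deriv_on_continuous[OF H(3)])
  then show ?thesis by (intro in_L2_diff[OF in_L2_continuous H(7)])
qed

text \<open>The fourth derivative exists only almost everywhere, so integration by parts goes
  through a single absolutely continuous primitive. Its derivative differs from the integrand by
  \<open>lam * (f1 x)\<^sup>2 - (f2 x)\<^sup>2\<close>, which is continuous and yields
  \<open>net_growth\<close>.\<close>

lemma H4_energy_identity: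
  assumes ab: "a < b" and H4: "H4 a b f" and bc: "xderiv a b 1 f a = 0" "xderiv a b 1 f b = 0"
  shows "(LINT x:{a..b}|lebesgue. (f x - k) * ks_rhs lam a b f x) =
    boundary_flux a b k f + net_growth lam a b f"
proof -
  define f1 f2 f3 f4 where "f1 = xderiv a b 1 f" and "f2 = xderiv a b 2 f"
    and "f3 = xderiv a b 3 f" and "f4 = xderiv a b 4 f"
  note H = H4_deriv_on[OF ab H4, folded f1_def f2_def f3_def f4_def]
  note c = deriv_on_continuous[OF H(1)] deriv_on_continuous[OF H(2)] deriv_on_continuous[OF H(3)] H(5)
  \<comment> \<open>The continuously differentiable part of the primitive; the part containing the
    third derivative, \<open>- (f x - k) * f3 x\<close>, is merely absolutely continuous and is
    added separately.\<close>
  define S where "S x = - (f x ^ 3 / 3 - k * (f x)\<^sup>2 / 2) - lam * ((f x - k) * f1 x) + f1 x * f2 x" for x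
  define S' where "S' x = - (f x - k) * f x * f1 x - lam * ((f x - k) * f2 x + f1 x * f1 x)
      + (f1 x * f3 x + f2 x * f2 x)" for x
  have S: "deriv_on a b S S'"
    unfolding deriv_on_def S_def S'_def
  proof
    fix x assume x: "x \<in> {a..b}"
    note d = H(1)[THEN deriv_onD, OF x] H(2)[THEN deriv_onD, OF x] H(3)[THEN deriv_onD, OF x]
    show "((\<lambda>x. - (f x ^ 3 / 3 - k * (f x)\<^sup>2 / 2) - lam * ((f x - k) * f1 x) + f1 x * f2 x)
      has_real_derivative (- (f x - k) * f x * f1 x - lam * ((f x - k) * f2 x + f1 x * f1 x)
      + (f1 x * f3 x + f2 x * f2 x))) (at x within {a..b})"
      by (auto intro!: derivative_eq_intros d simp: power2_eq_square field_simps)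
  qed
  have S'c: "continuous_on {a..b} S'"
    unfolding S'_def[abs_def] by (intro continuous_intros c)
  have fk: "deriv_on a b (\<lambda>x. - (f x - k)) (\<lambda>x. - f1 x)"
    using deriv_on_cmult[OF deriv_on_diff[OF H(1) deriv_on_const[of a b k]], of "-1"] by simp
  have ac: "abs_cont_fun (\<lambda>x. S x + - (f x - k) * f3 x) a b"
    by (intro abs_cont_add abs_cont_mult abs_cont_deriv_on[OF S S'c] H(4)
        abs_cont_deriv_on[OF fk continuous_on_minus[OF c(2)]])
  obtain E where E: "negligible E" "\<And>x. x \<notin> E \<Longrightarrow> x \<in> {a..b} \<longrightarrow>
      (f3 has_real_derivative f4 x) (at x within {a..b})"
    using AE_lebesgue_negligible[OF H(6)] by blast
  have der: "((\<lambda>x. S x + - (f x - k) * f3 x) has_real_derivative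
      (S' x + (- (f x - k) * f4 x + - f1 x * f3 x))) (at x within {a..b})" if "x \<in> {a..b} - E" for x
    using that E(2)[of x] deriv_onD[OF S] deriv_onD[OF fk]
    by (intro DERIV_add DERIV_mult'[of "\<lambda>x. - (f x - k)"]) auto
  have "((\<lambda>x. S' x + (- (f x - k) * f4 x + - f1 x * f3 x)) has_integral
      ((S b + - (f b - k) * f3 b) - (S a + - (f a - k) * f3 a))) {a..b}"
    using ab by (intro abs_cont_has_integral[OF _ ac E(1) der]) auto
  moreover have "((\<lambda>x. lam * (f1 x)\<^sup>2 - (f2 x)\<^sup>2) has_integral
      (integral {a..b} (\<lambda>x. lam * (f1 x)\<^sup>2 - (f2 x)\<^sup>2))) {a..b}"
    by (intro integrable_integral integrable_continuous_real continuous_intros c)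
  ultimately have "((\<lambda>x. (S' x + (- (f x - k) * f4 x + - f1 x * f3 x)) + (lam * (f1 x)\<^sup>2 - (f2 x)\<^sup>2)) has_integral
      ((S b + - (f b - k) * f3 b) - (S a + - (f a - k) * f3 a)
        + integral {a..b} (\<lambda>x. lam * (f1 x)\<^sup>2 - (f2 x)\<^sup>2))) {a..b}"
    by (rule has_integral_add)
  moreover have "(S' x + (- (f x - k) * f4 x + - f1 x * f3 x)) + (lam * (f1 x)\<^sup>2 - (f2 x)\<^sup>2)
      = (f x - k) * ks_rhs lam a b f x" for x
    by (simp add: S'_def power2_eq_square algebra_simps f1_def f2_def f4_def)
  moreover have "(S b + - (f b - k) * f3 b) - (S a + - (f a - k) * f3 a) = boundary_flux a b k f"
    using bc by (simp add: S_def boundary_flux_def f1_def f3_def) (simp add: field_simps)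
  moreover have "integral {a..b} (\<lambda>x. lam * (f1 x)\<^sup>2 - (f2 x)\<^sup>2)
      = lam * sq_int a b f1 - sq_int a b f2"
    by (subst integral_diff) (auto intro!: integrable_continuous_real continuous_intros c)
  ultimately have *: "integral {a..b} (\<lambda>x. (f x - k) * ks_rhs lam a b f x) =
      boundary_flux a b k f + lam * sq_int a b f1 - sq_int a b f2"
    by (simp add: integral_unique)
  have "in_L2 a b (\<lambda>x. f x - k)"
    by (intro in_L2_continuous continuous_intros c)
  then have "integrable (lebesgue_on {a..b}) (\<lambda>x. (f x - k) * ks_rhs lam a b f x)"
    using in_L2_ks_rhs[OF ab H4] by (intro integrable_mult_of_squares) (simp_all add: in_L2_iff)
  then have "set_integrable lebesgue {a..b} (\<lambda>x. (f x - k) * ks_rhs lam a b f x)"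
    by (simp add: set_integrable_def integrable_restrict_space)
  then show ?thesis
    using * by (simp add: set_lebesgue_integral_eq_integral net_growth_def f1_def f2_def)
qed

text \<open>Three null sets of times are discarded: where the equation fails on a set of positive
  measure in space, where the curve has infinite speed, and the switching instants. None of them
  depends on the offset \<open>k\<close>.\<close>

lemma energy_rate:
  assumes ab: "0 \<le> a" "a < b" "b \<le> L" and D: "D = {t0..}"
    and L2: "\<forall>t\<in>D. in_L2 0 L (\<lambda>x. u x t)"
    and curve: "loc_abs_cont (\<lambda>s t. L2norm 0 L (\<lambda>x. u x s - u x t)) D"
    and H4: "\<forall>t\<in>D - N. H4 a b (\<lambda>x. u x t)"
    and bc: "\<forall>t\<in>D - N. xderiv a b 1 (\<lambda>x. u x t) a = 0 \<and> xderiv a b 1 (\<lambda>x. u x t) b = 0"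
    and ks: "ks_on lam a b D u" and N: "countable N"
  shows "AE t in lebesgue. t \<in> {t0<..<t1} \<longrightarrow> t \<notin> N \<and>
     (\<forall>k. ((\<lambda>s. energy a b k (\<lambda>x. u x s)) has_real_derivative
        (boundary_flux a b k (\<lambda>x. u x t) + net_growth lam a b (\<lambda>x. u x t))) (at t))"
proof (cases "t0 < t1")
  case True
  let ?\<rho> = "\<lambda>s t. L2norm 0 L (\<lambda>x. u x s - u x t)"
  have ac: "abs_cont ?\<rho> t0 t1"
    using curve True by (auto simp: loc_abs_cont_def D)
  have "?\<rho> s t = ?\<rho> t s" for s t
    by (simp add: L2norm_def power2_commute)
  from abs_cont_finite_speed[OF ac this]
  have speed: "AE t in lebesgue. t \<in> {t0<..<t1} \<longrightarrow>
    (\<exists>M. \<exists>\<delta>>0. \<forall>t'. t' \<noteq> t \<and> \<bar>t' - t\<bar> < \<delta> \<longrightarrow> ?\<rho> t t' \<le> M * \<bar>t' - t\<bar>)" .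
  have "AE t in lebesgue. AE x in lebesgue. x \<in> {a..b} \<and> t \<in> D \<longrightarrow>
      ((\<lambda>s. u x s) has_real_derivative ks_rhs lam a b (\<lambda>y. u y t) x) (at t within D)"
    using AE_lebesgue_pair[OF ks[unfolded ks_on_def]] by simp
  moreover have "AE t in lebesgue. t \<notin> N"
    by (rule AE_not_in) (intro null_sets_completionI countable_imp_null_set_lborel N)
  ultimately show ?thesis
    using speed
  proof eventually_elim
    case (elim t)
    show ?case
    proof (intro impI conjI allI)
      assume t: "t \<in> {t0<..<t1}"
      then have tD: "t \<in> D - N" using elim by (simp add: D)
      show "t \<notin> N" using elim by simp
      fix k
      have H4t: "H4 a b (\<lambda>x. u x t)" and bct: "xderiv a b 1 (\<lambda>x. u x t) a = 0" "xderiv a b 1 (\<lambda>x. u x t) b = 0"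
        using H4 bc tD by auto
      obtain M \<delta> where M: "0 < \<delta>" "\<And>t'. t' \<noteq> t \<Longrightarrow> \<bar>t' - t\<bar> < \<delta> \<Longrightarrow> ?\<rho> t t' \<le> M * \<bar>t' - t\<bar>"
        using elim(3) t by blast
      obtain K where K: "\<And>x. x \<in> {a..b} \<Longrightarrow> \<bar>u x t\<bar> \<le> K"
        using continuous_on_Icc_bounded[OF deriv_on_continuous[OF H4_deriv_on(1)[OF ab(2) H4t]]] by blast
      have "((\<lambda>s. energy a b k (\<lambda>x. u x s)) has_real_derivative
            (LINT x:{a..b}|lebesgue. (u x t - k) * ks_rhs lam a b (\<lambda>x. u x t) x)) (at t)"
      proof (rule energy_has_derivative)
        \<comment> \<open>Times before \<open>t0\<close> are kept out: passing from the distance on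
          the whole interval to the one on the segment uses square integrability at the competing
          time.\<close>
        define \<delta>' where "\<delta>' = min \<delta> (t - t0)"
        show "t \<in> interior D" using t by (simp add: D)
        show "in_L2 a b (\<lambda>x. u x s)" if "s \<in> D" for s
          using L2 that ab by (auto intro: in_L2_subinterval[of 0 L _ a b])
        show "0 < \<delta>'" using M t by (simp add: \<delta>'_def)
        show "L2norm a b (\<lambda>x. u x t - u x s) \<le> M * \<bar>s - t\<bar>" if s: "s \<noteq> t" "\<bar>s - t\<bar> < \<delta>'" for s
        proof -
          have "s \<in> D" using s t by (auto simp: \<delta>'_def D)
          then have "L2norm a b (\<lambda>x. u x t - u x s) \<le> ?\<rho> t s"
            using L2 tD ab by (intro L2norm_subinterval in_L2_diff) auto
          also have "\<dots> \<le> M * \<bar>s - t\<bar>" using M(2) s by (simp add: \<delta>'_def)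
          finally show ?thesis .
        qed
        show "in_L2 a b (ks_rhs lam a b (\<lambda>x. u x t))" by (rule in_L2_ks_rhs[OF ab(2) H4t])
        show "AE x in lebesgue. x \<in> {a..b} \<longrightarrow>
            ((\<lambda>s. u x s) has_real_derivative ks_rhs lam a b (\<lambda>x. u x t) x) (at t within D)"
          using elim(1) tD by simp
      qed (use K in auto)
      then show "((\<lambda>s. energy a b k (\<lambda>x. u x s)) has_real_derivative
        (boundary_flux a b k (\<lambda>x. u x t) + net_growth lam a b (\<lambda>x. u x t))) (at t)"
        unfolding H4_energy_identity[OF ab(2) H4t bct] .
    qed
  qed
qed simp

section \<open>The clamped spectral inequality\<close>

text \<open>A class of C2 functions dense in the form domain of the clamped problem. It is large
  enough for the eigenfunctions, and its elements can be integrated by parts without weak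
  derivatives.\<close>

definition clamped :: "real \<Rightarrow> real \<Rightarrow> (real \<Rightarrow> real) \<Rightarrow> (real \<Rightarrow> real) \<Rightarrow> (real \<Rightarrow> real) \<Rightarrow> bool" where
  "clamped a b z z1 z2 \<longleftrightarrow> deriv_on a b z z1 \<and> deriv_on a b z1 z2 \<and> continuous_on {a..b} z2 \<and>
     z a = 0 \<and> z b = 0 \<and> z1 a = 0 \<and> z1 b = 0"

lemma clampedD:
  assumes "clamped a b z z1 z2"
  shows "deriv_on a b z z1" "deriv_on a b z1 z2" "continuous_on {a..b} z2"
    "continuous_on {a..b} z1" "continuous_on {a..b} z" "z a = 0" "z b = 0" "z1 a = 0" "z1 b = 0"
  using assms by (auto simp: clamped_def dest: deriv_on_continuous)

lemma clamped_add:
  assumes "clamped a b z z1 z2" "clamped a b y y1 y2"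
  shows "clamped a b (\<lambda>x. z x + s * y x) (\<lambda>x. z1 x + s * y1 x) (\<lambda>x. z2 x + s * y2 x)"
  using assms by (auto simp: clamped_def intro!: deriv_on_add deriv_on_cmult continuous_intros)

lemma clamped_cmult:
  assumes "clamped a b z z1 z2"
  shows "clamped a b (\<lambda>x. s * z x) (\<lambda>x. s * z1 x) (\<lambda>x. s * z2 x)"
  using assms by (auto simp: clamped_def intro!: deriv_on_cmult continuous_intros)

lemma clamped_by_parts1:
  assumes ab: "a < b" and z: "clamped a b z z1 z2" and g: "deriv_on a b g g'" "continuous_on {a..b} g'"
  shows "integral {a..b} (\<lambda>x. g x * z1 x) = - integral {a..b} (\<lambda>x. g' x * z x)"
    and "integral {a..b} (\<lambda>x. g x * z2 x) = - integral {a..b} (\<lambda>x. g' x * z1 x)"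
  using deriv_on_by_parts[OF _ g(1) clampedD(1)[OF z] g(2) clampedD(4)[OF z]]
    deriv_on_by_parts[OF _ g(1) clampedD(2)[OF z] g(2) clampedD(3)[OF z]] ab clampedD(6-9)[OF z]
  by simp_all

text \<open>The quadratic form of the operator \<open>z_xxxx + \<kappa> z_xx\<close> with clamped
  ends; \<open>delta_o\<close> belongs to \<open>\<kappa> = 3 * lam\<close>.\<close>

definition bending_form :: "real \<Rightarrow> real \<Rightarrow> real \<Rightarrow> (real \<Rightarrow> real) \<Rightarrow> (real \<Rightarrow> real) \<Rightarrow> real" where
  "bending_form a b \<kappa> z1 z2 = sq_int a b z2 - \<kappa> * sq_int a b z1"

text \<open>By parts, the integral of \<open>z1^2\<close> is minus that of \<open>z * z2\<close>,
  and the square of \<open>z2 + \<kappa> * z\<close> absorbs it. This bounds the Rayleigh quotient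
  from below and minimizing sequences in H2.\<close>

lemma bending_form_coercive:
  assumes ab: "a < b" and z: "clamped a b z z1 z2"
  shows "sq_int a b z2 / 2 - \<kappa>\<^sup>2 / 2 * sq_int a b z
      \<le> bending_form a b \<kappa> z1 z2"
proof -
  note c = clampedD(3-5)[OF z]
  have "0 \<le> integral {a..b} (\<lambda>x. (z2 x + \<kappa> * z x)\<^sup>2)"
    by (intro integral_square_nonneg continuous_intros c)
  also have "(\<lambda>x. (z2 x + \<kappa> * z x)\<^sup>2) = (\<lambda>x. (z2 x)\<^sup>2 + 2 * \<kappa> * (z x * z2 x) + \<kappa>\<^sup>2 * (z x)\<^sup>2)"
    by (simp add: fun_eq_iff power2_eq_square algebra_simps)
  also have "integral {a..b} \<dots> = sq_int a b z2
      + 2 * \<kappa> * integral {a..b} (\<lambda>x. z x * z2 x) + \<kappa>\<^sup>2 * sq_int a b z"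
    using c by (simp add: integral_expand)
  also have "integral {a..b} (\<lambda>x. z x * z2 x) = - sq_int a b z1"
    using clamped_by_parts1(2)[OF ab z clampedD(1)[OF z] c(2)] by (simp add: power2_eq_square)
  finally show ?thesis by (simp add: bending_form_def)
qed

section \<open>Minimization of the Rayleigh quotient\<close>

lemma exists_normalized_clamped:
  assumes ab: "a < b"
  shows "\<exists>z z1 z2. clamped a b z z1 z2 \<and> sq_int a b z = 1"
proof -
  \<comment> \<open>Squaring gives a double zero at each end, that is, both clamping
    conditions.\<close>
  define z z1 z2 where "z x = ((x - a) * (b - x))\<^sup>2"
    and "z1 x = 2 * ((x - a) * (b - x)) * (a + b - 2 * x)"
    and "z2 x = 2 * (a + b - 2 * x)\<^sup>2 - 4 * ((x - a) * (b - x))" for x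
  have z: "clamped a b z z1 z2"
    unfolding clamped_def deriv_on_def z_def[abs_def] z1_def[abs_def] z2_def[abs_def]
    by (auto intro!: derivative_eq_intros continuous_intros simp: power2_eq_square algebra_simps)
  have c: "continuous_on {a..b} (\<lambda>x. (z x)\<^sup>2)"
    by (intro continuous_intros clampedD[OF z])
  have "sq_int a b z \<noteq> 0"
  proof
    assume "sq_int a b z = 0"
    then have "\<forall>x\<in>{a..b}. (z x)\<^sup>2 = 0"
      using integral_eq_0_iff[OF c ab] by auto
    then have "z ((a + b) / 2) = 0" using ab by auto
    moreover have "0 < ((a + b) / 2 - a) * (b - (a + b) / 2)" using ab by (intro mult_pos_pos) auto
    ultimately show False by (simp add: z_def)
  qed
  moreover have "0 \<le> sq_int a b z"
    by (intro integral_square_nonneg clampedD[OF z])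
  ultimately have pos: "0 < sq_int a b z" by linarith
  define s where "s = 1 / sqrt (sq_int a b z)"
  have "integral {a..b} (\<lambda>x. (s * z x)\<^sup>2) = s\<^sup>2 * sq_int a b z"
    by (simp add: power_mult_distrib)
  also have "\<dots> = 1" using pos by (simp add: s_def power_divide)
  finally show ?thesis using clamped_cmult[OF z, of s] by blast
qed

lemma bending_form_infimum:
  assumes ab: "a < b"
  obtains m zn z1n z2n where
    "\<And>z z1 z2. clamped a b z z1 z2 \<Longrightarrow> m * sq_int a b z \<le> bending_form a b \<kappa> z1 z2"
    "\<And>n::nat. clamped a b (zn n) (z1n n) (z2n n)"
    "\<And>n. sq_int a b (zn n) = 1"
    "(\<lambda>n. bending_form a b \<kappa> (z1n n) (z2n n)) \<longlonglongrightarrow> m"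
proof -
  define S where "S = {bending_form a b \<kappa> z1 z2 | z z1 z2.
     clamped a b z z1 z2 \<and> sq_int a b z = 1}"
  have ne: "S \<noteq> {}" using exists_normalized_clamped[OF ab] by (auto simp: S_def)
  have lower: "- (\<kappa>\<^sup>2 / 2) \<le> s" if s: "s \<in> S" for s
  proof -
    obtain z z1 z2 where z: "s = bending_form a b \<kappa> z1 z2" "clamped a b z z1 z2"
      "sq_int a b z = 1" using s by (auto simp: S_def)
    have "0 \<le> sq_int a b z2"
      by (intro integral_square_nonneg clampedD[OF z(2)])
    then show ?thesis using bending_form_coercive[OF ab z(2), of \<kappa>] z by simp
  qed
  have bdd: "bdd_below S" using lower by (rule bdd_belowI)
  define m where "m = Inf S"
  have "\<exists>z z1 z2. clamped a b z z1 z2 \<and> sq_int a b z = 1 \<and>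
      bending_form a b \<kappa> z1 z2 < m + 1 / Suc n" for n
  proof -
    have "Inf S < m + 1 / Suc n" by (simp add: m_def)
    then obtain s where "s \<in> S" "s < m + 1 / Suc n" using cInf_lessD[OF ne] by blast
    then show ?thesis by (auto simp: S_def)
  qed
  then obtain zn z1n z2n where n: "\<And>n. clamped a b (zn n) (z1n n) (z2n n)"
    "\<And>n. sq_int a b (zn n) = 1"
    "\<And>n. bending_form a b \<kappa> (z1n n) (z2n n) < m + 1 / Suc n" by metis
  show thesis
  proof (rule that[of m zn z1n z2n])
    fix z z1 z2 assume z: "clamped a b z z1 z2"
    let ?N = "sq_int a b z"
    show "m * ?N \<le> bending_form a b \<kappa> z1 z2"
    proof (cases "?N = 0")
      case True
      have "0 \<le> sq_int a b z2"
        by (intro integral_square_nonneg clampedD[OF z])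
      then show ?thesis using True bending_form_coercive[OF ab z, of \<kappa>] by simp
    next
      case False
      moreover have "0 \<le> ?N"
        by (intro integral_square_nonneg clampedD[OF z])
      ultimately have pos: "0 < ?N" by linarith
      define s where "s = 1 / sqrt ?N"
      have s2: "s\<^sup>2 = 1 / ?N" using pos by (simp add: s_def power_divide)
      have "integral {a..b} (\<lambda>x. (s * z x)\<^sup>2) = 1"
        using pos s2 by (simp add: power_mult_distrib)
      then have "bending_form a b \<kappa> (\<lambda>x. s * z1 x) (\<lambda>x. s * z2 x) \<in> S"
        using clamped_cmult[OF z, of s] unfolding S_def by blast
      then have "m \<le> bending_form a b \<kappa> (\<lambda>x. s * z1 x) (\<lambda>x. s * z2 x)"
        unfolding m_def using bdd by (rule cInf_lower)
      also have "\<dots> = s\<^sup>2 * bending_form a b \<kappa> z1 z2"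
        by (simp add: bending_form_def power_mult_distrib algebra_simps)
      finally show ?thesis using pos s2 by (simp add: field_simps)
    qed
  next
    have low: "m \<le> bending_form a b \<kappa> (z1n n) (z2n n)" for n
      unfolding m_def using n(1,2)[of n] by (intro cInf_lower[OF _ bdd]) (unfold S_def, blast)
    have "(\<lambda>n. m + 1 / real (Suc n)) \<longlonglongrightarrow> m + 0"
      by (intro tendsto_add tendsto_const LIMSEQ_Suc[OF lim_inverse_n'])
    then have up: "(\<lambda>n. m + 1 / real (Suc n)) \<longlonglongrightarrow> m" by simp
    show "(\<lambda>n. bending_form a b \<kappa> (z1n n) (z2n n)) \<longlonglongrightarrow> m"
      by (rule tendsto_sandwich[OF _ _ tendsto_const[of m] up])
        (use low n(3) in \<open>auto intro!: always_eventually less_imp_le\<close>)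
  qed (use n in auto)
qed

text \<open>A crude Sobolev embedding: integrate \<open>z2\<close> from the clamped end and use
  \<open>|y| \<le> y^2 / 2 + 1 / 2\<close>. A uniform slope bound is all that equicontinuity
  requires.\<close>

lemma clamped_slope_bound:
  assumes ab: "a < b" and z: "clamped a b z z1 z2" and x: "x \<in> {a..b}"
  shows "\<bar>z1 x\<bar> \<le> sq_int a b z2 / 2 + (b - a) / 2"
proof -
  note c = clampedD(3-5)[OF z]
  have sub: "{a..x} \<subseteq> {a..b}" using x by auto
  have d: "deriv_on a x z1 z2"
    using clampedD(2)[OF z] sub unfolding deriv_on_def by (meson DERIV_subset subset_iff)
  have "z1 x = integral {a..x} z2"
    using deriv_on_integral[OF d] x clampedD[OF z] by (simp add: integral_unique)
  also have "\<bar>\<dots>\<bar> \<le> integral {a..x} (\<lambda>x. (z2 x)\<^sup>2 / 2 + 1 / 2)"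
  proof -
    have "norm (integral {a..x} z2) \<le> integral {a..x} (\<lambda>x. (z2 x)\<^sup>2 / 2 + 1 / 2)"
    proof (rule integral_norm_bound_integral)
      fix y
      have "0 \<le> (\<bar>z2 y\<bar> - 1)\<^sup>2" by simp
      then show "norm (z2 y) \<le> (z2 y)\<^sup>2 / 2 + 1 / 2" by (simp add: power2_diff)
    qed (intro integrable_continuous_real continuous_intros continuous_on_subset[OF c(1) sub]; simp)+
    then show ?thesis by simp
  qed
  also have "\<dots> \<le> integral {a..b} (\<lambda>x. (z2 x)\<^sup>2 / 2 + 1 / 2)"
    by (intro integral_subset_le sub integrable_continuous_real continuous_intros c
        continuous_on_subset[OF c(1) sub]) auto
  also have "\<dots> = sq_int a b z2 / 2 + (b - a) / 2"
    using ab by (subst integral_add) (auto intro!: integrable_continuous_real continuous_intros c)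
  finally show ?thesis .
qed

lemma clamped_lipschitz:
  assumes "clamped a b z z1 z2" "\<And>x. x \<in> {a..b} \<Longrightarrow> \<bar>z1 x\<bar> \<le> R" "x \<in> {a..b}" "y \<in> {a..b}"
  shows "\<bar>z x - z y\<bar> \<le> R * \<bar>x - y\<bar>"
proof -
  have "norm (z x - z y) \<le> R * norm (x - y)"
    by (rule field_differentiable_bound[of "{a..b}" z z1])
      (use assms clampedD(1)[OF assms(1)] in \<open>auto simp: deriv_on_def\<close>)
  then show ?thesis by simp
qed

lemma integral_tendsto_bounded:
  fixes f :: "nat \<Rightarrow> real \<Rightarrow> real"
  assumes "\<And>n. continuous_on {a..b} (f n)" "\<And>n x. x \<in> {a..b} \<Longrightarrow> \<bar>f n x\<bar> \<le> M"
    and "\<And>x. x \<in> {a..b} \<Longrightarrow> (\<lambda>n. f n x) \<longlonglongrightarrow> g x"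
  shows "(\<lambda>n. integral {a..b} (f n)) \<longlonglongrightarrow> integral {a..b} g"
  by (rule dominated_convergence(2)[where h = "\<lambda>_. M"])
    (use assms in \<open>auto intro!: integrable_continuous_real\<close>)

text \<open>A minimizing sequence for the Rayleigh quotient converges uniformly; the
  Cauchy-Schwarz inequality for the nonnegative form shifted by its infimum turns
  minimization into the very weak eigenvalue equation for the limit.\<close>
lemma very_weak_eigenfunction:
  assumes ab: "a < b"
  obtains m z where "continuous_on {a..b} z" "sq_int a b z = 1"
    "\<And>y y1 y2. clamped a b y y1 y2 \<Longrightarrow> m * sq_int a b y \<le> bending_form a b \<kappa> y1 y2"
    "\<And>p p1 p2 p3 p4. clamped a b p p1 p2 \<Longrightarrow> deriv_on a b p2 p3 \<Longrightarrow> deriv_on a b p3 p4 \<Longrightarrow>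
       continuous_on {a..b} p4 \<Longrightarrow> integral {a..b} (\<lambda>x. (p4 x + \<kappa> * p2 x - m * p x) * z x) = 0"
proof -
  obtain m zn z1n z2n where
    m: "\<And>z z1 z2. clamped a b z z1 z2 \<Longrightarrow> m * sq_int a b z \<le> bending_form a b \<kappa> z1 z2"
    and zn: "\<And>n::nat. clamped a b (zn n) (z1n n) (z2n n)"
    and N1: "\<And>n. sq_int a b (zn n) = 1"
    and lim: "(\<lambda>n. bending_form a b \<kappa> (z1n n) (z2n n)) \<longlonglongrightarrow> m"
    using bending_form_infimum[OF ab, of \<kappa>] by blast
  obtain C where C: "\<And>n. \<bar>bending_form a b \<kappa> (z1n n) (z2n n)\<bar> \<le> C"
    using convergent_imp_Bseq[OF convergentI[OF lim]] by (auto simp: Bseq_def)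
  \<comment> \<open>For normalized profiles coercivity gives
    \<open>sq_int a b z2 / 2 \<le> C + \<kappa>\<^sup>2 / 2\<close>, which is inserted into the
    slope bound.\<close>
  define R where "R = C + \<kappa>\<^sup>2 / 2 + (b - a) / 2"
  have R: "\<bar>z1n n x\<bar> \<le> R" if "x \<in> {a..b}" for n x
    using clamped_slope_bound[OF ab zn that, of n] bending_form_coercive[OF ab zn, of n \<kappa>, unfolded N1] C[of n]
    unfolding R_def by linarith
  have R0: "0 \<le> R" using R[of a 0] ab by auto
  have lip: "\<bar>zn n x - zn n y\<bar> \<le> R * \<bar>x - y\<bar>" if "x \<in> {a..b}" "y \<in> {a..b}" for n x y
    using clamped_lipschitz[OF zn R] that by blast
  have bound: "\<bar>zn n x\<bar> \<le> R * (b - a)" if x: "x \<in> {a..b}" for n x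
  proof -
    have "\<bar>zn n x - zn n a\<bar> \<le> R * \<bar>x - a\<bar>" using lip[OF x, of a] ab by simp
    also have "\<dots> \<le> R * (b - a)" using x R0 by (intro mult_left_mono) auto
    finally show ?thesis using clampedD(6)[OF zn] by simp
  qed
  obtain z k where z: "continuous_on {a..b} z" "strict_mono (k :: nat \<Rightarrow> nat)"
    and unif: "\<And>e. 0 < e \<Longrightarrow> \<exists>N. \<forall>n x. n \<ge> N \<and> x \<in> {a..b} \<longrightarrow> norm (zn (k n) x - z x) < e"
  proof (rule Arzela_Ascoli[of "{a..b}" zn "R * (b - a)"])
    show "compact {a..b}" by simp
    show "norm (zn n x) \<le> R * (b - a)" if "x \<in> {a..b}" for n x using bound[OF that] by simp
    fix x e :: real assume x: "x \<in> {a..b}" and e: "0 < e"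
    show "\<exists>d>0. \<forall>n y. y \<in> {a..b} \<and> norm (x - y) < d \<longrightarrow> norm (zn n x - zn n y) < e"
    proof (intro exI[of _ "e / (R + 1)"] conjI allI impI)
      show "0 < e / (R + 1)" using e R0 by simp
      fix n y assume y: "y \<in> {a..b} \<and> norm (x - y) < e / (R + 1)"
      have "\<bar>zn n x - zn n y\<bar> \<le> R * \<bar>x - y\<bar>" using lip x y by blast
      also have "\<dots> \<le> (R + 1) * \<bar>x - y\<bar>" by (simp add: algebra_simps)
      also have "\<dots> < e" using y R0 by (simp add: pos_less_divide_eq mult.commute)
      finally show "norm (zn n x - zn n y) < e" by simp
    qed
  qed (use that in blast)
  have ptw: "(\<lambda>n. zn (k n) x) \<longlonglongrightarrow> z x" if "x \<in> {a..b}" for x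
    unfolding LIMSEQ_iff using unif that by blast
  show thesis
  proof (rule that[OF z(1) _ m])
    have "(\<lambda>n. integral {a..b} (\<lambda>x. (zn (k n) x)\<^sup>2)) \<longlonglongrightarrow> sq_int a b z"
    proof (rule integral_tendsto_bounded[where M = "(R * (b - a))\<^sup>2"])
      show "\<bar>(zn (k n) x)\<^sup>2\<bar> \<le> (R * (b - a))\<^sup>2" if "x \<in> {a..b}" for n x
        using power_mono[OF bound[OF that], of "k n" 2] by simp
      show "continuous_on {a..b} (\<lambda>x. (zn (k n) x)\<^sup>2)" for n
        by (intro continuous_on_power clampedD(5)[OF zn])
      show "(\<lambda>n. (zn (k n) x)\<^sup>2) \<longlonglongrightarrow> (z x)\<^sup>2" if "x \<in> {a..b}" for x
        by (intro tendsto_power ptw that)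
    qed
    then show "sq_int a b z = 1"
      unfolding N1 by (simp add: LIMSEQ_const_iff)
  next
    fix p p1 p2 p3 p4
    assume p: "clamped a b p p1 p2" and p3: "deriv_on a b p2 p3" and p4: "deriv_on a b p3 p4"
      and c4: "continuous_on {a..b} p4"
    note pc = clampedD(3-5)[OF p] deriv_on_continuous[OF p4] c4
    define g where "g x = p4 x + \<kappa> * p2 x - m * p x" for x
    have gc: "continuous_on {a..b} g" unfolding g_def[abs_def] by (intro continuous_intros pc)
    define A where "A n = bending_form a b \<kappa> (z1n n) (z2n n) - m" for n
    define Cp where "Cp = bending_form a b \<kappa> p1 p2 - m * sq_int a b p"
    \<comment> \<open>The mixed term of the shifted form between \<open>zn n\<close> and
      \<open>p\<close>, with every derivative moved to \<open>p\<close>; uniform convergence of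
      \<open>zn\<close> alone therefore carries it to the limit. It vanishes there because
      \<open>A n\<close>, the shifted form at \<open>zn n\<close>, tends to zero.\<close>
    define B where "B n = integral {a..b} (\<lambda>x. g x * zn n x)" for n
    have B2: "(B n)\<^sup>2 \<le> A n * Cp" for n
    proof (rule quadratic_nonneg_discriminant)
      note zc = clampedD(3-5)[OF zn[of n]]
      show "0 \<le> Cp" using m[OF p] by (simp add: Cp_def)
      have "B n = integral {a..b} (\<lambda>x. p4 x * zn n x) + \<kappa> * integral {a..b} (\<lambda>x. p2 x * zn n x)
          - m * integral {a..b} (\<lambda>x. p x * zn n x)"
        using pc zc by (simp add: B_def g_def algebra_simps integral_expand)
      also have "integral {a..b} (\<lambda>x. p2 x * zn n x) = - integral {a..b} (\<lambda>x. p1 x * z1n n x)"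
        using clamped_by_parts1(1)[OF ab zn clampedD(2)[OF p] pc(1), of n] by simp
      also have "integral {a..b} (\<lambda>x. p4 x * zn n x) = integral {a..b} (\<lambda>x. p2 x * z2n n x)"
        using clamped_by_parts1(1)[OF ab zn p4 c4, of n] clamped_by_parts1(2)[OF ab zn p3 pc(4), of n] by simp
      finally have B: "B n = integral {a..b} (\<lambda>x. p2 x * z2n n x) - \<kappa> * integral {a..b} (\<lambda>x. p1 x * z1n n x)
          - m * integral {a..b} (\<lambda>x. p x * zn n x)" by simp
      fix s
      have sq: "integral {a..b} (\<lambda>x. (f x + s * h x)\<^sup>2) = sq_int a b f
          + 2 * s * integral {a..b} (\<lambda>x. h x * f x) + s\<^sup>2 * sq_int a b h"
        if c: "continuous_on {a..b} f" "continuous_on {a..b} h" for f h :: "real \<Rightarrow> real"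
      proof -
        have "integral {a..b} (\<lambda>x. (f x + s * h x)\<^sup>2)
            = integral {a..b} (\<lambda>x. (f x)\<^sup>2 + 2 * s * (h x * f x) + s\<^sup>2 * (h x)\<^sup>2)"
          by (simp add: power2_eq_square algebra_simps)
        then show ?thesis using c by (simp add: integral_expand)
      qed
      have "0 \<le> bending_form a b \<kappa> (\<lambda>x. z1n n x + s * p1 x) (\<lambda>x. z2n n x + s * p2 x)
          - m * integral {a..b} (\<lambda>x. (zn n x + s * p x)\<^sup>2)"
        using m[OF clamped_add[OF zn p]] by simp
      also have "\<dots> = A n + 2 * s * B n + s\<^sup>2 * Cp"
        unfolding bending_form_def A_def B Cp_def sq[OF zc(1) pc(1)] sq[OF zc(2) pc(2)] sq[OF zc(3) pc(3)] N1
        by (simp add: algebra_simps)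
      finally show "0 \<le> A n + 2 * s * B n + s\<^sup>2 * Cp" .
    qed
    have "(\<lambda>n. bending_form a b \<kappa> (z1n (k n)) (z2n (k n))) \<longlonglongrightarrow> m"
      using LIMSEQ_subseq_LIMSEQ[OF lim z(2)] by (simp add: comp_def)
    then have "(\<lambda>n. A (k n) * Cp) \<longlonglongrightarrow> (m - m) * Cp"
      unfolding A_def by (intro tendsto_intros)
    then have A0: "(\<lambda>n. A (k n) * Cp) \<longlonglongrightarrow> 0" by simp
    have "(\<lambda>n. (B (k n))\<^sup>2) \<longlonglongrightarrow> 0"
      by (rule tendsto_sandwich[OF _ _ tendsto_const[of 0] A0]) (use B2 in auto)
    then have B0: "(\<lambda>n. B (k n)) \<longlonglongrightarrow> 0"
      using tendsto_real_sqrt[of "\<lambda>n. (B (k n))\<^sup>2" 0] by (simp add: tendsto_rabs_zero_iff)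
    obtain G where G: "\<And>x. x \<in> {a..b} \<Longrightarrow> \<bar>g x\<bar> \<le> G"
      using continuous_on_Icc_bounded[OF gc] by blast
    have "(\<lambda>n. B (k n)) \<longlonglongrightarrow> integral {a..b} (\<lambda>x. g x * z x)"
      unfolding B_def
    proof (rule integral_tendsto_bounded[where M = "G * (R * (b - a))"])
      show "\<bar>g x * zn (k n) x\<bar> \<le> G * (R * (b - a))" if "x \<in> {a..b}" for n x
        unfolding abs_mult using G[OF that] bound[OF that, of "k n"] by (intro mult_mono) auto
      show "continuous_on {a..b} (\<lambda>x. g x * zn (k n) x)" for n
        by (intro continuous_on_mult gc clampedD(5)[OF zn])
      show "(\<lambda>n. g x * zn (k n) x) \<longlonglongrightarrow> g x * z x" if "x \<in> {a..b}" for x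
        by (intro tendsto_mult tendsto_const ptw that)
    qed
    then show "integral {a..b} (\<lambda>x. (p4 x + \<kappa> * p2 x - m * p x) * z x) = 0"
      using LIMSEQ_unique[OF B0] unfolding g_def by simp
  qed
qed

section \<open>Regularity of the minimizer\<close>

lemma deriv_on_primitive:
  assumes "continuous_on {a..b} f"
  shows "deriv_on a b (\<lambda>x. integral {a..x} f) f"
  unfolding deriv_on_def using integral_has_real_derivative[OF assms] by blast

text \<open>\<open>h\<close> is the Hermite cubic with a double zero at \<open>a\<close> that
  matches value and slope at \<open>b\<close>. Subtracting it clamps the second end, and its second
  derivative is affine, hence orthogonal to the second derivative of every clamped test
  function.\<close>

lemma clamp_by_cubic:
  assumes ab: "a < b" and y: "deriv_on a b y y1" "deriv_on a b y1 y2" "continuous_on {a..b} y2"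
    and ya: "y a = 0" "y1 a = 0"
  obtains h h1 h2 c where "deriv_on a b h h1" "deriv_on a b h1 h2" "deriv_on a b h2 (\<lambda>_. c)"
    "clamped a b (\<lambda>x. y x - h x) (\<lambda>x. y1 x - h1 x) (\<lambda>x. y2 x - h2 x)"
proof -
  define c0 c1 where "c0 = y b / (b - a)\<^sup>2" and "c1 = (y1 b - 2 * (b - a) * c0) / (b - a)\<^sup>2"
  define h h1 h2 where "h x = (x - a)\<^sup>2 * (c0 + c1 * (x - b))"
    and "h1 x = 2 * (x - a) * (c0 + c1 * (x - b)) + (x - a)\<^sup>2 * c1"
    and "h2 x = 2 * (c0 + c1 * (x - b)) + 4 * (x - a) * c1" for x
  have d: "deriv_on a b h h1" "deriv_on a b h1 h2" "deriv_on a b h2 (\<lambda>_. 6 * c1)"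
    unfolding deriv_on_def h_def[abs_def] h1_def[abs_def] h2_def[abs_def]
    by (auto intro!: derivative_eq_intros simp: power2_eq_square algebra_simps)
  have "(b - a)\<^sup>2 * c0 = y b" "2 * (b - a) * c0 + (b - a)\<^sup>2 * c1 = y1 b"
    using ab by (simp_all add: c0_def c1_def)
  then have "h b = y b" "h1 b = y1 b" "h a = 0" "h1 a = 0"
    by (simp_all add: h_def h1_def)
  then have "clamped a b (\<lambda>x. y x - h x) (\<lambda>x. y1 x - h1 x) (\<lambda>x. y2 x - h2 x)"
    unfolding clamped_def using ya
    by (auto intro!: deriv_on_diff y d continuous_intros deriv_on_continuous[OF d(3)])
  then show thesis using that d by blast
qed

lemma clamped_integral_fourth:
  assumes ab: "a < b" and y: "clamped a b y y1 y2" and p: "deriv_on a b p2 p3" "deriv_on a b p3 p4"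
    and c: "continuous_on {a..b} p4"
  shows "integral {a..b} (\<lambda>x. p4 x * y x) = integral {a..b} (\<lambda>x. p2 x * y2 x)"
  using clamped_by_parts1(1)[OF ab y p(2) c] clamped_by_parts1(2)[OF ab y p(1) deriv_on_continuous[OF p(2)]]
  by simp

text \<open>Very weak solutions are classical: the clamped solution \<open>y\<close> of the integrated equation
  satisfies the same identity as \<open>z\<close>, and the difference \<open>z - y\<close> is itself the fourth
  derivative of an admissible test function.\<close>
lemma very_weak_eigenfunction_regular:
  assumes ab: "a < b" and z: "continuous_on {a..b} z"
    and weak: "\<And>p p1 p2 p3 p4. clamped a b p p1 p2 \<Longrightarrow> deriv_on a b p2 p3 \<Longrightarrow> deriv_on a b p3 p4 \<Longrightarrow>
       continuous_on {a..b} p4 \<Longrightarrow> integral {a..b} (\<lambda>x. (p4 x + \<kappa> * p2 x - m * p x) * z x) = 0"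
  obtains y1 y2 y3 where "clamped a b z y1 y2" "deriv_on a b y2 y3"
    "deriv_on a b y3 (\<lambda>x. m * z x - \<kappa> * y2 x)"
proof -
  have I: "\<exists>F. deriv_on a b F f \<and> F a = 0" if "continuous_on {a..b} f" for f
    using deriv_on_primitive[OF that] by (intro exI[of _ "\<lambda>x. integral {a..x} f"]) simp
  obtain Z1 where Z1: "deriv_on a b Z1 z" "Z1 a = 0" using I[OF z] by blast
  obtain Z2 where Z2: "deriv_on a b Z2 Z1" "Z2 a = 0" using I[OF deriv_on_continuous[OF Z1(1)]] by blast
  obtain Z3 where Z3: "deriv_on a b Z3 Z2" "Z3 a = 0" using I[OF deriv_on_continuous[OF Z2(1)]] by blast
  obtain Z4 where Z4: "deriv_on a b Z4 Z3" "Z4 a = 0" using I[OF deriv_on_continuous[OF Z3(1)]] by blast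
  note Zc = deriv_on_continuous[OF Z1(1)] deriv_on_continuous[OF Z2(1)]
  \<comment> \<open>Integrating \<open>y_xxxx = m z - \<kappa> z_xx\<close> twice leaves no
    derivative on \<open>z\<close>, which so far is only continuous. Up to an affine function
    \<open>q\<close> is the second derivative sought; two more integrations give
    \<open>m Z4 - \<kappa> Z2\<close>.\<close>
  define q where "q x = m * Z2 x - \<kappa> * z x" for x
  have qc: "continuous_on {a..b} q" unfolding q_def[abs_def] by (intro continuous_intros Zc z)
  obtain h h1 h2 c where h: "deriv_on a b h2 (\<lambda>_. c)"
    and y: "clamped a b (\<lambda>x. (m * Z4 x - \<kappa> * Z2 x) - h x)
        (\<lambda>x. (m * Z3 x - \<kappa> * Z1 x) - h1 x) (\<lambda>x. q x - h2 x)"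
  proof (rule clamp_by_cubic[OF ab _ _ qc])
    show "deriv_on a b (\<lambda>x. m * Z4 x - \<kappa> * Z2 x) (\<lambda>x. m * Z3 x - \<kappa> * Z1 x)"
      by (intro deriv_on_diff deriv_on_cmult Z4 Z2)
    show "deriv_on a b (\<lambda>x. m * Z3 x - \<kappa> * Z1 x) q"
      unfolding q_def[abs_def] by (intro deriv_on_diff deriv_on_cmult Z3 Z1)
  qed (use that Z1 Z2 Z3 Z4 in auto)
  define y y1 y2 where "y x = (m * Z4 x - \<kappa> * Z2 x) - h x"
    and "y1 x = (m * Z3 x - \<kappa> * Z1 x) - h1 x" and "y2 x = q x - h2 x" for x
  have y: "clamped a b y y1 y2"
    using y unfolding y_def[abs_def] y1_def[abs_def] y2_def[abs_def] .
  have test: "integral {a..b} (\<lambda>x. p4 x * (z x - y x)) = 0"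
    if p: "clamped a b p p1 p2" and p3: "deriv_on a b p2 p3" and p4: "deriv_on a b p3 p4"
      and c4: "continuous_on {a..b} p4" for p p1 p2 p3 p4
  proof -
    note pc = clampedD(3-5)[OF p] deriv_on_continuous[OF p4] c4
    note hc = deriv_on_continuous[OF h]
    have "integral {a..b} (\<lambda>x. p4 x * y x) = integral {a..b} (\<lambda>x. p2 x * y2 x)"
      by (rule clamped_integral_fourth[OF ab y p3 p4 c4])
    also have "\<dots> = integral {a..b} (\<lambda>x. m * (Z2 x * p2 x) - \<kappa> * (p2 x * z x) - h2 x * p2 x)"
      by (simp add: y2_def q_def algebra_simps)
    also have "\<dots> = integral {a..b} (\<lambda>x. m * (Z2 x * p2 x)) - integral {a..b} (\<lambda>x. \<kappa> * (p2 x * z x))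
        - integral {a..b} (\<lambda>x. h2 x * p2 x)"
      using pc hc Zc z by (simp add: integral_expand)
    also have "integral {a..b} (\<lambda>x. h2 x * p2 x) = 0"
    proof -
      have "integral {a..b} p1 = 0"
        using deriv_on_integral[OF clampedD(1)[OF p]] ab clampedD[OF p] by (simp add: integral_unique)
      then show ?thesis using clamped_by_parts1(2)[OF ab p h] by simp
    qed
    also have "integral {a..b} (\<lambda>x. m * (Z2 x * p2 x)) = m * integral {a..b} (\<lambda>x. p x * z x)"
      using clamped_by_parts1(2)[OF ab p Z2(1) Zc(1)] clamped_by_parts1(1)[OF ab p Z1(1) z]
      by (simp add: mult.commute)
    finally have y4: "integral {a..b} (\<lambda>x. p4 x * y x)
        = m * integral {a..b} (\<lambda>x. p x * z x) - \<kappa> * integral {a..b} (\<lambda>x. p2 x * z x)" by simp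
    have "0 = integral {a..b} (\<lambda>x. p4 x * z x + \<kappa> * (p2 x * z x) - m * (p x * z x))"
      using weak[OF p p3 p4 c4] by (simp add: algebra_simps)
    then have z4: "integral {a..b} (\<lambda>x. p4 x * z x)
        = m * integral {a..b} (\<lambda>x. p x * z x) - \<kappa> * integral {a..b} (\<lambda>x. p2 x * z x)"
      using pc z by (simp add: integral_expand)
    have "integral {a..b} (\<lambda>x. p4 x * z x - p4 x * y x) = integral {a..b} (\<lambda>x. p4 x * z x) - integral {a..b} (\<lambda>x. p4 x * y x)"
      by (intro integral_diff integrable_continuous_real continuous_intros pc z clampedD[OF y])
    then show ?thesis using y4 z4 by (simp add: right_diff_distrib)
  qed
  define F where "F x = z x - y x" for x
  have Fc: "continuous_on {a..b} F" unfolding F_def[abs_def] by (intro continuous_intros z clampedD[OF y])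
  obtain F1 where F1: "deriv_on a b F1 F" "F1 a = 0" using I[OF Fc] by blast
  obtain F2 where F2: "deriv_on a b F2 F1" "F2 a = 0" using I[OF deriv_on_continuous[OF F1(1)]] by blast
  obtain F3 where F3: "deriv_on a b F3 F2" "F3 a = 0" using I[OF deriv_on_continuous[OF F2(1)]] by blast
  obtain F4 where F4: "deriv_on a b F4 F3" "F4 a = 0" using I[OF deriv_on_continuous[OF F3(1)]] by blast
  obtain g g1 g2 d where g: "deriv_on a b g2 (\<lambda>_. d)"
    and p: "clamped a b (\<lambda>x. F4 x - g x) (\<lambda>x. F3 x - g1 x) (\<lambda>x. F2 x - g2 x)"
    by (rule clamp_by_cubic[OF ab F4(1) F3(1) deriv_on_continuous[OF F2(1)] F4(2) F3(2)]) (rule that)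
  have "integral {a..b} (\<lambda>x. F x * (z x - y x)) = 0"
    by (rule test[OF p deriv_on_diff[OF F2(1) g] _ Fc])
      (use deriv_on_diff[OF F1(1) deriv_on_const[of a b d]] in simp)
  then have "sq_int a b F = 0" by (simp add: F_def power2_eq_square)
  then have "\<forall>x\<in>{a..b}. (F x)\<^sup>2 = 0"
    using integral_eq_0_iff[of a b "\<lambda>x. (F x)\<^sup>2"] ab by (auto intro!: continuous_intros Fc)
  then have zy: "z x = y x" if "x \<in> {a..b}" for x using that by (simp add: F_def)
  have z12: "clamped a b z y1 y2"
    using y zy ab deriv_on_cong[OF clampedD(1)[OF y], of z y1] by (auto simp: clamped_def)
  show thesis
  proof (rule that[OF z12])
    \<comment> \<open>Bootstrapping: now that \<open>z\<close> has derivative \<open>y1\<close>, the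
      function \<open>y2\<close> can be differentiated, and then once more.\<close>
    define y3 where "y3 x = (m * Z1 x - \<kappa> * y1 x) - c" for x
    show "deriv_on a b y2 y3"
      unfolding y2_def[abs_def] y3_def[abs_def] q_def
      by (intro deriv_on_diff deriv_on_cmult h Z2 clampedD(1)[OF z12])
    show "deriv_on a b y3 (\<lambda>x. m * z x - \<kappa> * y2 x)"
      using deriv_on_diff[OF deriv_on_diff[OF deriv_on_cmult[OF Z1(1), of m]
          deriv_on_cmult[OF clampedD(2)[OF z12], of \<kappa>]] deriv_on_const[of a b c]]
      by (simp add: y3_def[abs_def])
  qed
qed

text \<open>Pairing the eigenvalue equation with its own solution makes every eigenvalue a value of
  the Rayleigh quotient, so none lies below the infimum.\<close>

lemma clamped_rayleigh:
  assumes ab: "a < b" and z: "clamped a b z z1 z2" and z3: "deriv_on a b z2 z3"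
    and z4: "deriv_on a b z3 (\<lambda>x. \<delta> * z x - \<kappa> * z2 x)"
  shows "bending_form a b \<kappa> z1 z2 = \<delta> * sq_int a b z"
proof -
  note c = clampedD(3-5)[OF z]
  have "sq_int a b z2 = integral {a..b} (\<lambda>x. (\<delta> * z x - \<kappa> * z2 x) * z x)"
    using clamped_integral_fourth[OF ab z z3 z4] c by (simp add: continuous_intros power2_eq_square)
  also have "\<dots> = integral {a..b} (\<lambda>x. \<delta> * (z x)\<^sup>2 - \<kappa> * (z x * z2 x))"
    by (simp add: power2_eq_square algebra_simps)
  also have "\<dots> = integral {a..b} (\<lambda>x. \<delta> * (z x)\<^sup>2) - integral {a..b} (\<lambda>x. \<kappa> * (z x * z2 x))"
    by (intro integral_diff integrable_continuous_real continuous_intros c)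
  also have "integral {a..b} (\<lambda>x. \<kappa> * (z x * z2 x)) = - \<kappa> * sq_int a b z1"
    using clamped_by_parts1(2)[OF ab z clampedD(1)[OF z] c(2)] by (simp add: power2_eq_square)
  finally show ?thesis by (simp add: bending_form_def)
qed

text \<open>The infimum \<open>m\<close> of the Rayleigh quotient is attained by an eigenfunction
  smooth enough for the definition of \<open>delta_o\<close>, and all other eigenvalues are at least
  \<open>m\<close>. So the \<open>LEAST\<close> exists and equals \<open>m\<close>, and the
  variational inequality for \<open>m\<close> becomes one for \<open>delta_o\<close>.\<close>

theorem bending_form_ge_delta_o:
  assumes ab: "a < b" and y: "clamped a b y y1 y2"
  shows "delta_o lam a b * sq_int a b y \<le> bending_form a b (3 * lam) y1 y2"
proof -
  obtain m z where z: "continuous_on {a..b} z" "sq_int a b z = 1"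
    and m: "\<And>y y1 y2. clamped a b y y1 y2 \<Longrightarrow> m * sq_int a b y \<le> bending_form a b (3 * lam) y1 y2"
    and weak: "\<And>p p1 p2 p3 p4. clamped a b p p1 p2 \<Longrightarrow> deriv_on a b p2 p3 \<Longrightarrow> deriv_on a b p3 p4 \<Longrightarrow>
       continuous_on {a..b} p4 \<Longrightarrow> integral {a..b} (\<lambda>x. (p4 x + 3 * lam * p2 x - m * p x) * z x) = 0"
    by (rule very_weak_eigenfunction[OF ab, of "3 * lam"]) (rule that)
  obtain z1 z2 z3 where zz: "clamped a b z z1 z2" "deriv_on a b z2 z3"
    "deriv_on a b z3 (\<lambda>x. m * z x - 3 * lam * z2 x)"
  proof (rule very_weak_eigenfunction_regular[OF ab z(1)])
    fix p p1 p2 p3 p4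
    assume "clamped a b p p1 p2" "deriv_on a b p2 p3" "deriv_on a b p3 p4" "continuous_on {a..b} p4"
    then show "integral {a..b} (\<lambda>x. (p4 x + 3 * lam * p2 x - m * p x) * z x) = 0" by (rule weak)
  qed (rule that)
  let ?P = "\<lambda>\<delta>. \<exists>z.
     (\<forall>j<4. xderiv a b j z differentiable_on {a..b}) \<and>
     (\<forall>x\<in>{a..b}. xderiv a b 4 z x + 3 * lam * xderiv a b 2 z x = \<delta> * z x) \<and>
     z a = 0 \<and> z b = 0 \<and> xderiv a b 1 z a = 0 \<and> xderiv a b 1 z b = 0 \<and>
     (\<exists>x\<in>{a..b}. z x \<noteq> 0)"
  have "delta_o lam a b = m"
    unfolding delta_o_def
  proof (rule Least_equality)
    define F where "F i = (if i = 0 then z else if i = 1 then z1 else if i = 2 then z2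
      else if i = 3 then z3 else (\<lambda>x. m * z x - 3 * lam * z2 x))" for i :: nat
    have F: "deriv_on a b (F i) (F (Suc i))" if "i < 4" for i
    proof -
      have "i = 0 \<or> i = 1 \<or> i = 2 \<or> i = 3" using that by linarith
      then show ?thesis using zz clampedD[OF zz(1)] by (auto simp: F_def)
    qed
    have x: "xderiv a b i z x = F i x" if "i \<le> 4" "x \<in> {a..b}" for i x
      using xderiv_eq_of_deriv_on[of a b 4 F i x, OF ab F] that by (simp add: F_def[of 0])
    have "xderiv a b j z differentiable_on {a..b}" if "j < 4" for j
    proof -
      have "deriv_on a b (xderiv a b j z) (F (Suc j))"
        using that x by (intro deriv_on_cong[OF F[OF that]]) auto
      then show ?thesis
        unfolding deriv_on_def differentiable_on_def real_differentiable_def by blast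
    qed
    moreover have "\<exists>x\<in>{a..b}. z x \<noteq> 0"
    proof (rule ccontr)
      assume "\<not> ?thesis"
      then have "sq_int a b z = integral {a..b} (\<lambda>x. 0)"
        by (intro integral_cong) auto
      then show False using z(2) by simp
    qed
    ultimately show "?P m"
      using x ab clampedD[OF zz(1)] by (intro exI[of _ z]) (auto simp: F_def)
  next
    fix \<delta> assume "?P \<delta>"
    then obtain v where v: "\<And>j. j < 4 \<Longrightarrow> xderiv a b j v differentiable_on {a..b}"
      "\<And>x. x \<in> {a..b} \<Longrightarrow> xderiv a b 4 v x + 3 * lam * xderiv a b 2 v x = \<delta> * v x"
      "v a = 0" "v b = 0" "xderiv a b 1 v a = 0" "xderiv a b 1 v b = 0" "\<exists>x\<in>{a..b}. v x \<noteq> 0" by blast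
    have d: "deriv_on a b (xderiv a b j v) (xderiv a b (Suc j) v)" if "j < 4" for j
      using deriv_on_xderiv[OF ab v(1)[OF that]] .
    from d[of 0] d[of 1] d[of 2] d[of 3]
    have d: "deriv_on a b v (xderiv a b 1 v)" "deriv_on a b (xderiv a b 1 v) (xderiv a b 2 v)"
      "deriv_on a b (xderiv a b 2 v) (xderiv a b 3 v)" "deriv_on a b (xderiv a b 3 v) (xderiv a b 4 v)"
      by (simp_all add: xderiv_0 eval_nat_numeral)
    have cl: "clamped a b v (xderiv a b 1 v) (xderiv a b 2 v)"
      using d v deriv_on_continuous[OF d(3)] by (simp add: clamped_def)
    have "deriv_on a b (xderiv a b 3 v) (\<lambda>x. \<delta> * v x - 3 * lam * xderiv a b 2 v x)"
      by (rule deriv_on_cong[OF d(4)]) (use v(2) in \<open>auto simp: algebra_simps\<close>)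
    from clamped_rayleigh[OF ab cl d(3) this] m[OF cl]
    have le: "m * sq_int a b v \<le> \<delta> * sq_int a b v" by simp
    have vc: "continuous_on {a..b} (\<lambda>x. (v x)\<^sup>2)" by (intro continuous_intros clampedD[OF cl])
    have "sq_int a b v \<noteq> 0"
      using v(7) integral_eq_0_iff[OF vc ab] by auto
    moreover have "0 \<le> sq_int a b v"
      by (intro integral_square_nonneg clampedD[OF cl])
    ultimately show "m \<le> \<delta>" using le by (simp add: mult_le_cancel_right)
  qed
  then show ?thesis using m[OF y] by simp
qed

section \<open>Dissipation and control laws\<close>

lemma delta2_nonneg: "0 \<le> delta2 \<delta>"
  by (simp add: delta2_def abs_if)

text \<open>The weights in \<open>delta1\<close> and \<open>delta2\<close> come from splitting the cross term of
  \<open>(w - h)\<^sup>2\<close> as \<open>4 \<bar>w h\<bar> \<le> w\<^sup>2 + 4 h\<^sup>2\<close>.\<close>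
lemma delta_split:
  "- (2/3) * \<delta> * (w - h)\<^sup>2 \<le> delta1 \<delta> * w\<^sup>2 + delta2 \<delta> * h\<^sup>2"
proof -
  have "0 \<le> \<bar>\<delta>\<bar> / 3 * (w - 2 * sgn \<delta> * h)\<^sup>2" by simp
  also have "\<dots> \<le> \<bar>\<delta>\<bar> / 3 * (w\<^sup>2 + 4 * h\<^sup>2) - 4 / 3 * \<delta> * (w * h)"
    by (cases "\<delta> > 0"; cases "\<delta> < 0") (auto simp: power2_eq_square algebra_simps)
  finally show ?thesis
    by (simp add: delta1_def delta2_def power2_eq_square field_simps)
qed

text \<open>Write \<open>w = z + h\<close> with \<open>z\<close> clamped. The weights 2 on the
  slopes and 2/3 on the curvature come from completing squares; since
  \<open>2 * lam = (2/3) * (3 * lam)\<close>, the terms in \<open>z\<close> form -2/3 times the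
  bending form with \<open>\<kappa> = 3 * lam\<close>, to which the spectral inequality applies.
  This is the origin of the factor 3 in \<open>delta_o\<close>.\<close>

lemma dissipation_bound:
  assumes ab: "a < b" and lam: "0 \<le> lam" and \<delta>: "\<delta> \<le> delta_o lam a b"
    and w: "deriv_on a b w w1" "deriv_on a b w1 w2" "continuous_on {a..b} w2"
    and h: "deriv_on a b h h1" "deriv_on a b h1 h2" "continuous_on {a..b} h2"
    and bc: "h a = w a" "h b = w b" "h1 a = w1 a" "h1 b = w1 b"
  shows "lam * sq_int a b w1 - sq_int a b w2
    \<le> 2 * sq_int a b h2 + 2 * lam * sq_int a b h1
      + delta1 \<delta> * sq_int a b w + delta2 \<delta> * sq_int a b h"
proof -
  define z z1 z2 where "z x = w x - h x" and "z1 x = w1 x - h1 x" and "z2 x = w2 x - h2 x" for x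
  have z: "clamped a b z z1 z2"
    unfolding clamped_def z_def[abs_def] z1_def[abs_def] z2_def[abs_def]
    using bc by (auto intro!: deriv_on_diff w h continuous_intros)
  note c = w(3) h(3) deriv_on_continuous[OF w(1)] deriv_on_continuous[OF w(2)]
    deriv_on_continuous[OF h(1)] deriv_on_continuous[OF h(2)] clampedD(3-5)[OF z]
  have I: "((\<lambda>x. (f x)\<^sup>2) has_integral sq_int a b f) {a..b}"
    if "continuous_on {a..b} f" for f :: "real \<Rightarrow> real"
    by (intro integrable_integral integrable_continuous_real continuous_intros that)
  let ?I = "\<lambda>f. sq_int a b f"
  have "lam * ?I w1 - ?I w2 \<le> (2 * lam * ?I z1 - 2 / 3 * ?I z2) + (2 * ?I h2 + 2 * lam * ?I h1)"
  proof (rule has_integral_le)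
    show "((\<lambda>x. lam * (w1 x)\<^sup>2 - (w2 x)\<^sup>2) has_integral (lam * ?I w1 - ?I w2)) {a..b}"
      by (intro has_integral_diff has_integral_mult_right I c)
    show "((\<lambda>x. (2 * lam * (z1 x)\<^sup>2 - 2 / 3 * (z2 x)\<^sup>2) + (2 * (h2 x)\<^sup>2 + 2 * lam * (h1 x)\<^sup>2)) has_integral
      ((2 * lam * ?I z1 - 2 / 3 * ?I z2) + (2 * ?I h2 + 2 * lam * ?I h1))) {a..b}"
      by (intro has_integral_diff has_integral_add has_integral_mult_right I c)
    fix x
    have "0 \<le> lam * (z1 x - h1 x)\<^sup>2" using lam by simp
    moreover have "0 \<le> 1 / 3 * (z2 x + 3 * h2 x)\<^sup>2" by simp
    ultimately show "lam * (w1 x)\<^sup>2 - (w2 x)\<^sup>2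
        \<le> (2 * lam * (z1 x)\<^sup>2 - 2 / 3 * (z2 x)\<^sup>2) + (2 * (h2 x)\<^sup>2 + 2 * lam * (h1 x)\<^sup>2)"
      by (simp add: z1_def z2_def power2_eq_square field_simps)
  qed
  moreover have "\<delta> * ?I z \<le> ?I z2 - 3 * lam * ?I z1"
    using bending_form_ge_delta_o[OF ab z, of lam] mult_right_mono[OF \<delta> integral_square_nonneg[OF clampedD(5)[OF z]]]
    by (simp add: bending_form_def)
  moreover have "- (2/3) * \<delta> * ?I z \<le> delta1 \<delta> * ?I w + delta2 \<delta> * ?I h"
  proof (rule has_integral_le)
    show "((\<lambda>x. - (2/3) * \<delta> * (z x)\<^sup>2) has_integral (- (2/3) * \<delta> * ?I z)) {a..b}"
      by (intro has_integral_mult_right I c)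
    show "((\<lambda>x. delta1 \<delta> * (w x)\<^sup>2 + delta2 \<delta> * (h x)\<^sup>2) has_integral (delta1 \<delta> * ?I w + delta2 \<delta> * ?I h)) {a..b}"
      by (intro has_integral_add has_integral_mult_right I c)
  qed (simp only: z_def delta_split)
  ultimately show ?thesis by simp
qed

section \<open>The cubic lift of a boundary value\<close>

definition chi1 :: "real \<Rightarrow> real \<Rightarrow> real \<Rightarrow> real" where
  "chi1 l p s = p * (6 * s\<^sup>2 / l ^ 3 - 6 * s / l\<^sup>2)"

definition chi2 :: "real \<Rightarrow> real \<Rightarrow> real \<Rightarrow> real" where
  "chi2 l p s = p * (12 * s / l ^ 3 - 6 / l\<^sup>2)"

lemma deriv_on_chi:
  assumes "0 < l"
  shows "deriv_on a b (\<lambda>x. chi l p (x - c)) (\<lambda>x. chi1 l p (x - c))"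
    and "deriv_on a b (\<lambda>x. chi1 l p (x - c)) (\<lambda>x. chi2 l p (x - c))"
    and "continuous_on {a..b} (\<lambda>x. chi2 l p (x - c))"
  unfolding deriv_on_def chi_def chi1_def chi2_def using assms
  by (auto intro!: derivative_eq_intros continuous_intros
      simp: power2_eq_square power3_eq_cube field_simps)

lemma chi_endpoints:
  assumes "0 < l"
  shows "chi l p 0 = p" "chi l p l = 0" "chi1 l p 0 = 0" "chi1 l p l = 0"
  using assms by (simp_all add: chi_def chi1_def power2_eq_square power3_eq_cube)

lemma chi_scale: "chi l p s = p * chi l 1 s" "chi1 l p s = p * chi1 l 1 s" "chi2 l p s = p * chi2 l 1 s"
  by (simp_all add: chi_def chi1_def chi2_def algebra_simps)

text \<open>What a unit input at the left end costs in the energy balance. The same cubic is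
  transplanted to \<open>{Y..L}\<close>, because on either segment a lifted input acts at the left
  end.\<close>

definition lift_cost :: "real \<Rightarrow> real \<Rightarrow> real \<Rightarrow> real \<Rightarrow> real" where
  "lift_cost a b lam \<delta> = 2 * integral {a..b} (\<lambda>x. (chi2 (b - a) 1 (x - a))\<^sup>2)
     + 2 * lam * integral {a..b} (\<lambda>x. (chi1 (b - a) 1 (x - a))\<^sup>2)
     + delta2 \<delta> * integral {a..b} (\<lambda>x. (chi (b - a) 1 (x - a))\<^sup>2)"

lemma lift_cost_nonneg:
  assumes "a < b" "0 \<le> lam"
  shows "0 \<le> lift_cost a b lam \<delta>"
proof -
  have l: "0 < b - a" using assms by simp
  show ?thesis
    unfolding lift_cost_def using assms delta2_nonneg deriv_on_chi[OF l, of a b 1 a]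
    by (intro add_nonneg_nonneg mult_nonneg_nonneg integral_square_nonneg)
      (auto dest: deriv_on_continuous)
qed

lemma lifted_dissipation_bound:
  assumes ab: "a < b" and lam: "0 \<le> lam" and \<delta>: "\<delta> \<le> delta_o lam a b"
    and w: "deriv_on a b w w1" "deriv_on a b w1 w2" "continuous_on {a..b} w2"
    and bc: "w b = 0" "w1 a = 0" "w1 b = 0"
  shows "lam * sq_int a b w1 - sq_int a b w2
    \<le> lift_cost a b lam \<delta> * (w a)\<^sup>2 + delta1 \<delta> * sq_int a b w"
proof -
  let ?l = "b - a" and ?p = "w a"
  have l: "0 < ?l" using ab by simp
  note h = deriv_on_chi[OF l, of a b ?p a]
  have b: "chi ?l ?p (a - a) = w a" "chi ?l ?p (b - a) = w b"
    "chi1 ?l ?p (a - a) = w1 a" "chi1 ?l ?p (b - a) = w1 b"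
    using bc by (simp_all add: chi_endpoints[OF l])
  have sc: "integral {a..b} (\<lambda>x. (chi ?l ?p (x - a))\<^sup>2) = ?p\<^sup>2 * integral {a..b} (\<lambda>x. (chi ?l 1 (x - a))\<^sup>2)"
    "integral {a..b} (\<lambda>x. (chi1 ?l ?p (x - a))\<^sup>2) = ?p\<^sup>2 * integral {a..b} (\<lambda>x. (chi1 ?l 1 (x - a))\<^sup>2)"
    "integral {a..b} (\<lambda>x. (chi2 ?l ?p (x - a))\<^sup>2) = ?p\<^sup>2 * integral {a..b} (\<lambda>x. (chi2 ?l 1 (x - a))\<^sup>2)"
    by (simp_all add: chi_scale[of ?l ?p] power_mult_distrib)
  show ?thesis
    using dissipation_bound[OF ab lam \<delta> w h b] unfolding sc lift_cost_def
    by (simp add: algebra_simps)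
qed

text \<open>Measured from the common end value the profile has zero boundary data, so the lift and
  its cost vanish.\<close>

lemma clamped_dissipation_bound:
  assumes ab: "a < b" and lam: "0 \<le> lam" and \<delta>: "\<delta> \<le> delta_o lam a b"
    and w: "deriv_on a b w w1" "deriv_on a b w1 w2" "continuous_on {a..b} w2"
    and bc: "w a = k" "w b = k" "w1 a = 0" "w1 b = 0"
  shows "lam * sq_int a b w1 - sq_int a b w2
    \<le> delta1 \<delta> * integral {a..b} (\<lambda>x. (w x - k)\<^sup>2)"
proof -
  have "deriv_on a b (\<lambda>x. w x - k) w1"
    using deriv_on_diff[OF w(1) deriv_on_const[of a b k]] by simp
  from lifted_dissipation_bound[OF ab lam \<delta> this w(2,3)] bc show ?thesis by simp
qed

lemma set_lebesgue_integral_continuous: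
  fixes f :: "real \<Rightarrow> real"
  assumes "continuous_on {a..b} f"
  shows "(LINT x:{a..b}|lebesgue. f x) = integral {a..b} f"
  by (intro set_lebesgue_integral_eq_integral absolutely_integrable_continuous_real assms)

lemma energy_continuous:
  assumes "continuous_on {a..b} f"
  shows "integral {a..b} (\<lambda>x. (f x - k)\<^sup>2) = 2 * energy a b k f"
  unfolding energy_def
  by (subst set_lebesgue_integral_continuous) (auto intro!: continuous_intros assms)

lemma H4_lifted_growth:
  assumes ab: "a < b" and lam: "0 \<le> lam" and \<delta>: "\<delta> \<le> delta_o lam a b" and f: "H4 a b f"
    and bc: "f b = 0" "xderiv a b 1 f a = 0" "xderiv a b 1 f b = 0"
  shows "net_growth lam a b f \<le> lift_cost a b lam \<delta> * (f a)\<^sup>2 + delta1 \<delta> * (2 * energy a b 0 f)"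
proof -
  note H = H4_deriv_on[OF ab f]
  show ?thesis
    using lifted_dissipation_bound[OF ab lam \<delta> H(1,2) deriv_on_continuous[OF H(3)] bc]
      energy_continuous[OF deriv_on_continuous[OF H(1)], of 0] by (simp add: net_growth_def)
qed

lemma H4_clamped_growth:
  assumes ab: "a < b" and lam: "0 \<le> lam" and \<delta>: "\<delta> \<le> delta_o lam a b" and f: "H4 a b f"
    and bc: "f a = k" "f b = k" "xderiv a b 1 f a = 0" "xderiv a b 1 f b = 0"
  shows "net_growth lam a b f \<le> delta1 \<delta> * (2 * energy a b k f)"
proof -
  note H = H4_deriv_on[OF ab f]
  show ?thesis
    using clamped_dissipation_bound[OF ab lam \<delta> H(1,2) deriv_on_continuous[OF H(3)] bc]
    unfolding net_growth_def energy_continuous[OF deriv_on_continuous[OF H(1)]] .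
qed

lemma The_quadratic_coefficient:
  assumes "\<And>p. f p = c * p\<^sup>2"
  shows "(THE a. \<forall>p::real. a * p\<^sup>2 = f p) = (c::real)"
proof (rule the_equality)
  fix a assume "\<forall>p. a * p\<^sup>2 = f p"
  from this[THEN spec, of 1] assms[of 1] show "a = c" by simp
qed (simp add: assms)

text \<open>Links the constants of the control law, which are definite descriptions over all
  \<open>p\<close>, to the cost in the dissipation estimate. They are well defined because the lift
  is linear in \<open>p\<close>.\<close>

lemma lift_cost_eq_a_w:
  assumes Y: "0 < Y"
  shows "a_w1 Y + delta2 \<delta> * a_w2 Y + lam * a_w3 Y = lift_cost 0 Y lam \<delta>"
proof -
  have d: "deriv_on 0 Y (chi Y p) (chi1 Y p)" "deriv_on 0 Y (chi1 Y p) (chi2 Y p)"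
    "continuous_on {0..Y} (chi2 Y p)" for p
    using deriv_on_chi[OF Y, of 0 Y p 0] by simp_all
  have sq: "(LINT x:{0..Y}|lebesgue. (f x)\<^sup>2) = p\<^sup>2 * sq_int 0 Y g"
    if f: "\<And>x. x \<in> {0..Y} \<Longrightarrow> f x = p * g x" and g: "continuous_on {0..Y} g" for f g :: "real \<Rightarrow> real" and p
  proof -
    have "(LINT x:{0..Y}|lebesgue. (f x)\<^sup>2) = (LINT x:{0..Y}|lebesgue. (p * g x)\<^sup>2)"
      by (rule set_lebesgue_integral_cong) (auto simp: f)
    also have "\<dots> = integral {0..Y} (\<lambda>x. (p * g x)\<^sup>2)"
      by (intro set_lebesgue_integral_continuous continuous_intros g)
    finally show ?thesis by (simp add: power_mult_distrib)
  qed
  define F where "F p i = (if i = 0 then chi Y p else if i = 1 then chi1 Y p else chi2 Y p)" for p and i :: nat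
  have F: "deriv_on 0 Y (F p i) (F p (Suc i))" if "i < 2" for p i
  proof -
    have "i = 0 \<or> i = 1" using that by linarith
    then show ?thesis using d by (auto simp: F_def)
  qed
  have x: "xderiv 0 Y i (chi Y p) x = F p i x" if "i \<le> 2" "x \<in> {0..Y}" for i x p
    using xderiv_eq_of_deriv_on[of 0 Y 2 "F p" i x, OF Y F] that by (simp add: F_def[of p 0])
  have "a_w1 Y = 2 * sq_int 0 Y (chi2 Y 1)"
    unfolding a_w1_def
  proof (rule The_quadratic_coefficient)
    fix p
    have "xderiv 0 Y 2 (chi Y p) x = p * chi2 Y 1 x" if "x \<in> {0..Y}" for x
      using x[of 2 x p] that chi_scale(3)[of Y p x] by (simp add: F_def)
    from sq[OF this d(3)]
    show "2 * (LINT x:{0..Y}|lebesgue. (xderiv 0 Y 2 (chi Y p) x)\<^sup>2) = 2 * sq_int 0 Y (chi2 Y 1) * p\<^sup>2"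
      by simp
  qed
  moreover have "a_w2 Y = sq_int 0 Y (chi Y 1)"
    unfolding a_w2_def
  proof (rule The_quadratic_coefficient)
    fix p
    show "(LINT x:{0..Y}|lebesgue. (chi Y p x)\<^sup>2) = sq_int 0 Y (chi Y 1) * p\<^sup>2"
      using sq[OF chi_scale(1) deriv_on_continuous[OF d(1)]] by simp
  qed
  moreover have "a_w3 Y = 2 * sq_int 0 Y (chi1 Y 1)"
    unfolding a_w3_def
  proof (rule The_quadratic_coefficient)
    fix p
    have "xderiv 0 Y 1 (chi Y p) x = p * chi1 Y 1 x" if "x \<in> {0..Y}" for x
      using x[of 1 x p] that chi_scale(2)[of Y p x] by (simp add: F_def)
    from sq[OF this deriv_on_continuous[OF d(2)]]
    show "2 * (LINT x:{0..Y}|lebesgue. (xderiv 0 Y 1 (chi Y p) x)\<^sup>2) = 2 * sq_int 0 Y (chi1 Y 1) * p\<^sup>2"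
      by simp
  qed
  ultimately show ?thesis by (simp add: lift_cost_def)
qed

text \<open>If \<open>|\<zeta>|\<close> is at least \<open>l1\<close>, the sign choice gives
  \<open>x * \<zeta> \<le> - V * l1\<close>, and \<open>V * l1\<close> is exactly the sum of the
  cubic and quadratic costs and the desired decay. Otherwise
  \<open>|x * \<zeta>| \<le> x^2 + l1^2\<close>, and these two squares account for the
  \<open>+ 1\<close> and for \<open>3 * l1^2\<close> in \<open>admissible_k1\<close>. Positivity of
  \<open>l1\<close> excludes \<open>\<zeta> = 0\<close> in the first case, so that
  \<open>|x| = V\<close>.\<close>

lemma kappa1_decay:
  fixes \<zeta> :: real
  assumes Y: "0 < Y" and lam: "0 \<le> lam" and V: "0 \<le> V" and \<alpha>: "0 < \<alpha>1 + 2 * delta1 \<delta>"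
    and k1: "admissible_k1 Y lam \<delta> \<alpha>1 k1"
  defines "x \<equiv> kappa1 Y lam \<delta> \<alpha>1 k1 V \<zeta>"
  shows "x ^ 3 / 3 + x * \<zeta> + lift_cost 0 Y lam \<delta> * x\<^sup>2 + 2 * delta1 \<delta> * V \<le> - \<alpha>1 * V"
proof -
  define A where "A = lift_cost 0 Y lam \<delta>"
  have A: "0 \<le> A" unfolding A_def using Y lam by (rule lift_cost_nonneg)
  define e where "e = \<alpha>1 + 2 * delta1 \<delta>"
  define l where "l = l1 Y lam \<delta> \<alpha>1 V"
  have l: "l = V\<^sup>2 / 3 + A * V + e"
    unfolding l_def l1_def lift_cost_eq_a_w[OF Y] A_def e_def ..
  have lpos: "0 < l" using A V \<alpha> by (simp add: l e_def add_nonneg_pos)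
  have "x ^ 3 / 3 + x * \<zeta> + A * x\<^sup>2 \<le> - e * V"
  proof (cases "l \<le> \<bar>\<zeta>\<bar>")
    case True
    then have "\<zeta> \<noteq> 0" using lpos by auto
    have x: "x = - sgn \<zeta> * V" using True by (simp add: x_def kappa1_def l_def)
    have "\<bar>x\<bar> = V" using \<open>\<zeta> \<noteq> 0\<close> V by (simp add: x abs_mult abs_sgn_eq)
    then have x2: "x\<^sup>2 = V\<^sup>2" by (metis power2_abs)
    have "x ^ 3 \<le> \<bar>x\<bar> ^ 3" by (metis abs_ge_self power_abs)
    then have x3: "x ^ 3 \<le> V ^ 3" using \<open>\<bar>x\<bar> = V\<close> by simp
    have "x * \<zeta> = - (V * \<bar>\<zeta>\<bar>)" by (simp add: x abs_sgn mult.commute mult.left_commute)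
    also have "\<dots> \<le> - (V * l)" using True V by (simp add: mult_left_mono)
    finally have "x * \<zeta> \<le> - (V ^ 3 / 3 + A * V\<^sup>2 + e * V)"
      by (simp add: l power2_eq_square power3_eq_cube algebra_simps)
    then show ?thesis using x3 x2 by simp
  next
    case False
    then have x: "x = k1 V" by (simp add: x_def kappa1_def l_def)
    have k: "x ^ 3 + 3 * (A + 1) * x\<^sup>2 + 3 * l\<^sup>2 \<le> - 3 * e * V"
      using k1 V unfolding admissible_k1_def lift_cost_eq_a_w[OF Y] by (auto simp: x l_def A_def e_def)
    have "x * \<zeta> \<le> \<bar>x\<bar> * \<bar>\<zeta>\<bar>" by (metis abs_ge_self abs_mult)
    also have "\<dots> \<le> \<bar>x\<bar> * l" using False by (intro mult_left_mono) auto
    also have "\<dots> \<le> x\<^sup>2 + l\<^sup>2"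
    proof -
      have "0 \<le> (\<bar>x\<bar> - l)\<^sup>2" by simp
      then have "2 * (\<bar>x\<bar> * l) \<le> x\<^sup>2 + l\<^sup>2" by (simp add: power2_diff)
      moreover have "0 \<le> \<bar>x\<bar> * l" using lpos by simp
      ultimately show ?thesis by linarith
    qed
    finally show ?thesis using k by (simp add: algebra_simps)
  qed
  then show ?thesis by (simp add: A_def e_def algebra_simps)
qed

text \<open>The sign branch yields at most \<open>(1/3 - 2) * \<xi>^3\<close>. In the other branch
  \<open>|\<zeta>| < 2 * \<xi>^2\<close> leaves \<open>(6 * \<mu> - \<mu>^3) / 3 * \<xi>^3\<close>,
  and the condition on \<open>\<mu>\<close> says that this coefficient is at most -1.\<close>

lemma kappa2_decay:
  assumes \<xi>: "0 \<le> \<xi>" and \<mu>: "0 < \<mu>" "- (\<mu> ^ 3) + 6 * \<mu> + 3 \<le> 0"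
  shows "(kappa2 \<mu> \<xi> \<zeta>) ^ 3 / 3 + kappa2 \<mu> \<xi> \<zeta> * \<zeta> \<le> - (\<xi> ^ 3)"
proof (cases "2 * \<xi>\<^sup>2 \<le> \<bar>\<zeta>\<bar>")
  case True
  then have x: "kappa2 \<mu> \<xi> \<zeta> = - sgn \<zeta> * \<xi>" by (simp add: kappa2_def)
  have "\<bar>kappa2 \<mu> \<xi> \<zeta>\<bar> \<le> \<xi>" using \<xi> by (simp add: x abs_mult abs_sgn_eq)
  then have "(kappa2 \<mu> \<xi> \<zeta>) ^ 3 \<le> \<xi> ^ 3"
    by (metis abs_ge_self abs_ge_zero order_trans power_abs power_mono)
  moreover have "kappa2 \<mu> \<xi> \<zeta> * \<zeta> = - (\<xi> * \<bar>\<zeta>\<bar>)"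
    by (simp add: x abs_sgn mult.commute mult.left_commute)
  moreover have "\<xi> * (2 * \<xi>\<^sup>2) \<le> \<xi> * \<bar>\<zeta>\<bar>" using True \<xi> by (rule mult_left_mono)
  moreover have "0 \<le> \<xi> ^ 3" using \<xi> by simp
  ultimately show ?thesis by (simp add: power2_eq_square power3_eq_cube)
next
  case False
  then have x: "kappa2 \<mu> \<xi> \<zeta> = - \<mu> * \<xi>" by (simp add: kappa2_def)
  have "- \<mu> * \<xi> * \<zeta> \<le> \<mu> * \<xi> * \<bar>\<zeta>\<bar>"
    using mult_left_mono[of "- \<zeta>" "\<bar>\<zeta>\<bar>" "\<mu> * \<xi>"] \<mu> \<xi> by simp
  also have "\<dots> \<le> \<mu> * \<xi> * (2 * \<xi>\<^sup>2)"
    using False \<mu> \<xi> by (intro mult_left_mono) auto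
  finally have "(kappa2 \<mu> \<xi> \<zeta>) ^ 3 / 3 + kappa2 \<mu> \<xi> \<zeta> * \<zeta> \<le> (- (\<mu> ^ 3) + 6 * \<mu>) / 3 * \<xi> ^ 3"
    unfolding x by (simp add: power2_eq_square power3_eq_cube field_simps)
  also have "\<dots> \<le> - 1 * \<xi> ^ 3" using \<mu> \<xi> by (intro mult_right_mono) auto
  finally show ?thesis by simp
qed

lemma kappa2_range: "kappa2 \<mu> \<xi> \<zeta> \<in> {- \<xi>, 0, \<xi>, - \<mu> * \<xi>}"
  by (auto simp: kappa2_def sgn_if)

section \<open>Gronwall estimates almost everywhere in time\<close>

abbreviation rate_le :: "(real \<Rightarrow> real) \<Rightarrow> real \<Rightarrow> real \<Rightarrow> (real \<Rightarrow> real) \<Rightarrow> bool" where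
  "rate_le F s0 s1 R \<equiv> AE t in lebesgue. t \<in> {s0<..<s1} \<longrightarrow>
     (\<exists>D. (F has_real_derivative D) (at t) \<and> D \<le> R t)"

text \<open>The bound \<open>M\<close> is placed on the discounted forcing, so either sign of
  \<open>K\<close> can be exploited: a negative \<open>K\<close> keeps at least the smallest
  discount factor of the interval, a positive one at most the factor 1 when \<open>C\<close> is
  nonnegative.\<close>

lemma abs_cont_gronwall:
  assumes F: "abs_cont_fun F s0 s1" and s: "s \<in> {s0..s1}"
    and der: "rate_le F s0 s1 (\<lambda>t. C * F t + K)"
    and M: "\<And>t. t \<in> {s0<..<s1} \<Longrightarrow> exp (- C * (t - s0)) * K \<le> M"
  shows "exp (- C * (s - s0)) * F s \<le> F s0 + M * (s - s0)"
proof -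
  define G where "G t = exp (- C * (t - s0)) * F t + - (M * (t - s0))" for t
  have e: "abs_cont_fun (\<lambda>t. exp (- C * (t - s0))) s0 s"
    by (rule abs_cont_of_continuous_deriv[where F' = "\<lambda>t. - C * exp (- C * (t - s0))"])
      (auto intro!: derivative_eq_intros continuous_intros)
  have m: "abs_cont_fun (\<lambda>t. - (M * (t - s0))) s0 s"
    by (rule abs_cont_of_continuous_deriv[where F' = "\<lambda>t. - M"])
      (auto intro!: derivative_eq_intros)
  have ac: "abs_cont_fun G s0 s"
    unfolding G_def using s by (intro abs_cont_add abs_cont_mult e m abs_cont_subinterval[OF F]) auto
  have "AE t in lebesgue. t \<notin> {s0, s}"
    by (rule AE_not_in) (intro null_sets_completionI countable_imp_null_set_lborel; simp)
  with der have der': "AE t in lebesgue. t \<in> {s0..s} \<longrightarrow> (\<exists>D\<le>0. (G has_real_derivative D) (at t within {s0..s}))"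
  proof eventually_elim
    case (elim t)
    show ?case
    proof
      assume "t \<in> {s0..s}"
      then have t: "t \<in> {s0<..<s1}" using elim s by auto
      then obtain D where D: "(F has_real_derivative D) (at t)" "D \<le> C * F t + K" using elim by blast
      have "(G has_real_derivative (exp (- C * (t - s0)) * (D - C * F t) - M)) (at t)"
        unfolding G_def[abs_def]
        by (auto intro!: derivative_eq_intros D(1) simp: algebra_simps)
      moreover have "exp (- C * (t - s0)) * (D - C * F t) \<le> exp (- C * (t - s0)) * K"
        using D(2) by (intro mult_left_mono) auto
      then have "exp (- C * (t - s0)) * (D - C * F t) - M \<le> 0"
        using M[OF t] by linarith
      ultimately show "\<exists>D\<le>0. (G has_real_derivative D) (at t within {s0..s})"
        using has_field_derivative_at_within by blast
    qed
  qed
  have "G s \<le> G s0" using abs_cont_nonincreasing[OF _ ac der'] s by simp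
  then show ?thesis by (simp add: G_def)
qed

lemma abs_cont_gronwall_homogeneous:
  assumes F: "abs_cont_fun F s0 s1" and s: "s \<in> {s0..s1}"
    and der: "rate_le F s0 s1 (\<lambda>t. C * F t)"
  shows "F s \<le> exp (C * (s - s0)) * F s0"
proof -
  have "exp (- C * (s - s0)) * F s \<le> F s0 + 0 * (s - s0)"
    by (rule abs_cont_gronwall[OF F s, where K = 0]) (use der in auto)
  then have "exp (C * (s - s0)) * (exp (- C * (s - s0)) * F s) \<le> exp (C * (s - s0)) * F s0" by simp
  then show ?thesis by (simp add: mult.assoc[symmetric] flip: exp_add)
qed

section \<open>Closed-loop estimates over one interval\<close>

lemma V1_eq_energy: "V1 Y u s = energy 0 Y 0 (\<lambda>x. u x s)"
  and V2_eq_energy: "V2 Y L u s = energy Y L 0 (\<lambda>x. u x s)"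
  by (simp_all add: V1_def V2_def energy_def)

lemma L2norm_split:
  assumes f: "in_L2 0 L f" and Y: "0 \<le> Y" "Y \<le> L"
  shows "(L2norm 0 L f)\<^sup>2 = 2 * energy 0 Y 0 f + 2 * energy Y L 0 f"
proof -
  have si: "set_integrable lebesgue {a..b} (\<lambda>x. (f x)\<^sup>2)" if "0 \<le> a" "b \<le> L" for a b
    using in_L2_subinterval[OF f that] by (simp add: in_L2_def)
  have eq: "(LINT x:{a..b}|lebesgue. (f x)\<^sup>2) = sq_int a b f" if "0 \<le> a" "b \<le> L" for a b
    using set_lebesgue_integral_eq_integral(2)[OF si[OF that]] .
  have "(\<lambda>x. (f x)\<^sup>2) integrable_on {0..L}"
    using set_lebesgue_integral_eq_integral(1)[OF si[of 0 L]] by simp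
  then have "sq_int 0 Y f + sq_int Y L f = sq_int 0 L f"
    by (rule Henstock_Kurzweil_Integration.integral_combine[OF Y])
  then show ?thesis
    using Y by (simp add: L2norm_power2 flip: set_lebesgue_integral_eq_lebesgue_on)
      (simp add: energy_def eq)
qed

lemma delta1_le_abs: "delta1 \<delta> \<le> \<bar>\<delta>\<bar>"
  by (simp add: delta1_def)

text \<open>From \<open>(x + y)^2 \<le> 2 * x^2 + 2 * y^2\<close>. It is applied once to change to
  the held boundary value and once to change back, whence the factor 4 in later bounds.\<close>

lemma energy_shift_le:
  assumes "in_L2 a b f" "a \<le> b"
  shows "energy a b k f \<le> 2 * energy a b k' f + (k - k')\<^sup>2 * (b - a)"
proof -
  let ?A = "L2norm a b (\<lambda>x. f x - k')" and ?B = "L2norm a b (\<lambda>_. k' - k)"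
  have "L2norm a b (\<lambda>x. f x - k) \<le> ?A + ?B"
    using L2norm_add_le[OF in_L2_diff[OF assms(1) in_L2_const[of a b k']] in_L2_const[of a b "k' - k"]] by simp
  then have "(L2norm a b (\<lambda>x. f x - k))\<^sup>2 \<le> (?A + ?B)\<^sup>2"
    using L2norm_nonneg by (rule power_mono)
  also have "\<dots> \<le> 2 * ?A\<^sup>2 + 2 * ?B\<^sup>2"
    using sum_squares_bound[of ?A ?B] by (simp add: power2_sum)
  also have "?B\<^sup>2 = (k - k')\<^sup>2 * (b - a)"
    using assms(2) unfolding L2norm_power2
    by (simp add: measure_restrict_space power2_commute)
  finally show ?thesis by (simp add: energy_eq)
qed

text \<open>An input of size \<open>\<psi>\<close> drains \<open>V\<close> at the rate
  \<open>\<psi> ^ 3\<close>; as \<open>V\<close> cannot become negative, \<open>\<psi>\<close> is bounded independently of the gain \<open>g\<close>.\<close>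
lemma held_input_bound:
  assumes V: "abs_cont_fun V s0 s1" "\<And>s. 0 \<le> V s" and s: "s0 < s1"
    and g: "1 \<le> g" and \<psi>: "\<psi> = g * V s0" and B: "0 \<le> B" and C: "0 \<le> C"
    and der: "rate_le V s0 s1 (\<lambda>t. C * V t + (B * \<psi>\<^sup>2 - \<psi> ^ 3))"
  shows "\<psi> \<le> B + 1 + exp (C * (s1 - s0)) / (s1 - s0)"
    and "s \<in> {s0..s1} \<Longrightarrow> V s \<le> exp (C * (s1 - s0)) * (\<psi> + (s1 - s0) * B * \<psi>\<^sup>2)"
proof -
  let ?\<tau> = "s1 - s0" and ?K = "B * \<psi>\<^sup>2 - \<psi> ^ 3"
  have V\<psi>: "V s0 \<le> \<psi>" "0 \<le> \<psi>"
    using mult_right_mono[OF g V(2)[of s0]] g V(2)[of s0] by (simp_all add: \<psi>)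
  show "\<psi> \<le> B + 1 + exp (C * ?\<tau>) / ?\<tau>"
  proof (cases "\<psi> \<le> B + 1")
    case True
    moreover have "0 \<le> exp (C * ?\<tau>) / ?\<tau>" using s by simp
    ultimately show ?thesis by linarith
  next
    case False
    \<comment> \<open>Above \<open>B + 1\<close> the cubic drain exceeds the quadratic cost by at
      least \<open>\<psi>\<^sup>2\<close>.\<close>
    have "\<psi>\<^sup>2 * 1 \<le> \<psi>\<^sup>2 * (\<psi> - B)" using False by (intro mult_left_mono) auto
    then have K: "?K \<le> - \<psi>\<^sup>2" by (simp add: power2_eq_square power3_eq_cube algebra_simps)
    then have K0: "?K \<le> 0" using zero_le_power2[of \<psi>] by linarith
    have "exp (- C * (s1 - s0)) * V s1 \<le> V s0 + exp (- C * ?\<tau>) * ?K * (s1 - s0)"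
    proof (rule abs_cont_gronwall[OF V(1) _ der])
      fix t assume "t \<in> {s0<..<s1}"
      then have "exp (- C * ?\<tau>) \<le> exp (- C * (t - s0))"
        using C by (simp add: mult_left_mono)
      then show "exp (- C * (t - s0)) * ?K \<le> exp (- C * ?\<tau>) * ?K"
        using K0 by (rule mult_right_mono_neg)
    qed (use s in simp)
    moreover have "0 \<le> exp (- C * (s1 - s0)) * V s1" using V(2) by simp
    moreover have "exp (- C * ?\<tau>) * ?K * ?\<tau> \<le> exp (- C * ?\<tau>) * (- \<psi>\<^sup>2) * ?\<tau>"
      using K s by (intro mult_right_mono mult_left_mono) auto
    \<comment> \<open>Nonnegativity of the final energy bounds the total drain by the initial
      energy, which is at most \<open>\<psi>\<close>. A quadratic quantity lies below a linear one,
      and division by \<open>\<psi>\<close> remains.\<close>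
    ultimately have "exp (- C * ?\<tau>) * ?\<tau> * \<psi>\<^sup>2 \<le> \<psi>" using V\<psi> by (simp add: algebra_simps)
    then have "\<psi> * (exp (- C * ?\<tau>) * ?\<tau> * \<psi>) \<le> \<psi> * 1"
      by (simp add: power2_eq_square mult.assoc mult.left_commute)
    moreover have "0 < \<psi>" using False B by linarith
    ultimately have "exp (- C * ?\<tau>) * ?\<tau> * \<psi> \<le> 1" by simp
    then have "exp (C * ?\<tau>) * (exp (- C * ?\<tau>) * ?\<tau> * \<psi>) \<le> exp (C * ?\<tau>) * 1"
      by (intro mult_left_mono) auto
    also have "exp (C * ?\<tau>) * (exp (- C * ?\<tau>) * ?\<tau> * \<psi>) = ?\<tau> * \<psi>"
      by (simp add: mult.assoc[symmetric] flip: exp_add)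
    finally have "\<psi> \<le> exp (C * ?\<tau>) / ?\<tau>" using s by (simp add: pos_le_divide_eq mult.commute)
    then show ?thesis using B by linarith
  qed
  \<comment> \<open>Here the drain is discarded, and \<open>V s0 \<le> \<psi>\<close> holds because
    the gain is at least 1.\<close>
  show "V s \<le> exp (C * ?\<tau>) * (\<psi> + ?\<tau> * B * \<psi>\<^sup>2)" if s': "s \<in> {s0..s1}"
  proof -
    have "exp (- C * (s - s0)) * V s \<le> V s0 + B * \<psi>\<^sup>2 * (s - s0)"
    proof (rule abs_cont_gronwall[OF V(1) s' der])
      fix t assume "t \<in> {s0<..<s1}"
      then have "exp (- C * (t - s0)) \<le> 1" using C by simp
      moreover have "?K \<le> B * \<psi>\<^sup>2" "0 \<le> B * \<psi>\<^sup>2" using V\<psi> B by simp_all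
      ultimately have "exp (- C * (t - s0)) * ?K \<le> 1 * (B * \<psi>\<^sup>2)"
        by (meson exp_ge_zero mult_left_mono mult_right_mono order_trans)
      then show "exp (- C * (t - s0)) * ?K \<le> B * \<psi>\<^sup>2" by simp
    qed
    also have "\<dots> \<le> \<psi> + B * \<psi>\<^sup>2 * ?\<tau>"
      using V\<psi> B s' by (intro add_mono mult_left_mono) auto
    finally have le: "exp (C * (s - s0)) * (exp (- C * (s - s0)) * V s) \<le> exp (C * (s - s0)) * (\<psi> + B * \<psi>\<^sup>2 * ?\<tau>)"
      by (rule mult_left_mono) simp
    have "V s = exp (C * (s - s0)) * (exp (- C * (s - s0)) * V s)"
      by (simp add: mult.assoc[symmetric] flip: exp_add)
    also note le
    also have "exp (C * (s - s0)) * (\<psi> + B * \<psi>\<^sup>2 * ?\<tau>) \<le> exp (C * ?\<tau>) * (\<psi> + B * \<psi>\<^sup>2 * ?\<tau>)"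
      using s' C V\<psi> B s by (intro mult_right_mono) (auto intro: mult_left_mono)
    also have "B * \<psi>\<^sup>2 * ?\<tau> = ?\<tau> * B * \<psi>\<^sup>2" by (simp only: mult.commute mult.left_commute)
    finally show ?thesis .
  qed
qed

text \<open>Holds only what is given before the gains, the bound \<open>\<beta>\<close> and the
  solution are chosen. A constant defined here cannot depend on those unless they are explicit
  arguments, and this is how the order of quantifiers in the theorem is respected.\<close>

locale ks_setting =
  fixes L Y lam T1 T2 \<delta> \<mu> t0 :: real and t :: "nat \<Rightarrow> real"
  assumes Y: "0 < Y" "Y < L" and lam: "0 \<le> lam"
    and t1: "t 1 = 0" and t_step: "\<And>i. i \<ge> 1 \<Longrightarrow> t i < t (i + 1)"
    and T1: "0 < T1" and T2: "0 < T2"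
    and len1: "\<And>k. k \<ge> 1 \<Longrightarrow> t (2*k) - t (2*k - 1) = T1"
    and len2: "\<And>k. k \<ge> 1 \<Longrightarrow> t (2*k + 1) - t (2*k) = T2"
    and \<delta>: "\<delta> \<le> delta_o lam 0 Y" "\<delta> \<le> delta_o lam Y L"
    and \<mu>: "0 < \<mu>" "- (\<mu> ^ 3) + 6 * \<mu> + 3 \<le> 0"
    and t0: "0 \<le> t0"
begin

lemma t_less: "1 \<le> i \<Longrightarrow> i < j \<Longrightarrow> t i < t j"
proof (induction j)
  case (Suc j)
  then show ?case using t_step[of j] by (cases "i = j") auto
qed simp

lemma t_le: "1 \<le> i \<Longrightarrow> i \<le> j \<Longrightarrow> t i \<le> t j"
  using t_less[of i j] by (cases "i = j") auto

lemma no_switch_between: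
  assumes "1 \<le> i" "s \<in> {t i<..<t (i + 1)}"
  shows "s \<notin> t ` {1..}"
proof
  assume "s \<in> t ` {1..}"
  then obtain j where j: "1 \<le> j" "s = t j" by auto
  show False
  proof (cases "j \<le> i")
    case True
    then have "t j \<le> t i" using t_le[of j i] j by simp
    then show False using assms j by auto
  next
    case False
    then have "t (i + 1) \<le> t j" by (intro t_le) auto
    then show False using assms j by auto
  qed
qed

text \<open>\<open>delta1 \<delta>\<close> is negative for positive \<open>\<delta>\<close>; its
  bound \<open>\<bar>\<delta>\<bar>\<close> gives a nonnegative rate, for which exponentials can be
  estimated by the full length of a stretch.\<close>

definition rate :: real where "rate = 2 * \<bar>\<delta>\<bar>"

lemma rate_nonneg: "0 \<le> rate"
  by (simp add: rate_def)

lemma delta1_energy_le: "delta1 \<delta> * (2 * energy a b k f) \<le> rate * energy a b k f"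
  using mult_right_mono[OF delta1_le_abs[of \<delta>] energy_nonneg[of a b k f]] by (simp add: rate_def)

end

locale ks_closed_loop = ks_setting +
  fixes \<alpha>1 \<alpha>2 :: real and k1 :: "real \<Rightarrow> real" and u :: "real \<Rightarrow> real \<Rightarrow> real"
  assumes CL: "closed_loop_solution L Y lam t \<delta> \<mu> \<alpha>1 \<alpha>2 k1 t0 u"
    and k1: "admissible_k1 Y lam \<delta> \<alpha>1 k1" and \<alpha>1: "0 < \<alpha>1 + 2 * delta1 \<delta>" and \<alpha>2: "1 \<le> \<alpha>2"
begin

abbreviation state :: "real \<Rightarrow> real \<Rightarrow> real" where
  "state s \<equiv> \<lambda>x. u x s"

lemma split: "\<exists>u1 u2 u3. split_solution L Y lam {t0..} (t ` {1..}) u u1 u2 u3"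
  using CL unfolding closed_loop_solution_def Let_def by blast

lemma regular:
  assumes "s \<in> {t0..} - t ` {1..}"
  shows "H4 0 Y (state s)" "H4 Y L (state s)"
    "xderiv 0 Y 1 (state s) 0 = 0" "xderiv 0 Y 1 (state s) Y = 0"
    "xderiv Y L 1 (state s) Y = 0" "xderiv Y L 1 (state s) L = 0"
  using split assms unfolding split_solution_def by auto

lemma inputs_I1:
  assumes k: "1 \<le> k" and s: "s \<in> {max t0 (t (2*k - 1))<..<t (2*k)}"
  shows "u 0 s = kappa1 Y lam \<delta> \<alpha>1 k1 (V1 Y u s) (xderiv 0 Y 3 (state s) 0)" (is ?law)
    "u Y s = 0" "u L s = 0"
proof -
  have N: "s \<notin> t ` {1..}" using no_switch_between[of "2*k - 1" s] k s by simp
  have D: "s \<in> {t0..} - t ` {1..}" using N s by simp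
  have "s \<in> I1 t" unfolding I1_def using k s by (auto intro!: bexI[of _ k])
  then have "s \<in> {t0..} \<inter> I1 t - t ` {1..}" using D by blast
  moreover obtain u1 u2 u3 where sol: "split_solution L Y lam {t0..} (t ` {1..}) u u1 u2 u3"
    and law: "\<forall>s\<in>{t0..} \<inter> I1 t - t ` {1..}.
       u1 s = kappa1 Y lam \<delta> \<alpha>1 k1 (V1 Y u s) (xderiv 0 Y 3 (state s) 0) \<and> u2 s = 0 \<and> u3 s = 0"
    using CL unfolding closed_loop_solution_def Let_def by blast
  moreover have "u 0 s = u1 s" "u Y s = u2 s" "u L s = u3 s"
    using sol D unfolding split_solution_def by blast+
  ultimately show ?law
    "u Y s = 0" "u L s = 0"
    by simp_all
qed

lemma inputs_I2:
  assumes k: "1 \<le> k" and s: "s \<in> {max t0 (t (2*k))<..<t (2*k + 1)}"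
  shows "u 0 s = kappa2 \<mu> (\<alpha>2 powr (1/3) * V2 Y L u (max t0 (t (2*k)))) (xderiv Y L 3 (state s) Y)" (is ?law)
    "u Y s = u 0 s" "u L s = 0"
proof -
  have N: "s \<notin> t ` {1..}" using no_switch_between[of "2*k" s] k s by simp
  have D: "s \<in> {t0..} - t ` {1..}" using N s by simp
  have "s \<in> {t0..} \<inter> {t (2*k)..<t (2*k + 1)} - t ` {1..}" using D s by auto
  moreover obtain u1 u2 u3 where sol: "split_solution L Y lam {t0..} (t ` {1..}) u u1 u2 u3"
    and law: "\<forall>k\<ge>1. \<forall>s\<in>{t0..} \<inter> {t (2*k)..<t (2*k + 1)} - t ` {1..}.
       u1 s = kappa2 \<mu> (\<alpha>2 powr (1/3) * V2 Y L u (max t0 (t (2*k)))) (xderiv Y L 3 (state s) Y) \<and>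
       u2 s = u1 s \<and> u3 s = 0"
    using CL unfolding closed_loop_solution_def Let_def by blast
  moreover have "u 0 s = u1 s" "u Y s = u2 s" "u L s = u3 s"
    using sol D unfolding split_solution_def by blast+
  ultimately show ?law
    "u Y s = u 0 s" "u L s = 0"
    using k by simp_all
qed

lemma in_L2_state: "t0 \<le> s \<Longrightarrow> in_L2 0 L (state s)"
  using split unfolding split_solution_def by auto

lemma abs_cont_state_energy:
  assumes "t0 \<le> c" "c \<le> d" "0 \<le> a" "b \<le> L"
  shows "abs_cont_fun (\<lambda>s. energy a b k (state s)) c d"
proof (rule abs_cont_energy)
  show "in_L2 0 L (state s)" if "s \<in> {c..d}" for s using in_L2_state that assms by simp
  have "loc_abs_cont (\<lambda>s s'. L2norm 0 L (\<lambda>x. u x s - u x s')) {t0..}"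
    using split unfolding split_solution_def by blast
  then show "abs_cont (\<lambda>s s'. L2norm 0 L (\<lambda>x. u x s - u x s')) c d"
    using assms unfolding loc_abs_cont_def by (simp add: subset_iff)
qed (use assms in auto)

lemma energy_inequality:
  assumes ab: "(a, b) = (0, Y) \<or> (a, b) = (Y, L)" and s0: "t0 \<le> s0"
    and R: "\<And>s. s \<in> {s0<..<s1} \<Longrightarrow> s \<in> {t0..} - t ` {1..} \<Longrightarrow>
       boundary_flux a b k (state s) + net_growth lam a b (state s) \<le> R s"
  shows "rate_le (\<lambda>s. energy a b k (state s)) s0 s1 R"
proof -
  obtain u1 u2 u3 where sol: "split_solution L Y lam {t0..} (t ` {1..}) u u1 u2 u3" using split by blast
  have "AE s in lebesgue. s \<in> {t0<..<s1} \<longrightarrow> s \<notin> t ` {1..} \<and>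
     (\<forall>k. ((\<lambda>s. energy a b k (state s)) has_real_derivative
        (boundary_flux a b k (state s) + net_growth lam a b (state s))) (at s))"
  proof (rule energy_rate[OF _ _ _ refl])
    show "\<forall>s\<in>{t0..}. in_L2 0 L (state s)"
      "loc_abs_cont (\<lambda>s s'. L2norm 0 L (\<lambda>x. u x s - u x s')) {t0..}" "ks_on lam a b {t0..} u"
      using sol ab unfolding split_solution_def by auto
  qed (use ab Y regular in auto)
  then show ?thesis
  proof eventually_elim
    case (elim s)
    show ?case
    proof
      assume s: "s \<in> {s0<..<s1}"
      then have "s \<in> {t0..} - t ` {1..}" using elim s0 by auto
      from R[OF s this] elim s s0 show "\<exists>D. ((\<lambda>s. energy a b k (state s)) has_real_derivative D) (at s) \<and> D \<le> R s"
        by auto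
    qed
  qed
qed

text \<open>With zero input at \<open>Y\<close> the flux reduces to the cubic term and the third
  derivative at 0, the very combination that \<open>kappa1\<close> makes negative.\<close>

lemma I1_left_rate:
  assumes k: "1 \<le> k"
  shows "rate_le (\<lambda>s. V1 Y u s) (max t0 (t (2*k - 1))) (t (2*k)) (\<lambda>s. - \<alpha>1 * V1 Y u s)"
  unfolding V1_eq_energy
proof (rule energy_inequality)
  fix s assume s: "s \<in> {max t0 (t (2*k - 1))<..<t (2*k)}" and D: "s \<in> {t0..} - t ` {1..}"
  note in1 = inputs_I1[OF k s]
  let ?f = "state s"
  have "boundary_flux 0 Y 0 ?f + net_growth lam 0 Y ?f \<le> (u 0 s) ^ 3 / 3 + u 0 s * xderiv 0 Y 3 ?f 0
      + lift_cost 0 Y lam \<delta> * (u 0 s)\<^sup>2 + 2 * delta1 \<delta> * energy 0 Y 0 ?f"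
    using H4_lifted_growth[OF Y(1) lam \<delta>(1) regular(1)[OF D] in1(2) regular(3,4)[OF D]] in1(2)
    by (simp add: boundary_flux_def)
  also have "\<dots> \<le> - \<alpha>1 * energy 0 Y 0 ?f"
    unfolding in1(1) V1_eq_energy by (rule kappa1_decay[OF Y(1) lam energy_nonneg \<alpha>1 k1])
  finally show "boundary_flux 0 Y 0 ?f + net_growth lam 0 Y ?f \<le> - \<alpha>1 * energy 0 Y 0 ?f" .
qed simp_all

lemma I1_right_rate:
  assumes k: "1 \<le> k"
  shows "rate_le (\<lambda>s. V2 Y L u s) (max t0 (t (2*k - 1))) (t (2*k)) (\<lambda>s. rate * V2 Y L u s)"
  unfolding V2_eq_energy
proof (rule energy_inequality)
  fix s assume s: "s \<in> {max t0 (t (2*k - 1))<..<t (2*k)}" and D: "s \<in> {t0..} - t ` {1..}"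
  note in1 = inputs_I1[OF k s]
  show "boundary_flux Y L 0 (state s) + net_growth lam Y L (state s) \<le> rate * energy Y L 0 (state s)"
    using H4_clamped_growth[OF Y(2) lam \<delta>(2) regular(2)[OF D] in1(2,3) regular(5,6)[OF D]]
      delta1_energy_le[of Y L 0 "state s"] in1 by (simp add: boundary_flux_def)
qed simp_all

lemma I1_stretch:
  assumes k: "1 \<le> k" and s0: "s0 = max t0 (t (2*k - 1))" and s: "s \<in> {s0..t (2*k)}"
  shows "V1 Y u s \<le> exp (- \<alpha>1 * (s - s0)) * V1 Y u s0" (is ?left)
    "V2 Y L u s \<le> exp (rate * (s - s0)) * V2 Y L u s0" (is ?right)
proof -
  have ac: "abs_cont_fun (\<lambda>s. energy a b c (state s)) s0 (t (2*k))"
    if "0 \<le> a" "b \<le> L" for a b c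
  proof -
    have "s0 \<le> t (2*k)" using s unfolding atLeastAtMost_iff by linarith
    moreover have "t0 \<le> s0" by (simp add: s0)
    ultimately show ?thesis using that by (intro abs_cont_state_energy)
  qed
  show ?left
    using I1_left_rate[OF k] ac[of 0 Y 0] Y unfolding s0[symmetric]
    by (intro abs_cont_gronwall_homogeneous[OF _ s]) (simp_all add: V1_eq_energy)
  show ?right
    using I1_right_rate[OF k] ac[of Y L 0] Y unfolding s0[symmetric]
    by (intro abs_cont_gronwall_homogeneous[OF _ s]) (simp_all add: V2_eq_energy)
qed

text \<open>The control law on \<open>I2\<close> takes finitely many values while the boundary trace is
  continuous in time, so the input cannot switch between two sampling instants.\<close>
lemma I2_input_constant:
  assumes k: "1 \<le> k" and s0: "s0 = max t0 (t (2*k))" "s0 < t (2*k + 1)"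
  obtains c where "\<And>s. s \<in> {s0<..<t (2*k + 1)} \<Longrightarrow> u 0 s = c"
    "c\<^sup>2 \<le> (1 + \<mu>)\<^sup>2 * (\<alpha>2 powr (1/3) * V2 Y L u s0)\<^sup>2"
proof -
  define \<xi> where "\<xi> = \<alpha>2 powr (1/3) * V2 Y L u s0"
  have \<xi>: "0 \<le> \<xi>" by (simp add: \<xi>_def V2_eq_energy energy_nonneg)
  let ?S = "{s0<..<t (2*k + 1)}"
  have val: "u 0 s \<in> {- \<xi>, 0, \<xi>, - \<mu> * \<xi>}" if "s \<in> ?S" for s
    using inputs_I2(1)[OF k, of s] that kappa2_range unfolding s0(1)[symmetric] \<xi>_def[symmetric] by metis
  have loc: "loc_abs_cont (\<lambda>s s'. \<bar>u 0 s - u 0 s'\<bar>) ({t0..} - t ` {1..})"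
    using split Y unfolding split_solution_def by auto
  have sub: "?S \<subseteq> {t0..} - t ` {1..}"
  proof
    fix s assume "s \<in> ?S"
    then show "s \<in> {t0..} - t ` {1..}"
      using no_switch_between[of "2*k" s] k s0 by auto
  qed
  have "continuous_on ?S (u 0)"
    unfolding continuous_on_eq_continuous_at[OF open_greaterThanLessThan]
  proof
    fix s assume s: "s \<in> ?S"
    \<comment> \<open>Absolute continuity of the trace is given only on compact intervals free of
      switching instants, hence the compact neighbourhood.\<close>
    obtain c d where cd: "s \<in> {c<..<d}" "{c..d} \<subseteq> ?S"
    proof
      show "s \<in> {(s0 + s) / 2<..<(s + t (2*k + 1)) / 2}" using s by auto
      show "{(s0 + s) / 2..(s + t (2*k + 1)) / 2} \<subseteq> ?S" using s by auto
    qed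
    have "c \<le> d" "{c..d} \<subseteq> {t0..} - t ` {1..}" using cd sub by auto
    then have "abs_cont_fun (u 0) c d"
      using loc unfolding loc_abs_cont_def by blast
    then have "continuous_on {c..d} (u 0)" by (rule abs_cont_imp_continuous_on)
    then have "continuous_on {c<..<d} (u 0)" by (rule continuous_on_subset) auto
    then show "isCont (u 0) s"
      using cd(1) by (simp add: continuous_on_eq_continuous_at)
  qed
  moreover have "finite (u 0 ` ?S)"
    by (rule finite_subset[of _ "{- \<xi>, 0, \<xi>, - \<mu> * \<xi>}"]) (intro image_subsetI val, simp_all)
  ultimately have "u 0 constant_on ?S"
    by (intro continuous_finite_range_constant) auto
  then obtain c where c: "\<And>s. s \<in> ?S \<Longrightarrow> u 0 s = c" by (auto simp: constant_on_def)
  have "(s0 + t (2*k + 1)) / 2 \<in> ?S" using s0(2) by auto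
  from val[OF this] c[OF this] have "c \<in> {- \<xi>, 0, \<xi>, - \<mu> * \<xi>}" by simp
  then have "\<bar>c\<bar> \<le> (1 + \<mu>) * \<xi>"
    using \<xi> \<mu>(1) by (auto simp: abs_mult algebra_simps)
  then have "\<bar>c\<bar>\<^sup>2 \<le> ((1 + \<mu>) * \<xi>)\<^sup>2" by (intro power_mono) auto
  then show thesis
    using that[OF c] by (simp add: power_mult_distrib \<xi>_def)
qed

text \<open>The stretch begins at the later of \<open>t0\<close> and the sampling instant, so
  \<open>\<tau>\<close> may be smaller than \<open>T2\<close>. On the right segment the decay from
  \<open>kappa2\<close> feeds the bound on the held input; the input bound so obtained limits the
  boundary value seen by the left segment.\<close>

lemma I2_stretch_aux:
  assumes k: "1 \<le> k" and s0: "s0 = max t0 (t (2*k))" "s0 < s1" and s1: "s1 = t (2*k + 1)"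
  defines "\<psi> \<equiv> \<alpha>2 powr (1/3) * V2 Y L u s0" and "B \<equiv> lift_cost Y L lam \<delta> * (1 + \<mu>)\<^sup>2" and "\<tau> \<equiv> s1 - s0"
  shows "\<psi> \<le> B + 1 + exp (rate * \<tau>) / \<tau>"
    and "s \<in> {s0..s1} \<Longrightarrow> V2 Y L u s \<le> exp (rate * \<tau>) * (\<psi> + \<tau> * B * \<psi>\<^sup>2)"
    and "s \<in> {s0..s1} \<Longrightarrow> V1 Y u s \<le> 4 * exp (rate * \<tau>) * V1 Y u s0
      + (2 * exp (rate * \<tau>) + 1) * ((1 + \<mu>)\<^sup>2 * \<psi>\<^sup>2 * Y)"
proof -
  obtain c where c: "\<And>s. s \<in> {s0<..<t (2*k + 1)} \<Longrightarrow> u 0 s = c"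
    "c\<^sup>2 \<le> (1 + \<mu>)\<^sup>2 * (\<alpha>2 powr (1/3) * V2 Y L u s0)\<^sup>2"
    by (rule I2_input_constant[OF k s0(1) s0(2)[unfolded s1]]) (rule that)
  note c = c[folded s1 \<psi>_def]
  have ac: "abs_cont_fun (\<lambda>s. energy a b k (state s)) s0 s1"
    if "0 \<le> a" "b \<le> L" for a b k
    using that s0 by (intro abs_cont_state_energy) auto
  have \<psi>0: "0 \<le> \<psi>" by (simp add: \<psi>_def V2_eq_energy energy_nonneg)
  have A: "0 \<le> lift_cost Y L lam \<delta>" using Y lam by (intro lift_cost_nonneg)
  have rate2: "rate_le (V2 Y L u) s0 s1 (\<lambda>s. rate * V2 Y L u s + (B * \<psi>\<^sup>2 - \<psi> ^ 3))"
    unfolding V2_eq_energy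
  proof (rule energy_inequality)
    fix s assume s: "s \<in> {s0<..<s1}" and D: "s \<in> {t0..} - t ` {1..}"
    note in2 = inputs_I2[OF k s[unfolded s0(1) s1]]
    let ?f = "state s" and ?z = "xderiv Y L 3 (state s) Y"
    have "net_growth lam Y L ?f \<le> lift_cost Y L lam \<delta> * (u Y s)\<^sup>2 + delta1 \<delta> * (2 * energy Y L 0 ?f)"
      by (rule H4_lifted_growth[OF Y(2) lam \<delta>(2) regular(2)[OF D] in2(3) regular(5,6)[OF D]])
    moreover have "lift_cost Y L lam \<delta> * (u Y s)\<^sup>2 \<le> B * \<psi>\<^sup>2"
      using mult_left_mono[OF c(2) A] c(1)[OF s] in2(2) by (simp add: B_def mult.assoc)
    moreover have "boundary_flux Y L 0 ?f = (u 0 s) ^ 3 / 3 + u 0 s * ?z"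
      using in2 by (simp add: boundary_flux_def)
    moreover have "(u 0 s) ^ 3 / 3 + u 0 s * ?z \<le> - (\<psi> ^ 3)"
      unfolding in2(1) s0(1)[symmetric] \<psi>_def[symmetric] by (rule kappa2_decay[OF \<psi>0 \<mu>])
    ultimately show "boundary_flux Y L 0 ?f + net_growth lam Y L ?f \<le> rate * energy Y L 0 ?f + (B * \<psi>\<^sup>2 - \<psi> ^ 3)"
      using delta1_energy_le[of Y L 0 ?f] by linarith
  qed (use s0 in simp_all)
  have g: "1 \<le> \<alpha>2 powr (1/3)" using \<alpha>2 by (simp add: ge_one_powr_ge_zero)
  have B: "0 \<le> B" using A by (simp add: B_def)
  have ac2: "abs_cont_fun (V2 Y L u) s0 s1"
    using ac[of Y L 0] Y by (simp add: V2_eq_energy)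
  have V2nn: "0 \<le> V2 Y L u s" for s by (simp add: V2_eq_energy energy_nonneg)
  note held = held_input_bound[OF ac2 V2nn s0(2) g \<psi>_def[THEN meta_eq_to_obj_eq] B rate_nonneg rate2]
  show "\<psi> \<le> B + 1 + exp (rate * \<tau>) / \<tau>" unfolding \<tau>_def by (rule held(1))
  show "V2 Y L u s \<le> exp (rate * \<tau>) * (\<psi> + \<tau> * B * \<psi>\<^sup>2)" if "s \<in> {s0..s1}"
    unfolding \<tau>_def using that by (rule held(2))
  \<comment> \<open>Both ends carry the constant \<open>c\<close>, so the flux relative to
    \<open>c\<close> is zero and the third derivatives at the ends disappear.\<close>
  have rate1: "rate_le (\<lambda>s. energy 0 Y c (state s)) s0 s1 (\<lambda>s. rate * energy 0 Y c (state s))"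
  proof (rule energy_inequality)
    fix s assume s: "s \<in> {s0<..<s1}" and D: "s \<in> {t0..} - t ` {1..}"
    have uc: "u 0 s = c" "u Y s = c" using c(1)[OF s] inputs_I2(2)[OF k s[unfolded s0(1) s1]] by simp_all
    show "boundary_flux 0 Y c (state s) + net_growth lam 0 Y (state s) \<le> rate * energy 0 Y c (state s)"
      using H4_clamped_growth[OF Y(1) lam \<delta>(1) regular(1)[OF D] uc regular(3,4)[OF D]]
        delta1_energy_le[of 0 Y c "state s"] uc by (simp add: boundary_flux_def)
  qed (use s0 in simp_all)
  show "V1 Y u s \<le> 4 * exp (rate * \<tau>) * V1 Y u s0
      + (2 * exp (rate * \<tau>) + 1) * ((1 + \<mu>)\<^sup>2 * \<psi>\<^sup>2 * Y)" if s: "s \<in> {s0..s1}"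
  proof -
    let ?E = "\<lambda>s. energy 0 Y c (state s)" and ?e = "exp (rate * \<tau>)"
    have L2: "in_L2 0 Y (state s)" if "t0 \<le> s" for s
      using in_L2_subinterval[OF in_L2_state[OF that]] Y by simp
    have "V1 Y u s \<le> 2 * ?E s + c\<^sup>2 * Y"
      using energy_shift_le[OF L2, of s 0 c] s s0 Y by (simp add: V1_eq_energy)
    also have "?E s \<le> exp (rate * (s - s0)) * ?E s0"
      using Y by (intro abs_cont_gronwall_homogeneous[OF ac s rate1]) auto
    also have "exp (rate * (s - s0)) * ?E s0 \<le> ?e * ?E s0"
      using s rate_nonneg by (intro mult_right_mono energy_nonneg) (auto simp: \<tau>_def intro: mult_left_mono)
    also have "?E s0 \<le> 2 * V1 Y u s0 + c\<^sup>2 * Y"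
      using energy_shift_le[OF L2, of s0 c 0] s0 Y by (simp add: V1_eq_energy)
    finally have "V1 Y u s \<le> 4 * ?e * V1 Y u s0 + (2 * ?e + 1) * (c\<^sup>2 * Y)"
      by (simp add: algebra_simps)
    also have "\<dots> \<le> 4 * ?e * V1 Y u s0 + (2 * ?e + 1) * ((1 + \<mu>)\<^sup>2 * \<psi>\<^sup>2 * Y)"
      using c(2) Y by (intro add_left_mono mult_left_mono mult_right_mono) (auto intro: add_nonneg_nonneg)
    finally show ?thesis .
  qed
qed

end

section \<open>Iteration over the cycles\<close>

context ks_setting
begin

definition lift_gain :: real where "lift_gain = lift_cost Y L lam \<delta> * (1 + \<mu>)\<^sup>2"

text \<open>The argument is \<open>T2\<close> or the remainder of a stretch already under way at
  \<open>t0\<close>. A short stretch leaves little time to drain the energy, so the bound blows up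
  as \<open>\<tau>\<close> tends to 0 from above; this is harmless because \<open>t0\<close> is
  fixed in advance.\<close>

definition input_bound :: "real \<Rightarrow> real" where
  "input_bound \<tau> = lift_gain + 1 + exp (rate * \<tau>) / \<tau>"

definition right_bound :: "real \<Rightarrow> real" where
  "right_bound \<tau> = exp (rate * \<tau>) * (input_bound \<tau> + \<tau> * lift_gain * (input_bound \<tau>)\<^sup>2)"

definition left_offset :: "real \<Rightarrow> real" where
  "left_offset \<tau> = (2 * exp (rate * \<tau>) + 1) * ((1 + \<mu>)\<^sup>2 * (input_bound \<tau>)\<^sup>2 * Y)"

definition left_bound :: "real \<Rightarrow> real \<Rightarrow> real" where
  "left_bound \<tau> e = 4 * exp (rate * \<tau>) * e + left_offset \<tau>"

lemma bounds_nonneg: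
  assumes "0 \<le> \<tau>"
  shows "0 \<le> lift_gain" "0 \<le> input_bound \<tau>" "0 \<le> right_bound \<tau>" "0 \<le> left_offset \<tau>"
    "0 \<le> e \<Longrightarrow> 0 \<le> left_bound \<tau> e"
proof -
  show lg: "0 \<le> lift_gain" using Y lam lift_cost_nonneg by (simp add: lift_gain_def)
  then show ib: "0 \<le> input_bound \<tau>" using assms by (simp add: input_bound_def)
  show "0 \<le> right_bound \<tau>" using lg ib assms by (simp add: right_bound_def)
  show lo: "0 \<le> left_offset \<tau>" using Y by (simp add: left_offset_def)
  show "0 \<le> left_bound \<tau> e" if "0 \<le> e" using lo that by (simp add: left_bound_def)
qed

lemma left_bound_mono: "e \<le> e' \<Longrightarrow> left_bound \<tau> e \<le> left_bound \<tau> e'"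
  by (simp add: left_bound_def)

lemma le_left_bound:
  assumes "0 \<le> \<tau>" "0 \<le> e" shows "e \<le> left_bound \<tau> e"
proof -
  have "1 \<le> exp (rate * \<tau>)" using assms(1) rate_nonneg by simp
  then have "1 \<le> 4 * exp (rate * \<tau>)" by linarith
  then have "1 * e \<le> 4 * exp (rate * \<tau>) * e" using assms(2) by (rule mult_right_mono)
  then show ?thesis using bounds_nonneg(4)[OF assms(1)] by (simp add: left_bound_def)
qed

lemma switch_time_add: "1 \<le> k \<Longrightarrow> t (2 * (k + n)) = t (2 * k) + n * (T1 + T2)"
proof (induction n)
  case (Suc n)
  have "2 * (k + Suc n) - 1 = 2 * (k + n) + 1" by simp
  then show ?case
    using len1[of "k + Suc n"] len2[of "k + n"] Suc by (simp add: algebra_simps)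
qed simp

lemma switch_time_unbounded:
  assumes "1 \<le> k" obtains n where "s < t (2 * (k + n))"
proof -
  obtain n where "s - t (2 * k) < real n * (T1 + T2)"
    using reals_Archimedean3[of "T1 + T2"] T1 T2 by (metis add_pos_pos)
  then show thesis using that switch_time_add[OF assms] by (metis diff_less_eq add.commute)
qed

text \<open>Index of the first cycle lying entirely after \<open>t0\<close>: its sampling instant
  \<open>t (2 * k0)\<close> is the first that is certainly preceded by a full stretch of length
  \<open>T1\<close>, and so by a contraction of \<open>V1\<close> that a large
  \<open>\<alpha>1\<close> makes arbitrarily strong.\<close>

definition k0 :: nat where "k0 = (LEAST k. 1 \<le> k \<and> t0 \<le> t (2 * k - 1))"

lemma k0:
  "1 \<le> k0" "t0 \<le> t (2 * k0 - 1)"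
  "1 < k0 \<Longrightarrow> t (2 * (k0 - 1) - 1) < t0"
  "k0 = 1 \<Longrightarrow> t (2 * k0 - 1) = t0"
proof -
  let ?P = "\<lambda>k. 1 \<le> k \<and> t0 \<le> t (2 * k - 1)"
  obtain n where "t0 < t (2 * (1 + n))" using switch_time_unbounded[of 1] by auto
  then have "?P (1 + n + 1)" using t_less[of "2 * (1 + n)" "2 * (1 + n + 1) - 1"] by simp
  then have "?P k0" unfolding k0_def by (rule LeastI)
  then show "1 \<le> k0" "t0 \<le> t (2 * k0 - 1)" by auto
  show "t (2 * (k0 - 1) - 1) < t0" if "1 < k0"
    using not_less_Least[of "k0 - 1" ?P, folded k0_def] that by auto
  show "t (2 * k0 - 1) = t0" if "k0 = 1"
    using \<open>?P k0\<close> that t1 t0 by simp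
qed

definition lead_time :: real where "lead_time = t (2 * k0 - 1) - t0"

text \<open>A sum in place of a distinction of the position of \<open>t0\<close> within its cycle:
  each position is covered by some of the summands. All of them are nonnegative, also for
  \<open>lead_time = 0\<close>, where division by zero yields 0.\<close>

definition transient_bound :: "real \<Rightarrow> real" where
  "transient_bound e = exp (rate * T1) * e + right_bound T2 + right_bound lead_time
     + left_bound T2 e + left_bound lead_time e"

text \<open>The 1 is the level below which \<open>V1\<close> is kept at the sampling instants.
  Neither this bound nor \<open>steady_right\<close> involves \<open>\<beta>\<close>, which makes
  the ultimate bound uniform in the initial data.\<close>

definition steady_left :: real where "steady_left = left_bound T2 1"

definition steady_right :: real where "steady_right = exp (rate * T1) * right_bound T2"

lemma steady_bounds_nonneg: "0 \<le> steady_left" "0 \<le> steady_right"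
  using bounds_nonneg(5)[of T2 1] bounds_nonneg(3)[of T2] T2 by (simp_all add: steady_left_def steady_right_def)

lemma lead_time_nonneg: "0 \<le> lead_time"
  using k0 by (simp add: lead_time_def)

lemma one_le_exp_rate: "1 \<le> exp (rate * T1)"
  using rate_nonneg T1 by simp

lemma transient_bound_ge:
  assumes "0 \<le> e"
  shows "e \<le> transient_bound e" "exp (rate * T1) * e \<le> transient_bound e"
    "right_bound T2 \<le> transient_bound e" "right_bound lead_time \<le> transient_bound e"
    "left_bound T2 e \<le> transient_bound e" "left_bound lead_time e \<le> transient_bound e"
    "0 \<le> transient_bound e"
proof -
  have "0 \<le> exp (rate * T1) * e" using assms by simp
  note nn = this bounds_nonneg[OF less_imp_le[OF T2]] bounds_nonneg[OF lead_time_nonneg]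
    bounds_nonneg(5)[OF less_imp_le[OF T2] assms] bounds_nonneg(5)[OF lead_time_nonneg assms]
  show "exp (rate * T1) * e \<le> transient_bound e" "right_bound T2 \<le> transient_bound e"
    "right_bound lead_time \<le> transient_bound e"
    "left_bound T2 e \<le> transient_bound e" "left_bound lead_time e \<le> transient_bound e"
    using nn by (simp_all add: transient_bound_def)
  show "e \<le> transient_bound e"
    using le_left_bound[OF less_imp_le[OF T2] assms] \<open>left_bound T2 e \<le> transient_bound e\<close> by linarith
  then show "0 \<le> transient_bound e" using assms by linarith
qed

lemma large_left_gain:
  assumes "0 < \<eta>"
  shows "\<exists>\<alpha>s. \<forall>\<alpha>\<ge>\<alpha>s. 0 < \<alpha> + 2 * delta1 \<delta> \<and> exp (- \<alpha> * T1) * m \<le> \<eta>"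
\<comment> \<open>The first entry keeps \<open>l1\<close> positive, the second solves the
  exponential inequality; \<open>\<bar>m\<bar> + 1\<close> makes the argument of the logarithm
  positive for either sign of \<open>m\<close>.\<close>
proof (intro exI[of _ "max (1 - 2 * delta1 \<delta>) (ln ((\<bar>m\<bar> + 1) / \<eta>) / T1)"] allI impI conjI)
  fix \<alpha> assume a: "max (1 - 2 * delta1 \<delta>) (ln ((\<bar>m\<bar> + 1) / \<eta>) / T1) \<le> \<alpha>"
  then show "0 < \<alpha> + 2 * delta1 \<delta>" by simp
  have "ln ((\<bar>m\<bar> + 1) / \<eta>) \<le> \<alpha> * T1" using a T1 by (simp add: pos_divide_le_eq)
  then have "exp (ln ((\<bar>m\<bar> + 1) / \<eta>)) \<le> exp (\<alpha> * T1)" by simp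
  then have "(\<bar>m\<bar> + 1) / \<eta> \<le> exp (\<alpha> * T1)" using assms by simp
  then have "exp (- \<alpha> * T1) * ((\<bar>m\<bar> + 1) / \<eta>) \<le> exp (- \<alpha> * T1) * exp (\<alpha> * T1)"
    by (intro mult_left_mono) auto
  also have "\<dots> = 1" by (simp flip: exp_add)
  finally have "exp (- \<alpha> * T1) * (\<bar>m\<bar> + 1) \<le> \<eta>" using assms by (simp add: field_simps)
  moreover have "exp (- \<alpha> * T1) * m \<le> exp (- \<alpha> * T1) * (\<bar>m\<bar> + 1)"
    by (intro mult_left_mono) auto
  ultimately show "exp (- \<alpha> * T1) * m \<le> \<eta>" by linarith
qed

end

section \<open>Bounds along a closed-loop solution\<close>

context ks_closed_loop
begin

lemma V_nonneg: "0 \<le> V1 Y u s" "0 \<le> V2 Y L u s"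
  by (simp_all add: V1_eq_energy V2_eq_energy energy_nonneg)

text \<open>Replacing the held input by its bound removes \<open>\<alpha>2\<close> from all
  estimates; this is why the threshold for \<open>\<alpha>1\<close> can be chosen uniformly in
  \<open>\<alpha>2\<close>.\<close>

lemma I2_stretch:
  assumes k: "1 \<le> k" and s0: "s0 = max t0 (t (2*k))" "s0 < t (2*k + 1)" and \<tau>: "\<tau> = t (2*k + 1) - s0"
  shows "\<alpha>2 powr (1/3) * V2 Y L u s0 \<le> input_bound \<tau>"
    and "s \<in> {s0..t (2*k + 1)} \<Longrightarrow> V2 Y L u s \<le> right_bound \<tau>"
    and "s \<in> {s0..t (2*k + 1)} \<Longrightarrow> V1 Y u s \<le> left_bound \<tau> (V1 Y u s0)"
proof -
  let ?\<psi> = "\<alpha>2 powr (1/3) * V2 Y L u s0"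
  note aux = I2_stretch_aux[OF k s0 refl, folded \<tau> lift_gain_def]
  have \<tau>0: "0 \<le> \<tau>" using s0(2) \<tau> by simp
  show \<psi>: "?\<psi> \<le> input_bound \<tau>" unfolding input_bound_def by (rule aux(1))
  have \<psi>2: "?\<psi>\<^sup>2 \<le> (input_bound \<tau>)\<^sup>2"
    using \<psi> V_nonneg by (intro power_mono) auto
  show "V2 Y L u s \<le> right_bound \<tau>" if s: "s \<in> {s0..t (2*k + 1)}"
  proof -
    have "V2 Y L u s \<le> exp (rate * \<tau>) * (?\<psi> + \<tau> * lift_gain * ?\<psi>\<^sup>2)" using s by (rule aux(2))
    also have "\<dots> \<le> right_bound \<tau>"
      unfolding right_bound_def using \<psi> \<psi>2 \<tau>0 bounds_nonneg(1)[OF \<tau>0]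
      by (intro mult_left_mono add_mono mult_nonneg_nonneg) auto
    finally show ?thesis .
  qed
  show "V1 Y u s \<le> left_bound \<tau> (V1 Y u s0)" if s: "s \<in> {s0..t (2*k + 1)}"
  proof -
    have "V1 Y u s \<le> 4 * exp (rate * \<tau>) * V1 Y u s0
      + (2 * exp (rate * \<tau>) + 1) * ((1 + \<mu>)\<^sup>2 * ?\<psi>\<^sup>2 * Y)" using s by (rule aux(3))
    also have "\<dots> \<le> left_bound \<tau> (V1 Y u s0)"
      unfolding left_bound_def left_offset_def using \<psi>2 Y
      by (intro add_left_mono mult_left_mono mult_right_mono) (auto intro: add_nonneg_nonneg)
    finally show ?thesis .
  qed
qed

lemma I1_stretch_bounds:
  assumes k: "1 \<le> k" and s0: "s0 = max t0 (t (2*k - 1))" and s: "s \<in> {s0..t (2*k)}" and \<alpha>: "0 \<le> \<alpha>1"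
  shows "V1 Y u s \<le> V1 Y u s0" (is ?left) "V2 Y L u s \<le> exp (rate * T1) * V2 Y L u s0" (is ?right)
proof -
  have "s - s0 \<le> T1" "0 \<le> s - s0" using s s0 len1[OF k] by auto
  then have e: "exp (- \<alpha>1 * (s - s0)) \<le> 1" "exp (rate * (s - s0)) \<le> exp (rate * T1)"
    using \<alpha> rate_nonneg by (auto intro: mult_left_mono)
  show ?left
    using I1_stretch(1)[OF k s0 s] mult_right_mono[OF e(1) V_nonneg(1)[of s0]] by simp
  show ?right
    using I1_stretch(2)[OF k s0 s] mult_right_mono[OF e(2) V_nonneg(2)[of s0]] by simp
qed

text \<open>Before the first full cycle there are three situations: \<open>t0\<close> is itself the
  start of that cycle; it lies in an \<open>I1\<close> stretch, which a full \<open>I2\<close>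
  stretch follows; or it lies in an \<open>I2\<close> stretch, of which only
  \<open>lead_time\<close> is left.\<close>

lemma lead_bound:
  assumes \<alpha>: "0 \<le> \<alpha>1" and e: "V1 Y u t0 \<le> e" "V2 Y L u t0 \<le> e" and s: "s \<in> {t0..t (2 * k0 - 1)}"
  shows "V1 Y u s \<le> transient_bound e \<and> V2 Y L u s \<le> transient_bound e"
proof -
  have e0: "0 \<le> e" using e(1) V_nonneg(1)[of t0] by linarith
  note tb = transient_bound_ge[OF e0]
  show ?thesis
  proof (cases "s = t0")
    case True
    then show ?thesis using e tb(1) by auto
  next
    case False
    then have ne: "t0 < s" "t0 < t (2 * k0 - 1)" using s by auto
    then have "k0 \<noteq> 1" using k0(4) by auto
    then obtain j where j: "k0 = j + 1" "1 \<le> j"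
      using k0(1) by (metis add.commute le_Suc_ex le_antisym not_less_eq_eq One_nat_def plus_1_eq_Suc)
    \<comment> \<open>The end of the \<open>I2\<close> stretch of cycle \<open>j\<close> is the
      start of cycle \<open>k0 = j + 1\<close>.\<close>
    have fc: "2 * k0 - 1 = 2 * j + 1" using j by simp
    have before: "t (2 * j - 1) < t0" using k0(3) j by simp
    show ?thesis
    proof (cases "t0 < t (2 * j)")
      case True
      have s0: "t0 = max t0 (t (2 * j - 1))" using before by simp
      note I1b = I1_stretch_bounds[OF j(2) s0 _ \<alpha>]
      have "exp (rate * T1) * V2 Y L u t0 \<le> exp (rate * T1) * e"
        using e(2) by (rule mult_left_mono) simp
      then have I1: "V1 Y u r \<le> e" "V2 Y L u r \<le> exp (rate * T1) * e" if "r \<in> {t0..t (2 * j)}" for r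
        using I1b[OF that] e(1) by linarith+
      show ?thesis
      proof (cases "s \<le> t (2 * j)")
        case True
        then show ?thesis using I1[of s] tb s by auto
      next
        case False
        have m: "t (2 * j) = max t0 (t (2 * j))" "t (2 * j) < t (2 * j + 1)" using True t_less[of "2*j"] j by auto
        have s': "s \<in> {t (2 * j)..t (2 * j + 1)}" using False s fc by simp
        note I2 = I2_stretch[OF j(2) m len2[OF j(2), symmetric]]
        have "left_bound T2 (V1 Y u (t (2 * j))) \<le> left_bound T2 e"
          using I1(1)[of "t (2 * j)"] True by (intro left_bound_mono) auto
        then show ?thesis using I2(2,3)[OF s'] tb by linarith
      qed
    next
      case False
      have m: "t0 = max t0 (t (2 * j))" "t0 < t (2 * j + 1)" using False ne fc by auto
      have s': "s \<in> {t0..t (2 * j + 1)}" using s fc by simp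
      note I2 = I2_stretch[OF j(2) m lead_time_def[unfolded fc]]
      have "left_bound lead_time (V1 Y u t0) \<le> left_bound lead_time e"
        using e by (intro left_bound_mono)
      then show ?thesis using I2(2,3)[OF s'] tb by linarith
    qed
  qed
qed

context
  fixes e \<eta> :: real
  assumes \<alpha>1_pos: "0 \<le> \<alpha>1" and e: "V1 Y u t0 \<le> e" "V2 Y L u t0 \<le> e"
    and gain: "exp (- \<alpha>1 * T1) * (transient_bound e + steady_left) \<le> \<eta>" and \<eta>: "\<eta> \<le> 1"
begin

lemma e_nonneg: "0 \<le> e"
  using e(1) V_nonneg(1)[of t0] by linarith

text \<open>One gain condition serves all cycles: the first full cycle starts from at most
  \<open>transient_bound e\<close>, every later one from at most \<open>steady_left\<close>.\<close>

lemma contraction: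
  assumes "x \<le> transient_bound e \<or> x \<le> steady_left"
  shows "exp (- \<alpha>1 * T1) * x \<le> \<eta>"
proof -
  have "x \<le> transient_bound e + steady_left"
    using assms steady_bounds_nonneg transient_bound_ge(7)[OF e_nonneg] by auto
  then have "exp (- \<alpha>1 * T1) * x \<le> exp (- \<alpha>1 * T1) * (transient_bound e + steady_left)"
    by (intro mult_left_mono) auto
  then show ?thesis using gain by linarith
qed

lemma transient:
  assumes s: "s \<in> {t0..t (2 * k0)}"
  shows "V1 Y u s \<le> exp (rate * T1) * transient_bound e" "V2 Y L u s \<le> exp (rate * T1) * transient_bound e"
proof -
  let ?M = "transient_bound e"
  have M: "?M \<le> exp (rate * T1) * ?M"
    using mult_right_mono[OF one_le_exp_rate transient_bound_ge(7)[OF e_nonneg]] by simp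
  have "V1 Y u s \<le> exp (rate * T1) * ?M \<and> V2 Y L u s \<le> exp (rate * T1) * ?M"
  proof (cases "s \<le> t (2 * k0 - 1)")
    case True
    then show ?thesis using lead_bound[OF \<alpha>1_pos e, of s] s M by auto
  next
    case False
    have s0: "t (2 * k0 - 1) = max t0 (t (2 * k0 - 1))" using k0(2) by simp
    have "s \<in> {t (2 * k0 - 1)..t (2 * k0)}" using False s by simp
    note b = I1_stretch_bounds[OF k0(1) s0 this \<alpha>1_pos]
    have start: "V1 Y u (t (2 * k0 - 1)) \<le> ?M" "V2 Y L u (t (2 * k0 - 1)) \<le> ?M"
      using lead_bound[OF \<alpha>1_pos e, of "t (2 * k0 - 1)"] k0(2) by auto
    have "exp (rate * T1) * V2 Y L u (t (2 * k0 - 1)) \<le> exp (rate * T1) * ?M"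
      using start(2) by (intro mult_left_mono) auto
    then show ?thesis using b start M by linarith
  qed
  then show "V1 Y u s \<le> exp (rate * T1) * ?M" "V2 Y L u s \<le> exp (rate * T1) * ?M" by auto
qed

lemma left_at_sample:
  assumes k: "1 \<le> k" "t0 \<le> t (2*k - 1)"
    and x: "V1 Y u (t (2*k - 1)) \<le> transient_bound e \<or> V1 Y u (t (2*k - 1)) \<le> steady_left"
  shows "V1 Y u (t (2*k)) \<le> \<eta>"
proof -
  have s0: "t (2*k - 1) = max t0 (t (2*k - 1))" using k by simp
  have "t (2*k - 1) \<le> t (2*k)" using len1[OF k(1)] T1 by simp
  then have "V1 Y u (t (2*k)) \<le> exp (- \<alpha>1 * (t (2*k) - t (2*k - 1))) * V1 Y u (t (2*k - 1))"
    by (intro I1_stretch(1)[OF k(1) s0]) simp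
  also have "\<dots> \<le> \<eta>" unfolding len1[OF k(1)] using x by (rule contraction)
  finally show ?thesis .
qed

text \<open>\<open>V1\<close> is small by what happened before, over a full \<open>I1\<close>
  stretch. \<open>V2\<close> is bounded by what comes after: a larger sample would drive it below
  zero during the next \<open>I2\<close> stretch.\<close>

lemma first_sample:
  "V1 Y u (t (2 * k0)) \<le> \<eta>"
  "\<alpha>2 powr (1/3) * V2 Y L u (t (2 * k0)) \<le> input_bound T2" (is ?right)
proof -
  show "V1 Y u (t (2 * k0)) \<le> \<eta>"
    using lead_bound[OF \<alpha>1_pos e, of "t (2 * k0 - 1)"] k0(2)
    by (intro left_at_sample k0) auto
  have "t0 \<le> t (2 * k0)" using k0(2) len1[OF k0(1)] T1 by linarith
  then have m: "t (2 * k0) = max t0 (t (2 * k0))" by simp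
  have "t (2 * k0) < t (2 * k0 + 1)" using len2[OF k0(1)] T2 by linarith
  then show ?right
    by (rule I2_stretch(1)[OF k0(1) m _ len2[OF k0(1), symmetric]])
qed

text \<open>Only \<open>V1 \<le> \<eta>\<close> at the sampling instants has to be propagated.
  \<open>V2\<close> requires no induction hypothesis, because \<open>right_bound T2\<close> holds
  over an \<open>I2\<close> stretch whatever its initial value, and the following \<open>I1\<close>
  stretch adds a fixed factor.\<close>

lemma steady_cycle:
  assumes k: "k0 \<le> k" and start: "V1 Y u (t (2*k)) \<le> \<eta>"
  shows "V1 Y u (t (2*(k + 1))) \<le> \<eta>"
    and "s \<in> {t (2*k)..t (2*(k + 1))} \<Longrightarrow> V1 Y u s \<le> steady_left \<and> V2 Y L u s \<le> steady_right"
proof -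
  have k1: "1 \<le> k" using k k0(1) by linarith
  have "t (2 * k0 - 1) \<le> t (2*k - 1)"
    using k k0(1) by (intro t_le) linarith+
  then have "t0 \<le> t (2*k - 1)" using k0(2) by linarith
  then have tk: "t0 \<le> t (2*k)" "t (2*k) < t (2*k + 1)" using len1[OF k1] len2[OF k1] T1 T2 by linarith+
  then have m: "t (2*k) = max t0 (t (2*k))" by simp
  have fc: "2 * (k + 1) - 1 = 2 * k + 1" by simp
  note I2 = I2_stretch[OF k1 m tk(2) len2[OF k1, symmetric]]
  have I2b: "V1 Y u r \<le> steady_left" "V2 Y L u r \<le> right_bound T2" if "r \<in> {t (2*k)..t (2*k + 1)}" for r
    using I2(2,3)[OF that] left_bound_mono[of "V1 Y u (t (2*k))" 1 T2] start \<eta> unfolding steady_left_def by linarith+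
  have mid: "t (2*k + 1) \<in> {t (2*k)..t (2*k + 1)}" using tk by simp
  have t0': "t0 \<le> t (2*(k + 1) - 1)" using tk by (simp only: fc)
  show "V1 Y u (t (2*(k + 1))) \<le> \<eta>"
    using I2b(1)[OF mid] by (intro left_at_sample t0') (simp_all only: fc, simp)
  have R: "right_bound T2 \<le> steady_right"
    using mult_right_mono[OF one_le_exp_rate bounds_nonneg(3)[of T2]] T2 by (simp add: steady_right_def)
  show "V1 Y u s \<le> steady_left \<and> V2 Y L u s \<le> steady_right" if s: "s \<in> {t (2*k)..t (2*(k + 1))}"
  proof (cases "s \<le> t (2*k + 1)")
    case True
    then have "s \<in> {t (2*k)..t (2*k + 1)}" using s by simp
    from I2b[OF this] R show ?thesis by linarith
  next
    case False
    have "t (2*k + 1) = max t0 (t (2*(k + 1) - 1))" "s \<in> {t (2*k + 1)..t (2*(k + 1))}"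
      using False s t0' by (simp_all add: fc)
    note b = I1_stretch_bounds[OF le_add2 this \<alpha>1_pos]
    have "exp (rate * T1) * V2 Y L u (t (2*k + 1)) \<le> steady_right"
      unfolding steady_right_def using I2b(2)[OF mid] by (rule mult_left_mono) simp
    then show ?thesis using b I2b(1)[OF mid] by linarith
  qed
qed

lemma steady:
  assumes s: "t (2 * k0) \<le> s"
  shows "V1 Y u s \<le> steady_left" (is ?left) "V2 Y L u s \<le> steady_right" (is ?right)
proof -
  have sample: "V1 Y u (t (2 * (k0 + n))) \<le> \<eta>" for n
  proof (induction n)
    case 0
    then show ?case using first_sample(1) by simp
  next
    case (Suc n)
    then show ?case using steady_cycle(1)[of "k0 + n"] by simp
  qed
  have "s \<le> t (2 * (k0 + n)) \<Longrightarrow> V1 Y u s \<le> steady_left \<and> V2 Y L u s \<le> steady_right" for n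
  proof (induction n)
    case 0
    have "t (2 * k0) \<le> t (2 * (k0 + 1))"
      using t_less[of "2 * k0" "2 * (k0 + 1)"] k0(1) by simp
    then show ?case using 0 s steady_cycle(2)[of k0 s] first_sample(1) by auto
  next
    case (Suc n)
    show ?case
    proof (cases "s \<le> t (2 * (k0 + n))")
      case False
      then show ?thesis using Suc.prems steady_cycle(2)[of "k0 + n" s] sample[of n] by auto
    qed (rule Suc.IH)
  qed
  moreover obtain n where "s < t (2 * (k0 + n))"
    using switch_time_unbounded[OF k0(1)] .
  ultimately show ?left ?right by (meson less_imp_le)+
qed

end

lemma norm_split:
  assumes "t0 \<le> s"
  shows "(L2norm 0 L (state s))\<^sup>2 = 2 * V1 Y u s + 2 * V2 Y L u s"
  using L2norm_split[OF in_L2_state[OF assms], of Y] Y by (simp add: V1_eq_energy V2_eq_energy)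

lemma norm_le:
  assumes "t0 \<le> s" "V1 Y u s \<le> a" "V2 Y L u s \<le> b" "2 * a + 2 * b \<le> \<gamma>\<^sup>2" "0 \<le> \<gamma>"
  shows "L2norm 0 L (state s) \<le> \<gamma>"
proof (rule power2_le_imp_le)
  show "(L2norm 0 L (state s))\<^sup>2 \<le> \<gamma>\<^sup>2" using norm_split[OF assms(1)] assms(2-4) by linarith
qed fact

lemma initial_energy:
  assumes "L2norm 0 L (state t0) \<le> \<beta>"
  shows "V1 Y u t0 \<le> \<beta>\<^sup>2" (is ?left) "V2 Y L u t0 \<le> \<beta>\<^sup>2" (is ?right)
proof -
  have "(L2norm 0 L (state t0))\<^sup>2 \<le> \<beta>\<^sup>2" using assms L2norm_nonneg by (rule power_mono)
  then show ?left ?right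
    using norm_split[of t0] V_nonneg[of t0] by linarith+
qed

end

section \<open>Choice of the gains\<close>

context ks_setting
begin

definition settling_time :: real where "settling_time = t (2 * k0) - t0"

lemma settling_time_pos: "0 < settling_time"
  using k0(2) len1[OF k0(1)] T1 unfolding settling_time_def by linarith

lemma ks_closed_loopI:
  assumes "0 < \<alpha>1 + 2 * delta1 \<delta>" "1 \<le> \<alpha>2" "admissible_k1 Y lam \<delta> \<alpha>1 k1"
    "closed_loop_solution L Y lam t \<delta> \<mu> \<alpha>1 \<alpha>2 k1 t0 u"
  shows "ks_closed_loop L Y lam T1 T2 \<delta> \<mu> t0 t \<alpha>1 \<alpha>2 k1 u"
  using assms by unfold_locales

lemma practically_attractive:
  assumes "0 < \<epsilon>"
  shows "\<exists>\<alpha>2s>0. \<forall>\<alpha>2\<ge>\<alpha>2s. \<exists>\<alpha>1s. \<forall>\<alpha>1\<ge>\<alpha>1s. \<alpha>1 > 0 \<longrightarrow>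
          (\<forall>k1 u. admissible_k1 Y lam \<delta> \<alpha>1 k1 \<and>
             closed_loop_solution L Y lam t \<delta> \<mu> \<alpha>1 \<alpha>2 k1 t0 u \<and>
             L2norm 0 L (\<lambda>x. u x t0) \<le> \<beta> \<longrightarrow>
             (\<exists>T>0. L2norm 0 L (\<lambda>x. u x (t0 + T)) \<le> \<epsilon>))"
proof -
  \<comment> \<open>The squared norm is \<open>2 * V1 + 2 * V2\<close>, so each energy may use
    \<open>\<epsilon>\<^sup>2 / 4\<close>; the cap at 1 is the level built into
    \<open>steady_left\<close>.\<close>
  define \<eta> where "\<eta> = min 1 (\<epsilon>\<^sup>2 / 4)"
  have \<eta>: "0 < \<eta>" "\<eta> \<le> 1" "\<eta> \<le> \<epsilon>\<^sup>2 / 4" using assms by (simp_all add: \<eta>_def)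
  \<comment> \<open>For \<open>\<alpha>2\<close> above \<open>r ^ 3\<close> the bound on the sampled
    input becomes \<open>r * V2 \<le> input_bound T2\<close>, that is,
    \<open>V2 \<le> \<epsilon>\<^sup>2 / 4\<close>.\<close>
  define r where "r = 4 * input_bound T2 / \<epsilon>\<^sup>2"
  have r: "0 \<le> r" using bounds_nonneg(2)[of T2] T2 by (simp add: r_def)
  obtain \<alpha>1s where large: "\<And>\<alpha>1. \<alpha>1s \<le> \<alpha>1 \<Longrightarrow> 0 < \<alpha>1 + 2 * delta1 \<delta> \<and>
      exp (- \<alpha>1 * T1) * (transient_bound (\<beta>\<^sup>2) + steady_left) \<le> \<eta>"
    using large_left_gain[OF \<eta>(1)] by blast
  show ?thesis
  proof (rule exI[of _ "max 1 (r ^ 3)"], rule conjI, simp, intro allI impI, rule exI[of _ \<alpha>1s],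
      intro allI impI, rule exI[of _ settling_time], rule conjI[OF settling_time_pos])
    fix \<alpha>2 \<alpha>1 k1 u
    assume a2: "max 1 (r ^ 3) \<le> \<alpha>2" and a1: "\<alpha>1s \<le> \<alpha>1" "0 < \<alpha>1"
      and sol: "admissible_k1 Y lam \<delta> \<alpha>1 k1 \<and> closed_loop_solution L Y lam t \<delta> \<mu> \<alpha>1 \<alpha>2 k1 t0 u \<and>
             L2norm 0 L (\<lambda>x. u x t0) \<le> \<beta>"
    interpret ks_closed_loop L Y lam T1 T2 \<delta> \<mu> t0 t \<alpha>1 \<alpha>2 k1 u
      by (rule ks_closed_loopI) (use a2 large[OF a1(1)] sol in auto)
    have init: "V1 Y u t0 \<le> \<beta>\<^sup>2" "V2 Y L u t0 \<le> \<beta>\<^sup>2" using initial_energy sol by auto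
    have gain: "exp (- \<alpha>1 * T1) * (transient_bound (\<beta>\<^sup>2) + steady_left) \<le> \<eta>" using large[OF a1(1)] by simp
    note fs = first_sample[OF less_imp_le[OF a1(2)] init gain \<eta>(2)]
    have "(r ^ 3) powr (1/3) \<le> \<alpha>2 powr (1/3)" using a2 r by (intro powr_mono2) auto
    moreover have "(r ^ 3) powr (1/3) = r"
      using powr_powr[of r 3 "1/3"] r by simp
    ultimately have "r * V2 Y L u (t (2 * k0)) \<le> \<alpha>2 powr (1/3) * V2 Y L u (t (2 * k0))"
      using V_nonneg by (intro mult_right_mono) auto
    then have "r * V2 Y L u (t (2 * k0)) \<le> input_bound T2" using fs(2) by linarith
    moreover have "0 < input_bound T2"
    proof -
      have "0 \<le> lift_gain" "0 \<le> exp (rate * T2) / T2" using bounds_nonneg(1)[of T2] T2 by auto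
      then show ?thesis by (simp add: input_bound_def)
    qed
    ultimately have "V2 Y L u (t (2 * k0)) \<le> \<epsilon>\<^sup>2 / 4"
      using assms by (simp add: r_def field_simps)
    then show "L2norm 0 L (\<lambda>x. u x (t0 + settling_time)) \<le> \<epsilon>"
      using fs(1) \<eta>(3) assms settling_time_pos
      by (intro norm_le[where a = "\<epsilon>\<^sup>2 / 4" and b = "\<epsilon>\<^sup>2 / 4"]) (auto simp: settling_time_def)
  qed
qed

definition steady_bound :: real where "steady_bound = sqrt (2 * steady_left + 2 * steady_right) + 1"

lemma steady_bound:
  "0 < steady_bound" "2 * steady_left + 2 * steady_right \<le> steady_bound\<^sup>2"
  using steady_bounds_nonneg by (simp_all add: steady_bound_def add_nonneg_pos power2_sum)

text \<open>Boundedness and ultimate boundedness share one choice of \<open>\<alpha>1\<close>, with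
  \<open>\<eta> = 1\<close> because no smallness is demanded. \<open>\<gamma>\<close> grows with
  \<open>\<beta>\<close> through the transient; \<open>steady_bound\<close> and
  \<open>settling_time\<close> do not.\<close>

lemma transient_and_steady:
  "\<exists>\<gamma>>0. \<exists>\<alpha>1s. \<forall>\<alpha>1\<ge>\<alpha>1s. \<alpha>1 > 0 \<longrightarrow>
     (\<forall>\<alpha>2 k1 u. 1 \<le> \<alpha>2 \<and> admissible_k1 Y lam \<delta> \<alpha>1 k1 \<and>
         closed_loop_solution L Y lam t \<delta> \<mu> \<alpha>1 \<alpha>2 k1 t0 u \<and> L2norm 0 L (\<lambda>x. u x t0) \<le> \<beta> \<longrightarrow>
       (\<forall>s\<ge>0. L2norm 0 L (\<lambda>x. u x (t0 + s)) \<le> \<gamma>) \<and>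
       (\<forall>s\<ge>settling_time. L2norm 0 L (\<lambda>x. u x (t0 + s)) \<le> steady_bound))"
proof -
  define M where "M = exp (rate * T1) * transient_bound (\<beta>\<^sup>2)"
  have M: "0 \<le> M" using transient_bound_ge(7)[of "\<beta>\<^sup>2"] by (simp add: M_def)
  define \<gamma> where "\<gamma> = sqrt (4 * M) + steady_bound"
  have \<gamma>: "0 < \<gamma>" "steady_bound \<le> \<gamma>" using steady_bound(1) M by (simp_all add: \<gamma>_def add_nonneg_pos)
  have "(sqrt (4 * M))\<^sup>2 \<le> \<gamma>\<^sup>2" using steady_bound(1) M by (intro power_mono) (auto simp: \<gamma>_def)
  then have \<gamma>2: "2 * M + 2 * M \<le> \<gamma>\<^sup>2" using M by simp
  obtain \<alpha>1s where large: "\<And>\<alpha>1. \<alpha>1s \<le> \<alpha>1 \<Longrightarrow> 0 < \<alpha>1 + 2 * delta1 \<delta> \<and>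
      exp (- \<alpha>1 * T1) * (transient_bound (\<beta>\<^sup>2) + steady_left) \<le> 1"
    using large_left_gain[OF zero_less_one] by blast
  show ?thesis
  proof (rule exI[of _ \<gamma>], rule conjI[OF \<gamma>(1)], rule exI[of _ \<alpha>1s], intro allI impI conjI)
    fix \<alpha>1 \<alpha>2 k1 u s
    assume a1: "\<alpha>1s \<le> \<alpha>1" "0 < \<alpha>1"
      and sol: "1 \<le> \<alpha>2 \<and> admissible_k1 Y lam \<delta> \<alpha>1 k1 \<and>
         closed_loop_solution L Y lam t \<delta> \<mu> \<alpha>1 \<alpha>2 k1 t0 u \<and> L2norm 0 L (\<lambda>x. u x t0) \<le> \<beta>"
    interpret ks_closed_loop L Y lam T1 T2 \<delta> \<mu> t0 t \<alpha>1 \<alpha>2 k1 u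
      by (rule ks_closed_loopI) (use large[OF a1(1)] sol in auto)
    have init: "V1 Y u t0 \<le> \<beta>\<^sup>2" "V2 Y L u t0 \<le> \<beta>\<^sup>2" using initial_energy sol by auto
    have gain: "exp (- \<alpha>1 * T1) * (transient_bound (\<beta>\<^sup>2) + steady_left) \<le> 1" using large[OF a1(1)] by simp
    note st = steady[OF less_imp_le[OF a1(2)] init gain order_refl]
    note tr = transient[OF less_imp_le[OF a1(2)] init gain order_refl, folded M_def]
    have late: "L2norm 0 L (\<lambda>x. u x (t0 + r)) \<le> steady_bound" if "settling_time \<le> r" for r
      using that settling_time_pos steady_bound st[of "t0 + r"]
      by (intro norm_le[where a = steady_left and b = steady_right]) (auto simp: settling_time_def)
    show "L2norm 0 L (\<lambda>x. u x (t0 + s)) \<le> steady_bound" if "settling_time \<le> s" using that by (rule late)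
    show "L2norm 0 L (\<lambda>x. u x (t0 + s)) \<le> \<gamma>" if "0 \<le> s"
    proof (cases "settling_time \<le> s")
      case True
      then show ?thesis using late[of s] \<gamma>(2) by linarith
    next
      case False
      then show ?thesis using that tr[of "t0 + s"] \<gamma> \<gamma>2
        by (intro norm_le[where a = M and b = M]) (auto simp: settling_time_def)
    qed
  qed
qed

end

theorem theorem2:
  fixes L Y lam T1 T2 \<delta> \<mu> t0 :: real and t :: "nat \<Rightarrow> real"
  assumes "0 < L" and "0 < Y" and "Y < L" and "0 \<le> lam"
    and "t 1 = 0" and "\<And>i. i \<ge> 1 \<Longrightarrow> t i < t (i + 1)"
    and "0 < T1" and "0 < T2"
    and "\<And>k. k \<ge> 1 \<Longrightarrow> t (2*k) - t (2*k - 1) = T1"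
    and "\<And>k. k \<ge> 1 \<Longrightarrow> t (2*k + 1) - t (2*k) = T2"
    and "\<delta> \<le> delta_o lam 0 Y" and "\<delta> \<le> delta_o lam Y L"
    and "0 < \<mu>" and "- (\<mu> ^ 3) + 6 * \<mu> + 3 \<le> 0"
    and "0 \<le> t0"
  shows
    "(\<forall>\<beta> \<epsilon>. 0 < \<epsilon> \<and> \<epsilon> < \<beta> \<longrightarrow>
        (\<exists>\<alpha>2s>0. \<forall>\<alpha>2\<ge>\<alpha>2s. \<exists>\<alpha>1s. \<forall>\<alpha>1\<ge>\<alpha>1s. \<alpha>1 > 0 \<longrightarrow>
          (\<forall>k1 u. admissible_k1 Y lam \<delta> \<alpha>1 k1 \<and>
             closed_loop_solution L Y lam t \<delta> \<mu> \<alpha>1 \<alpha>2 k1 t0 u \<and>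
             L2norm 0 L (\<lambda>x. u x t0) \<le> \<beta> \<longrightarrow>
             (\<exists>T>0. L2norm 0 L (\<lambda>x. u x (t0 + T)) \<le> \<epsilon>))))
     \<and>
     (\<forall>\<beta>>0. \<exists>\<gamma>>0. \<exists>\<alpha>2s>0. \<forall>\<alpha>2\<ge>\<alpha>2s. \<exists>\<alpha>1s. \<forall>\<alpha>1\<ge>\<alpha>1s. \<alpha>1 > 0 \<longrightarrow>
        (\<forall>k1 u. admissible_k1 Y lam \<delta> \<alpha>1 k1 \<and>
           closed_loop_solution L Y lam t \<delta> \<mu> \<alpha>1 \<alpha>2 k1 t0 u \<and>
           L2norm 0 L (\<lambda>x. u x t0) \<le> \<beta> \<longrightarrow>
           (\<forall>s\<ge>0. L2norm 0 L (\<lambda>x. u x (t0 + s)) \<le> \<gamma>)))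
     \<and>
     (\<exists>\<gamma>>0. \<forall>\<beta>>0. \<exists>\<alpha>2s>0. \<forall>\<alpha>2\<ge>\<alpha>2s. \<exists>\<alpha>1s. \<forall>\<alpha>1\<ge>\<alpha>1s. \<alpha>1 > 0 \<longrightarrow>
        (\<forall>k1 u. admissible_k1 Y lam \<delta> \<alpha>1 k1 \<and>
           closed_loop_solution L Y lam t \<delta> \<mu> \<alpha>1 \<alpha>2 k1 t0 u \<and>
           L2norm 0 L (\<lambda>x. u x t0) \<le> \<beta> \<longrightarrow>
           (\<exists>T>0. \<forall>s\<ge>T. L2norm 0 L (\<lambda>x. u x (t0 + s)) \<le> \<gamma>)))"
proof -
  interpret ks_setting L Y lam T1 T2 \<delta> \<mu> t0 t
    using assms by unfold_locales
  show ?thesis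
    (is "(\<forall>\<beta> \<epsilon>. _ \<longrightarrow> ?A \<beta> \<epsilon>) \<and> (\<forall>\<beta>>0. \<exists>\<gamma>>0. ?B \<beta> \<gamma>) \<and> (\<exists>\<gamma>>0. \<forall>\<beta>>0. ?C \<gamma> \<beta>)")
  proof (intro conjI allI impI)
    show "?A \<beta> \<epsilon>" if "0 < \<epsilon> \<and> \<epsilon> < \<beta>" for \<beta> \<epsilon>
      using that by (intro practically_attractive) simp
    show "\<exists>\<gamma>>0. ?B \<beta> \<gamma>" for \<beta>
    proof -
      obtain \<gamma> \<alpha>1s where \<gamma>: "0 < \<gamma>" and b: "\<And>\<alpha>1 \<alpha>2 k1 u s. \<lbrakk>\<alpha>1s \<le> \<alpha>1; 0 < \<alpha>1; 1 \<le> \<alpha>2;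
          admissible_k1 Y lam \<delta> \<alpha>1 k1; closed_loop_solution L Y lam t \<delta> \<mu> \<alpha>1 \<alpha>2 k1 t0 u;
          L2norm 0 L (\<lambda>x. u x t0) \<le> \<beta>; 0 \<le> s\<rbrakk> \<Longrightarrow> L2norm 0 L (\<lambda>x. u x (t0 + s)) \<le> \<gamma>"
        using transient_and_steady[of \<beta>] by blast
      show ?thesis
        \<comment> \<open>The threshold 1 for \<open>\<alpha>2\<close> suffices here: it makes the
          held input dominate the sampled energy, and a larger gain matters only for the smallness
          in the first claim.\<close>
        by (rule exI[of _ \<gamma>], rule conjI[OF \<gamma>], rule exI[of _ 1], rule conjI[OF zero_less_one],
            intro allI impI, rule exI[of _ \<alpha>1s], intro allI impI, rule b) auto
    qed
    show "\<exists>\<gamma>>0. \<forall>\<beta>>0. ?C \<gamma> \<beta>"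
    proof (rule exI[of _ steady_bound], rule conjI[OF steady_bound(1)], intro allI impI)
      fix \<beta> :: real
      obtain \<alpha>1s where b: "\<And>\<alpha>1 \<alpha>2 k1 u s. \<lbrakk>\<alpha>1s \<le> \<alpha>1; 0 < \<alpha>1; 1 \<le> \<alpha>2;
          admissible_k1 Y lam \<delta> \<alpha>1 k1; closed_loop_solution L Y lam t \<delta> \<mu> \<alpha>1 \<alpha>2 k1 t0 u;
          L2norm 0 L (\<lambda>x. u x t0) \<le> \<beta>; settling_time \<le> s\<rbrakk> \<Longrightarrow> L2norm 0 L (\<lambda>x. u x (t0 + s)) \<le> steady_bound"
        using transient_and_steady[of \<beta>] by blast
      show "?C steady_bound \<beta>"
        by (rule exI[of _ 1], rule conjI[OF zero_less_one], intro allI impI, rule exI[of _ \<alpha>1s],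
            intro allI impI, rule exI[of _ settling_time], rule conjI[OF settling_time_pos],
            intro allI impI, rule b) auto
    qed
  qed
qed

end
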